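(* Let $r\ge 1$ be an integer and let $f\in L_{2\pi}$ be a complex valued function such that both $\{\hat{f}(n)\}_{n=0}^{+\infty}\in \mathrm{GBV}$ and $\{\hat{f}(-n)\}_{n=1}^{+\infty}\in \mathrm{GBV}$. If $f$ has absolutely continuous derivatives up to order $r-1$ (i.e. $f,f',\dots,f^{(r-1)}$ are absolutely continuous), then $$\|f-S_{n}(f)\|=O\left((n+1)^{-r}\,\omega\left(f^{(r)}, (n+1)^{-1}\right)_{L}\right)$$ if and only if $$\hat{f}(n)\log|n|=O\left((|n|+1)^{-r}\,\omega\left(f^{(r)}, (|n|+1)^{-1}\right)_{L}\right),$$ where the first estimate is for $n\to\infty$ and the second for $|n|\to\infty$.
   Context: $L_{2\pi}$ is the space of all real or complex valued integrable functions $f$ of period $2\pi$ with norm $\|f\|=\int_{-\pi}^{\pi}|f(x)|\,dx$. The Fourier series of $f$ is $\sum_{k=-\infty}^{\infty}\hat f(k)e^{ikx}$, with $\hat f(k)=\frac1{2\pi}\int_{-\pi}^{\pi}f(x)e^{-ikx}dx$, and $S_n(f)=S_n(f,x)=\sum_{k=-n}^{n}\hat f(k)e^{ikx}$. The modulus of continuity in the integral metric is $\omega(g,t)_L=\max_{0\le h\le t}\|g(x+h)-g(x)\|$ (norm taken in the variable $x$). For a sequence $\{c_n\}$, $\Delta c_n=c_n-c_{n+1}$. The constants implied in $O$ are independent of $n$. For $\theta\in[0,\pi/2)$ put $K(\theta)=\{z\in\mathbb{C}:|\arg z|\le\theta\}$ (with $0\in K(\theta)$). Class GBV: a complex sequence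 $\mathbf c=\{c_n\}_{n=1}^\infty$ belongs to GBV if there is $\theta_1\in[0,\pi/2)$ with $c_n\in K(\theta_1)$ for all $n=1,2,\dots$, and there are a natural number $N_0\ge1$ and a positive constant $M(\mathbf c)$ depending only on $\mathbf c$ such that $$\sum_{n=m}^{2m}|\Delta c_n|\le M(\mathbf c)\max_{m\le n<m+N_0}|c_n|\quad\text{for all } m=1,2,\dots.$$ For a sequence indexed from $n=0$, membership in GBV means that these conditions hold for its terms with index $n\ge1$. *)

theory Defs
  imports "HOL-Analysis.Analysis" "HOL-Library.Landau_Symbols"
begin

definition L2pi :: "(real \<Rightarrow> complex) set" where
  "L2pi = {f. (\<forall>x. f (x + 2 * pi) = f x) \<and> f absolutely_integrable_on {-pi..pi}}"

definition L1_norm :: "(real \<Rightarrow> complex) \<Rightarrow> real" where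
  "L1_norm f = (LINT x:{-pi..pi}|lebesgue. norm (f x))"

definition fourier_coeff :: "(real \<Rightarrow> complex) \<Rightarrow> int \<Rightarrow> complex" where
  "fourier_coeff f k =
     complex_of_real (1 / (2 * pi)) *
       (LINT x:{-pi..pi}|lebesgue. f x * exp (- \<i> * of_int k * complex_of_real x))"

definition fourier_partial_sum :: "(real \<Rightarrow> complex) \<Rightarrow> nat \<Rightarrow> real \<Rightarrow> complex" where
  "fourier_partial_sum f n x =
     (\<Sum>k = - int n..int n. fourier_coeff f k * exp (\<i> * of_int k * complex_of_real x))"

(* For g in L2pi the map h |-> L1_norm (g(. + h) - g) is continuous, so this
   supremum is attained: it is the maximum over 0 \<le> h \<le> t. *)
definition modulus_L :: "(real \<Rightarrow> complex) \<Rightarrow> real \<Rightarrow> real" where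
  "modulus_L g t = (SUP h\<in>{0..t}. L1_norm (\<lambda>x. g (x + h) - g x))"

(* Arg takes values in (-pi, pi], and Arg 0 = 0, so 0 belongs to every cone. *)
definition arg_cone :: "real \<Rightarrow> complex set" where
  "arg_cone \<theta> = {z. \<bar>Arg z\<bar> \<le> \<theta>}"

(* Only the terms with index n \<ge> 1 are constrained; the value c 0 is irrelevant. *)
definition GBV :: "(nat \<Rightarrow> complex) \<Rightarrow> bool" where
  "GBV c \<longleftrightarrow>
     (\<exists>\<theta>\<in>{0..<pi/2}. \<forall>n\<ge>1. c n \<in> arg_cone \<theta>) \<and>
     (\<exists>N\<ge>1. \<exists>M>0. \<forall>m\<ge>1.
        (\<Sum>n = m..2 * m. norm (c n - c (Suc n))) \<le> M * Max ((\<lambda>n. norm (c n)) ` {m..<m + N}))"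

(* The epsilon-delta definition; a division D of a subset of S is a finite family of
   compact intervals [Inf k, Sup k] in S with disjoint interiors. *)
definition absolutely_continuous_on :: "real set \<Rightarrow> (real \<Rightarrow> complex) \<Rightarrow> bool" where
  "absolutely_continuous_on S f \<longleftrightarrow>
     (\<forall>\<epsilon>>0. \<exists>\<delta>>0. \<forall>D T. D division_of T \<and> T \<subseteq> S \<and> (\<Sum>k\<in>D. Sup k - Inf k) < \<delta> \<longrightarrow>
        (\<Sum>k\<in>D. norm (f (Sup k) - f (Inf k))) < \<epsilon>)"

(* At points where f is not differentiable, vector_derivative takes one fixed arbitrary
   value; for an almost everywhere differentiable f this only affects a null set. *)
definition nth_vderiv :: "nat \<Rightarrow> (real \<Rightarrow> complex) \<Rightarrow> real \<Rightarrow> complex" where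
  "nth_vderiv k f = ((\<lambda>g x. vector_derivative g (at x)) ^^ k) f"

end

theory Submission
  imports Defs
begin

text \<open>
  Write \<open>c k\<close> for the Fourier coefficients of \<open>f\<close>, \<open>S_n\<close> for its partial sums, \<open>\<omega>\<close> for the integral
  modulus of continuity of the \<open>r\<close>-th derivative and \<open>\<psi> n = (n + 1)^(-r) \<omega>(1/(n + 1))\<close>. The function
  \<open>\<psi>\<close> is decreasing and \<open>\<psi> n\<close> is at most a constant times \<open>\<psi> (2 n)\<close>, so it may be compared at indices
  within a bounded ratio. The equivalence rests on three estimates.

  Jackson's inequality. If a function \<open>h\<close> has no frequencies in \<open>[-n, n]\<close>, then its norm is at most
  a constant times \<open>\<omega>(h, 1/(n + 1))\<close>, because \<open>h\<close> is annihilated by convolution with a kernel of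
  degree \<open>n\<close> that is concentrated near \<open>0\<close> (\<open>spectral_gap_norm_le_modulus\<close>). The remainder
  \<open>f - V_n f\<close> of the de la Vallee Poussin mean has such a gap, and so have its derivatives, which are
  the remainders of the derivatives of \<open>f\<close>. Passing to a derivative replaces \<open>\<omega>(h, 1/(n + 1))\<close> by
  \<open>1/(n + 1)\<close> times the norm of the derivative, and \<open>r\<close> such steps give
  \<open>||f - V_n f|| = O(\<psi> n)\<close> (\<open>vdp_rest_norm_le_modulus\<close>).

  From the remainder to the coefficients. The Fejer means of the sawtooth series \<open>\<Sum> sin (k x) / k\<close> are
  uniformly bounded. Testing \<open>f - S_n\<close> against such a mean, modulated by \<open>e^(i n x)\<close>, bounds the sum
  of \<open>c (n + k) / k\<close>, up to harmless weights, by \<open>||f - S_n||\<close>: the coefficients on one side of \<open>n\<close>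
  have been subtracted away, so the oddness of the sine produces no cancellation. The cone condition
  replaces the coefficients in the sum by their absolute values, and the variation condition of GBV
  bounds \<open>c (2 n)\<close> by a few consecutive terms starting at every \<open>n + k\<close>. The harmonic sum then yields
  \<open>|c (2 n)| log n = O(||f - S_n||)\<close> (\<open>hardy_type_bound\<close>, \<open>GBV_log_bound\<close>).

  From the coefficients to the remainder. \<open>V_n f - S_n\<close> consists of two blocks of frequencies between
  \<open>n\<close> and \<open>2 n\<close>. Summation by parts, the variation condition and the logarithmic growth of the norms
  of the Dirichlet kernels bound each block by \<open>log n\<close> times the largest coefficient just after \<open>n\<close>
  (\<open>GBV_block_norm_le\<close>).

  All this needs the \<open>r\<close>-th derivative to be a genuine density of the absolutely continuous
  \<open>(r - 1)\<close>-st derivative. This is the theorem of Lebesgue that opens the development: an absolutely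
  continuous function is a difference of increasing ones whose Stieltjes measures have a density by
  the Radon-Nikodym theorem, and the density is almost everywhere the derivative.
\<close>

section \<open>Absolutely continuous functions are indefinite integrals\<close>

text \<open>
  A finite family of nonoverlapping intervals is kept as a set of pairs of endpoints, with degenerate
  intervals excluded. Families on adjacent or separated intervals are then disjoint as sets, so sums
  over their union split without correction terms.
\<close>

definition subintervals :: "real \<Rightarrow> real \<Rightarrow> (real \<times> real) set \<Rightarrow> bool" where
  "subintervals a b P \<longleftrightarrow> finite P \<and> (\<forall>(p,q)\<in>P. a \<le> p \<and> p < q \<and> q \<le> b) \<and>
     (\<forall>(p,q)\<in>P. \<forall>(p',q')\<in>P. (p,q) \<noteq> (p',q') \<longrightarrow> q \<le> p' \<or> q' \<le> p)"

lemma subintervals_finite: "subintervals a b P \<Longrightarrow> finite P"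
  by (simp add: subintervals_def)

lemma subintervals_bounds:
  "subintervals a b P \<Longrightarrow> (p,q) \<in> P \<Longrightarrow> a \<le> p \<and> p < q \<and> q \<le> b"
  by (auto simp: subintervals_def)

lemma subintervals_separated:
  "subintervals a b P \<Longrightarrow> (p,q) \<in> P \<Longrightarrow> (p',q') \<in> P \<Longrightarrow> (p,q) \<noteq> (p',q') \<Longrightarrow> q \<le> p' \<or> q' \<le> p"
  unfolding subintervals_def by blast

lemma subintervalsI:
  assumes "finite P" "\<And>p q. (p,q) \<in> P \<Longrightarrow> a \<le> p \<and> p < q \<and> q \<le> b"
    "\<And>p q p' q'. (p,q) \<in> P \<Longrightarrow> (p',q') \<in> P \<Longrightarrow> (p,q) \<noteq> (p',q') \<Longrightarrow> q \<le> p' \<or> q' \<le> p"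
  shows "subintervals a b P"
  using assms unfolding subintervals_def by blast

lemma subintervals_single: "a \<le> p \<Longrightarrow> p < q \<Longrightarrow> q \<le> b \<Longrightarrow> subintervals a b {(p,q)}"
  by (auto simp: subintervals_def)

lemma subintervals_empty: "subintervals a b {}"
  by (auto simp: subintervals_def)

lemma subintervals_length:
  assumes P: "subintervals a b P" and "a \<le> b"
  shows "(\<Sum>(p,q)\<in>P. q - p) \<le> b - a"
proof -
  have fin: "finite P" using P by (rule subintervals_finite)
  have dis: "disjoint_family_on (\<lambda>(p,q). {p<..<q}) P"
    unfolding disjoint_family_on_def
  proof (intro ballI impI)
    fix z z' assume "z \<in> P" "z' \<in> P" "z \<noteq> z'"
    then show "(case z of (p,q) \<Rightarrow> {p<..<q}) \<inter> (case z' of (p,q) \<Rightarrow> {p<..<q}) = {}"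
      using subintervals_separated[OF P, of "fst z" "snd z" "fst z'" "snd z'"] by (auto simp: case_prod_beta)
  qed
  have "ennreal (\<Sum>(p,q)\<in>P. q - p) = (\<Sum>(p,q)\<in>P. ennreal (q - p))"
    using subintervals_bounds[OF P] by (subst sum_ennreal[symmetric]) (force simp: case_prod_beta)+
  also have "\<dots> = (\<Sum>x\<in>P. emeasure lborel (case x of (p,q) \<Rightarrow> {p<..<q}))"
    using subintervals_bounds[OF P] by (intro sum.cong) (force)+
  also have "\<dots> = emeasure lborel (\<Union>x\<in>P. case x of (p,q) \<Rightarrow> {p<..<q})"
    using dis fin by (intro sum_emeasure) auto
  also have "\<dots> \<le> emeasure lborel {a..b}"
    using subintervals_bounds[OF P] by (intro emeasure_mono) (force)+
  also have "\<dots> = ennreal (b - a)" using \<open>a \<le> b\<close> by simp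
  finally show ?thesis using \<open>a \<le> b\<close> by (simp add: ennreal_le_iff)
qed

lemma subintervals_division:
  assumes P: "subintervals a b P"
  shows "((\<lambda>(p,q). {p..q}) ` P) division_of (\<Union>((\<lambda>(p,q). {p..q}) ` P))"
    and "inj_on (\<lambda>(p,q). {p..q}) P"
proof -
  show inj: "inj_on (\<lambda>(p,q). {p..q}) P"
  proof (rule inj_onI, clarify)
    fix p q p' q' assume *: "(p,q) \<in> P" "(p',q') \<in> P" "{p..q} = {p'..q'}"
    then show "p = p' \<and> q = q'"
      using subintervals_bounds[OF P *(1)] subintervals_bounds[OF P *(2)] by (auto simp: Icc_eq_Icc)
  qed
  show "((\<lambda>(p,q). {p..q}) ` P) division_of (\<Union>((\<lambda>(p,q). {p..q}) ` P))"
  proof (rule division_ofI)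
    show "finite ((\<lambda>(p,q). {p..q}) ` P)" using subintervals_finite[OF P] by simp
  next
    fix K assume "K \<in> (\<lambda>(p,q). {p..q}) ` P"
    then obtain p q where K: "(p,q) \<in> P" "K = {p..q}" by auto
    show "K \<subseteq> \<Union>((\<lambda>(p,q). {p..q}) ` P)" using K by auto
    show "K \<noteq> {}" using subintervals_bounds[OF P K(1)] K by simp
    show "\<exists>a b. K = cbox a b" using K by auto
  next
    fix K1 K2 assume K: "K1 \<in> (\<lambda>(p,q). {p..q}) ` P" "K2 \<in> (\<lambda>(p,q). {p..q}) ` P" "K1 \<noteq> K2"
    then obtain p q p' q' where *: "(p,q) \<in> P" "K1 = {p..q}" "(p',q') \<in> P" "K2 = {p'..q'}" by auto
    with K have "(p,q) \<noteq> (p',q')" by auto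
    from subintervals_separated[OF P *(1) *(3) this]
    show "interior K1 \<inter> interior K2 = {}" using * by auto
  qed auto
qed

lemma absolutely_continuous_on_subintervals:
  assumes "absolutely_continuous_on {a..b} F" "0 < \<epsilon>"
  obtains \<delta> where "\<delta> > 0"
    "\<And>P. subintervals a b P \<Longrightarrow> (\<Sum>(p,q)\<in>P. q - p) < \<delta> \<Longrightarrow> (\<Sum>(p,q)\<in>P. norm (F q - F p)) < \<epsilon>"
proof -
  from assms obtain \<delta> where d: "\<delta> > 0"
    "\<And>D T. D division_of T \<and> T \<subseteq> {a..b} \<and> (\<Sum>k\<in>D. Sup k - Inf k) < \<delta> \<Longrightarrow>
        (\<Sum>k\<in>D. norm (F (Sup k) - F (Inf k))) < \<epsilon>"
    unfolding absolutely_continuous_on_def by meson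
  show ?thesis
  proof (rule that[OF d(1)])
    fix P assume P: "subintervals a b P" and less: "(\<Sum>(p,q)\<in>P. q - p) < \<delta>"
    let ?D = "(\<lambda>(p,q). {p..q}) ` P"
    have eq: "(\<Sum>k\<in>?D. g (Sup k) (Inf k)) = (\<Sum>(p,q)\<in>P. g q p)" for g :: "real \<Rightarrow> real \<Rightarrow> real"
    proof -
      have "(\<Sum>k\<in>?D. g (Sup k) (Inf k)) = (\<Sum>x\<in>P. g (Sup (case x of (p,q) \<Rightarrow> {p..q})) (Inf (case x of (p,q) \<Rightarrow> {p..q})))"
        by (subst sum.reindex[OF subintervals_division(2)[OF P]]) simp
      also have "\<dots> = (\<Sum>(p,q)\<in>P. g q p)"
      proof (intro sum.cong refl, clarify, goal_cases)
        case (1 p q)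
        then show ?case using subintervals_bounds[OF P 1] by simp
      qed
      finally show ?thesis .
    qed
    have "\<Union>?D \<subseteq> {a..b}" using subintervals_bounds[OF P] by force
    moreover have "(\<Sum>k\<in>?D. Sup k - Inf k) < \<delta>" using eq[of "\<lambda>x y. x - y"] less by simp
    ultimately have "(\<Sum>k\<in>?D. norm (F (Sup k) - F (Inf k))) < \<epsilon>"
      using d(2)[OF conjI, OF subintervals_division(1)[OF P]] by blast
    then show "(\<Sum>(p,q)\<in>P. norm (F q - F p)) < \<epsilon>" using eq[of "\<lambda>x y. norm (F x - F y)"] by simp
  qed
qed

text \<open>
  The total variation takes values in the extended nonnegative reals, so that its additivity can be
  proved before its finiteness.
\<close>

definition variation :: "(real \<Rightarrow> complex) \<Rightarrow> real \<Rightarrow> real \<Rightarrow> ennreal" where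
  "variation F a b = (SUP P\<in>Collect (subintervals a b). ennreal (\<Sum>(p,q)\<in>P. norm (F q - F p)))"

lemma variation_upper:
  "subintervals a b P \<Longrightarrow> ennreal (\<Sum>(p,q)\<in>P. norm (F q - F p)) \<le> variation F a b"
  unfolding variation_def by (rule SUP_upper) simp

lemma norm_diff_le_variation:
  assumes "p \<le> q" shows "ennreal (norm (F q - F p)) \<le> variation F p q"
  using variation_upper[of p q "{(p,q)}" F] subintervals_single[of p p q q] assms
  by (cases "p = q") auto

text \<open>
  At most one interval of a family contains the cutting point. Replacing every interval by its parts
  on either side can only increase the sum, by the triangle inequality.
\<close>

lemma variation_split_le:
  assumes "x \<le> c" "c \<le> y"
  shows "variation F x y \<le> variation F x c + variation F c y"
  unfolding variation_def[of F x y]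
proof (rule SUP_least, clarify)
  fix P assume P: "subintervals x y P"
  have fin: "finite P" using P by (rule subintervals_finite)
  define A where "A = {z\<in>P. fst z < c}"
  define B where "B = {z\<in>P. c < snd z}"
  define \<alpha> where "\<alpha> = (\<lambda>(p,q). (p::real, min q c))"
  define \<beta> where "\<beta> = (\<lambda>(p,q::real). (max p c, q))"
  have sub: "subintervals x c (\<alpha> ` A)"
  proof (rule subintervalsI)
    show "finite (\<alpha> ` A)" using fin by (simp add: A_def)
    fix p q assume "(p,q) \<in> \<alpha> ` A"
    then obtain q0 where z: "(p,q0) \<in> P" "q = min q0 c" "p < c" by (auto simp: A_def \<alpha>_def)
    then show "x \<le> p \<and> p < q \<and> q \<le> c" using subintervals_bounds[OF P z(1)] by auto
    fix p' q' assume "(p',q') \<in> \<alpha> ` A" and ne: "(p,q) \<noteq> (p',q')"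
    then obtain q0' where z': "(p',q0') \<in> P" "q' = min q0' c" "p' < c" by (auto simp: A_def \<alpha>_def)
    have "(p,q0) \<noteq> (p',q0')" using ne z z' by auto
    then show "q \<le> p' \<or> q' \<le> p" using subintervals_separated[OF P z(1) z'(1)] z z' by auto
  qed
  have inja: "inj_on \<alpha> A"
  proof (rule inj_onI, clarify)
    fix p q p' q' assume "(p,q) \<in> A" "(p',q') \<in> A" "\<alpha> (p,q) = \<alpha> (p',q')"
    then have *: "(p,q) \<in> P" "(p',q') \<in> P" "p = p'" by (auto simp: A_def \<alpha>_def)
    then show "p = p' \<and> q = q'"
      using subintervals_separated[OF P *(1) *(2)] subintervals_bounds[OF P *(1)] subintervals_bounds[OF P *(2)]
      by auto
  qed
  have sub': "subintervals c y (\<beta> ` B)"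
  proof (rule subintervalsI)
    show "finite (\<beta> ` B)" using fin by (simp add: B_def)
    fix p q assume "(p,q) \<in> \<beta> ` B"
    then obtain p0 where z: "(p0,q) \<in> P" "p = max p0 c" "c < q" by (auto simp: B_def \<beta>_def)
    then show "c \<le> p \<and> p < q \<and> q \<le> y" using subintervals_bounds[OF P z(1)] by auto
    fix p' q' assume "(p',q') \<in> \<beta> ` B" and ne: "(p,q) \<noteq> (p',q')"
    then obtain p0' where z': "(p0',q') \<in> P" "p' = max p0' c" "c < q'" by (auto simp: B_def \<beta>_def)
    have "(p0,q) \<noteq> (p0',q')" using ne z z' by auto
    then show "q \<le> p' \<or> q' \<le> p" using subintervals_separated[OF P z(1) z'(1)] z z' by auto
  qed
  have injb: "inj_on \<beta> B"
  proof (rule inj_onI, clarify)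
    fix p q p' q' assume "(p,q) \<in> B" "(p',q') \<in> B" "\<beta> (p,q) = \<beta> (p',q')"
    then have *: "(p,q) \<in> P" "(p',q') \<in> P" "q = q'" by (auto simp: B_def \<beta>_def)
    then show "p = p' \<and> q = q'"
      using subintervals_separated[OF P *(1) *(2)] subintervals_bounds[OF P *(1)] subintervals_bounds[OF P *(2)]
      by auto
  qed
  let ?n = "\<lambda>(p,q). norm (F q - F p)"
  have "(\<Sum>z\<in>P. ?n z) \<le> (\<Sum>z\<in>P. (if z \<in> A then ?n (\<alpha> z) else 0) + (if z \<in> B then ?n (\<beta> z) else 0))"
  proof (intro sum_mono, clarify)
    fix p q assume z: "(p,q) \<in> P"
    note b = subintervals_bounds[OF P z]
    have tri: "norm (F q - F p) \<le> norm (F c - F p) + norm (F q - F c)"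
      using norm_triangle_ineq[of "F c - F p" "F q - F c"] by simp
    show "norm (F q - F p) \<le> (if (p,q) \<in> A then ?n (\<alpha> (p,q)) else 0) + (if (p,q) \<in> B then ?n (\<beta> (p,q)) else 0)"
      using z b tri by (auto simp: A_def B_def \<alpha>_def \<beta>_def min_def max_def)
  qed
  also have "\<dots> = (\<Sum>z\<in>A. ?n (\<alpha> z)) + (\<Sum>z\<in>B. ?n (\<beta> z))"
    using fin by (simp add: sum.distrib sum.If_cases A_def B_def Int_def)
  also have "\<dots> = (\<Sum>z\<in>\<alpha> ` A. ?n z) + (\<Sum>z\<in>\<beta> ` B. ?n z)"
    by (simp add: sum.reindex[OF inja] sum.reindex[OF injb])
  finally have "ennreal (\<Sum>z\<in>P. ?n z) \<le> ennreal (\<Sum>z\<in>\<alpha> ` A. ?n z) + ennreal (\<Sum>z\<in>\<beta> ` B. ?n z)"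
    by (subst ennreal_plus[symmetric]) (auto intro!: sum_nonneg simp: ennreal_leI)
  also have "\<dots> \<le> variation F x c + variation F c y"
    by (intro add_mono variation_upper sub sub')
  finally show "ennreal (\<Sum>z\<in>P. ?n z) \<le> variation F x c + variation F c y" .
qed

lemma variation_join_le:
  assumes "x \<le> c" "c \<le> y"
  shows "variation F x c + variation F c y \<le> variation F x y"
proof -
  have key: "ennreal (\<Sum>(p,q)\<in>P. norm (F q - F p)) + ennreal (\<Sum>(p,q)\<in>Q. norm (F q - F p)) \<le> variation F x y"
    if P: "subintervals x c P" and Q: "subintervals c y Q" for P Q
  proof -
    have fin: "finite P" "finite Q" using P Q by (auto dest: subintervals_finite)
    have dis: "P \<inter> Q = {}"
      using subintervals_bounds[OF P] subintervals_bounds[OF Q] by force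
    have "subintervals x y (P \<union> Q)"
    proof (rule subintervalsI, goal_cases)
      case 1 then show ?case using fin by simp
    next
      case (2 p q) then show ?case using subintervals_bounds[OF P] subintervals_bounds[OF Q] assms by force
    next
      case (3 p q p' q')
      then show ?case
        using subintervals_bounds[OF P, of p q] subintervals_bounds[OF Q, of p q]
          subintervals_bounds[OF P, of p' q'] subintervals_bounds[OF Q, of p' q']
          subintervals_separated[OF P, of p q p' q'] subintervals_separated[OF Q, of p q p' q'] by auto
    qed
    from variation_upper[OF this, of F] show ?thesis
      by (subst ennreal_plus[symmetric]) (auto intro!: sum_nonneg simp: sum.union_disjoint[OF fin dis])
  qed
  have *: "(SUP Q\<in>Collect (subintervals c y). ennreal (\<Sum>(p,q)\<in>Q. norm (F q - F p)) + ennreal (\<Sum>(p,q)\<in>P. norm (F q - F p))) \<le> variation F x y"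
    if "subintervals x c P" for P
    by (intro SUP_least) (subst add.commute, rule key[OF that], simp)
  have ne: "Collect (subintervals u v) \<noteq> {}" for u v using subintervals_empty by blast
  have "ennreal (\<Sum>(p,q)\<in>P. norm (F q - F p)) + variation F c y \<le> variation F x y"
    if "subintervals x c P" for P
    using *[OF that] unfolding ennreal_SUP_add_left[OF ne] variation_def[of F c y] by (simp add: add.commute)
  then have "(SUP P\<in>Collect (subintervals x c). ennreal (\<Sum>(p,q)\<in>P. norm (F q - F p)) + variation F c y) \<le> variation F x y"
    by (intro SUP_least) auto
  then show ?thesis unfolding ennreal_SUP_add_left[OF ne] variation_def[of F x c] .
qed

lemma variation_add:
  "x \<le> c \<Longrightarrow> c \<le> y \<Longrightarrow> variation F x y = variation F x c + variation F c y"
  by (intro antisym variation_split_le variation_join_le)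

text \<open>
  Approximating finitely many suprema at the same time, one choice for each index. The summand \<open>c\<close>
  carries the terms already treated in the induction.
\<close>

lemma sum_SUP_le_ennreal:
  fixes f :: "'i \<Rightarrow> 'a \<Rightarrow> ennreal"
  assumes "finite I" "\<And>i. i \<in> I \<Longrightarrow> A i \<noteq> {}"
    and "\<And>Q. (\<And>i. i \<in> I \<Longrightarrow> Q i \<in> A i) \<Longrightarrow> c + (\<Sum>i\<in>I. f i (Q i)) \<le> e"
  shows "c + (\<Sum>i\<in>I. SUP q\<in>A i. f i q) \<le> e"
  using assms
proof (induction I arbitrary: c rule: finite_induct)
  case empty
  then show ?case by simp
next
  case (insert j I)
  have "f j q + c + (\<Sum>i\<in>I. SUP q\<in>A i. f i q) \<le> e" if q: "q \<in> A j" for q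
  proof (rule insert.IH)
    fix Q assume Q: "\<And>i. i \<in> I \<Longrightarrow> Q i \<in> A i"
    have "c + (\<Sum>i\<in>insert j I. f i ((Q(j := q)) i)) \<le> e"
      using Q q by (intro insert.prems) auto
    moreover have "(\<Sum>i\<in>I. f i ((Q(j := q)) i)) = (\<Sum>i\<in>I. f i (Q i))"
      using insert.hyps by (intro sum.cong) auto
    ultimately show "f j q + c + (\<Sum>i\<in>I. f i (Q i)) \<le> e"
      using insert.hyps by (simp add: ac_simps del: fun_upd_apply) (simp add: ac_simps)
  qed (use insert.prems in auto)
  then have "(SUP q\<in>A j. f j q + (c + (\<Sum>i\<in>I. SUP q\<in>A i. f i q))) \<le> e"
    by (intro SUP_least) (simp add: add.assoc)
  then have "(SUP q\<in>A j. f j q) + (c + (\<Sum>i\<in>I. SUP q\<in>A i. f i q)) \<le> e"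
    by (subst (asm) ennreal_SUP_add_left) (use insert.prems(1)[of j] in auto)
  then show ?case
    using insert.hyps by (simp add: ac_simps)
qed

text \<open>
  The variation function inherits absolute continuity: if each interval of a short family is refined
  by a family inside it, the union of the refinements is again a short family.
\<close>

lemma variation_absolutely_continuous:
  assumes ac: "absolutely_continuous_on {a..b} F" and "0 < \<epsilon>"
  obtains \<delta> where "\<delta> > 0"
    "\<And>P. subintervals a b P \<Longrightarrow> (\<Sum>(p,q)\<in>P. q - p) < \<delta> \<Longrightarrow> (\<Sum>(p,q)\<in>P. variation F p q) \<le> ennreal \<epsilon>"
proof -
  from absolutely_continuous_on_subintervals[OF assms] obtain \<delta> where d: "\<delta> > 0"
    "\<And>P. subintervals a b P \<Longrightarrow> (\<Sum>(p,q)\<in>P. q - p) < \<delta> \<Longrightarrow> (\<Sum>(p,q)\<in>P. norm (F q - F p)) < \<epsilon>" by blast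
  show ?thesis
  proof (rule that[OF d(1)])
    fix P assume P: "subintervals a b P" and less: "(\<Sum>(p,q)\<in>P. q - p) < \<delta>"
    have fin: "finite P" using P by (rule subintervals_finite)
    have "0 + (\<Sum>z\<in>P. SUP Q\<in>Collect (subintervals (fst z) (snd z)). ennreal (\<Sum>(p,q)\<in>Q. norm (F q - F p))) \<le> ennreal \<epsilon>"
    proof (rule sum_SUP_le_ennreal[OF fin])
      show "Collect (subintervals (fst z) (snd z)) \<noteq> {}" for z using subintervals_empty by blast
      fix Q assume "\<And>z. z \<in> P \<Longrightarrow> Q z \<in> Collect (subintervals (fst z) (snd z))"
      then have Q: "\<And>z. z \<in> P \<Longrightarrow> subintervals (fst z) (snd z) (Q z)" by simp
      let ?R = "\<Union>z\<in>P. Q z"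
      have finQ: "\<forall>z\<in>P. finite (Q z)" using Q subintervals_finite by blast
      have disQ: "\<forall>z\<in>P. \<forall>z'\<in>P. z \<noteq> z' \<longrightarrow> Q z \<inter> Q z' = {}"
      proof (intro ballI impI, rule ccontr)
        fix z z' assume z: "z \<in> P" "z' \<in> P" "z \<noteq> z'" "Q z \<inter> Q z' \<noteq> {}"
        then obtain p q where "(p,q) \<in> Q z" "(p,q) \<in> Q z'" by auto
        then have "fst z \<le> p" "p < q" "q \<le> snd z" "fst z' \<le> p" "q \<le> snd z'"
          using subintervals_bounds[OF Q[OF z(1)]] subintervals_bounds[OF Q[OF z(2)]] by auto
        then show False using subintervals_separated[OF P, of "fst z" "snd z" "fst z'" "snd z'"] z by auto
      qed
      have R: "subintervals a b ?R"
      proof (rule subintervalsI, goal_cases)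
        case 1 then show ?case using fin finQ by simp
      next
        case (2 p q)
        then obtain z where z: "z \<in> P" "(p,q) \<in> Q z" by auto
        then show ?case using subintervals_bounds[OF Q[OF z(1)] z(2)] subintervals_bounds[OF P, of "fst z" "snd z"] by auto
      next
        case (3 p q p' q')
        then obtain z z' where z: "z \<in> P" "(p,q) \<in> Q z" "z' \<in> P" "(p',q') \<in> Q z'" by auto
        show ?case
        proof (cases "z = z'")
          case True
          then show ?thesis using subintervals_separated[OF Q[OF z(1)] z(2)] z 3 by auto
        next
          case False
          then show ?thesis
            using subintervals_separated[OF P, of "fst z" "snd z" "fst z'" "snd z'"] z
              subintervals_bounds[OF Q[OF z(1)] z(2)] subintervals_bounds[OF Q[OF z(3)] z(4)] by auto
        qed
      qed
      have sumR: "(\<Sum>y\<in>?R. g y) = (\<Sum>z\<in>P. \<Sum>y\<in>Q z. g y)" for g :: "real \<times> real \<Rightarrow> real"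
        by (rule sum.UNION_disjoint[OF fin finQ disQ])
      have "(\<Sum>(p,q)\<in>?R. q - p) \<le> (\<Sum>z\<in>P. snd z - fst z)"
        unfolding sumR using Q subintervals_bounds[OF P]
        by (intro sum_mono subintervals_length) force+
      also have "\<dots> < \<delta>" using less by (simp add: case_prod_beta)
      finally have "(\<Sum>(p,q)\<in>?R. norm (F q - F p)) < \<epsilon>" using d(2) R by blast
      then have "(\<Sum>z\<in>P. \<Sum>(p,q)\<in>Q z. norm (F q - F p)) < \<epsilon>" unfolding sumR .
      then show "0 + (\<Sum>z\<in>P. ennreal (\<Sum>(p,q)\<in>Q z. norm (F q - F p))) \<le> ennreal \<epsilon>"
        by (subst sum_ennreal) (auto intro!: sum_nonneg ennreal_leI)
    qed
    then show "(\<Sum>(p,q)\<in>P. variation F p q) \<le> ennreal \<epsilon>"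
      by (simp add: variation_def case_prod_beta)
  qed
qed

text \<open>
  On an interval shorter than the \<open>\<delta>\<close> that belongs to \<open>\<epsilon> = 1\<close> the variation is at most 1, and
  finitely many such intervals suffice.
\<close>

lemma variation_finite:
  assumes ac: "absolutely_continuous_on {a..b} F" and "a \<le> x" "x \<le> y" "y \<le> b"
  shows "variation F x y < \<infinity>"
proof -
  obtain \<delta> where d: "\<delta> > 0"
    "\<And>P. subintervals a b P \<Longrightarrow> (\<Sum>(p,q)\<in>P. q - p) < \<delta> \<Longrightarrow> (\<Sum>(p,q)\<in>P. variation F p q) \<le> ennreal 1"
    using variation_absolutely_continuous[OF ac, of 1] by auto
  have eq0: "variation F u u = 0" for u
  proof -
    have "P = {}" if "subintervals u u P" for P using subintervals_bounds[OF that] by force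
    then have "Collect (subintervals u u) = {{}}" using subintervals_empty by blast
    then show ?thesis by (simp add: variation_def)
  qed
  have small: "variation F u v \<le> 1" if "a \<le> u" "u \<le> v" "v \<le> b" "v - u < \<delta>" for u v
    using d(2)[OF subintervals_single[of a u v b]] that eq0[of u] by (cases "u = v") auto
  have "variation F x y < \<infinity>" if "x \<le> y" "y \<le> b" "y - x \<le> real n * (\<delta> / 2)" for n y
    using that
  proof (induction n arbitrary: y)
    case 0
    then show ?case using eq0[of x] by simp
  next
    case (Suc n)
    define c where "c = max x (y - \<delta>/2)"
    have c: "x \<le> c" "c \<le> y" "y - c < \<delta>" "c - x \<le> real n * (\<delta>/2)"
      using Suc.prems d(1) by (auto simp: c_def max_def algebra_simps)
    have "variation F c y < \<infinity>" using small[of c y] c Suc.prems assms by (auto simp: order_le_less_trans)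
    moreover have "variation F x c < \<infinity>" using c Suc.prems by (intro Suc.IH) auto
    ultimately show ?case using variation_add[OF c(1,2), of F] by (simp add: ennreal_add_less_top)
  qed
  moreover obtain n where "(y - x) / (\<delta>/2) \<le> real n" using real_arch_simple by blast
  ultimately show ?thesis using assms d(1) by (simp add: divide_le_eq)
qed

text \<open>
  The way back from divisions to pairs; the one-point members of a division contribute nothing to
  the sums in question.
\<close>

lemma sum_over_division_eq_subintervals:
  fixes u :: "real \<Rightarrow> real"
  assumes D: "D division_of T" and T: "T \<subseteq> {a..b}"
  obtains P where "subintervals a b P"
    "\<And>w :: real \<Rightarrow> real. (\<Sum>(p,q)\<in>P. w q - w p) = (\<Sum>k\<in>D. w (Sup k) - w (Inf k))"
proof -
  have fin: "finite D" using D by auto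
  have ivl: "\<exists>p q. p \<le> q \<and> k = {p..q} \<and> a \<le> p \<and> q \<le> b" if "k \<in> D" for k
  proof -
    obtain p q where k: "k = cbox p q" using division_ofD(4)[OF D \<open>k \<in> D\<close>] by blast
    moreover have "k \<noteq> {}" "k \<subseteq> {a..b}" using division_ofD(2,3)[OF D \<open>k \<in> D\<close>] T by auto
    ultimately show ?thesis by (intro exI[of _ p] exI[of _ q]) auto
  qed
  define E where "E = {k\<in>D. Inf k < Sup k}"
  let ?e = "\<lambda>k::real set. (Inf k, Sup k)"
  have inj: "inj_on ?e E"
  proof (rule inj_onI)
    fix k l assume "k \<in> E" "l \<in> E" "(Inf k, Sup k) = (Inf l, Sup l)"
    then show "k = l" using ivl[of k] ivl[of l] by (auto simp: E_def)
  qed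
  have "subintervals a b (?e ` E)"
  proof (rule subintervalsI, goal_cases)
    case 1 then show ?case using fin by (simp add: E_def)
  next
    case (2 p q)
    then obtain k where "k \<in> E" "p = Inf k" "q = Sup k" by auto
    then show ?case using ivl[of k] by (auto simp: E_def)
  next
    case (3 p q p' q')
    then obtain k l where kl: "k \<in> E" "p = Inf k" "q = Sup k" "l \<in> E" "p' = Inf l" "q' = Sup l" by auto
    then have "k = {p..q}" "l = {p'..q'}" "p < q" "p' < q'" using ivl[of k] ivl[of l] by (auto simp: E_def)
    moreover have "interior k \<inter> interior l = {}"
      using division_ofD(5)[OF D, of k l] kl 3 by (auto simp: E_def)
    ultimately have "{max p p'<..<min q q'} = {}" by auto
    then show ?case using \<open>p < q\<close> \<open>p' < q'\<close> by (auto simp: greaterThanLessThan_empty_iff)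
  qed
  moreover have "(\<Sum>(p,q)\<in>?e ` E. w q - w p) = (\<Sum>k\<in>D. w (Sup k) - w (Inf k))" for w :: "real \<Rightarrow> real"
  proof -
    have "(\<Sum>(p,q)\<in>?e ` E. w q - w p) = (\<Sum>k\<in>E. w (Sup k) - w (Inf k))"
      by (subst sum.reindex[OF inj]) simp
    also have "\<dots> = (\<Sum>k\<in>D. w (Sup k) - w (Inf k))"
    proof (rule sum.mono_neutral_left[OF fin])
      show "\<forall>k\<in>D - E. w (Sup k) - w (Inf k) = 0"
      proof
        fix k assume "k \<in> D - E"
        then have "k \<in> D" "\<not> Inf k < Sup k" by (auto simp: E_def)
        with ivl[of k] have "Inf k = Sup k" by auto
        then show "w (Sup k) - w (Inf k) = 0" by simp
      qed
    qed (simp add: E_def)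
    finally show ?thesis .
  qed
  ultimately show ?thesis by (rule that)
qed

text \<open>
  The Stieltjes measure of \<open>u\<close> vanishes on Lebesgue null sets: such a set lies in an open set of small
  Lebesgue measure, which is exhausted by finite unions of intervals, and on these absolute continuity
  bounds the Stieltjes measure. The density is the one given by the Radon-Nikodym theorem.
\<close>

lemma monotone_absolutely_continuous_density:
  fixes u :: "real \<Rightarrow> real"
  assumes "a < b"
    and mono: "\<And>x y. a \<le> x \<Longrightarrow> x \<le> y \<Longrightarrow> y \<le> b \<Longrightarrow> u x \<le> u y"
    and ac: "\<And>\<epsilon>. \<epsilon> > 0 \<Longrightarrow> \<exists>\<delta>>0. \<forall>P. subintervals a b P \<and> (\<Sum>(p,q)\<in>P. q - p) < \<delta> \<longrightarrow>
               (\<Sum>(p,q)\<in>P. u q - u p) \<le> \<epsilon>"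
  obtains g :: "real \<Rightarrow> real" where "g \<in> borel_measurable borel"
    "set_integrable lborel {a..b} g" "\<And>x. x \<in> {a..b} \<Longrightarrow> (LINT t:{a..x}|lborel. g t) = u x - u a"
proof -
  define cl where "cl = (\<lambda>x. max a (min b x))"
  define v where "v = (\<lambda>x. u (cl x))"
  have cl: "a \<le> cl x" "cl x \<le> b" "x \<le> y \<Longrightarrow> cl x \<le> cl y" "x \<le> y \<Longrightarrow> cl y - cl x \<le> y - x" for x y
    using \<open>a < b\<close> by (auto simp: cl_def)
  have v_eq: "v x = u x" if "x \<in> {a..b}" for x using that by (auto simp: v_def cl_def max_def min_def)
  have v_mono: "v x \<le> v y" if "x \<le> y" for x y
    unfolding v_def using cl that by (intro mono) auto
  have v_cont: "continuous_on UNIV v"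
  proof (clarsimp simp: continuous_on_iff)
    fix x e :: real assume "e > 0"
    then obtain d where d: "d > 0"
      "\<And>P. subintervals a b P \<Longrightarrow> (\<Sum>(p,q)\<in>P. q - p) < d \<Longrightarrow> (\<Sum>(p,q)\<in>P. u q - u p) \<le> e/2"
      using ac[of "e/2"] \<open>e > 0\<close> by auto
    have *: "v q - v p < e" if "p \<le> q" "q - p < d" for p q
    proof (cases "cl p = cl q")
      case False
      then have "subintervals a b {(cl p, cl q)}" using cl(3)[OF that(1)] by (intro subintervals_single) (auto simp: cl(1,2))
      then show ?thesis using d(2)[of "{(cl p, cl q)}"] cl(4)[OF that(1)] that \<open>e > 0\<close> by (auto simp: v_def)
    qed (use \<open>e > 0\<close> in \<open>simp add: v_def\<close>)
    show "\<exists>d>0. \<forall>x'. dist x' x < d \<longrightarrow> dist (v x') (v x) < e"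
    proof (intro exI[of _ d] conjI d(1) allI impI)
      fix x' assume "dist x' x < d"
      then show "dist (v x') (v x) < e"
        using *[of x x'] *[of x' x] v_mono[of x x'] v_mono[of x' x] by (cases "x \<le> x'") (auto simp: dist_real_def)
    qed
  qed
  define \<mu> where "\<mu> = interval_measure v"
  have sets_mu[simp, measurable_cong]: "sets \<mu> = sets borel" and space_mu[simp]: "space \<mu> = UNIV" by (simp_all add: \<mu>_def)
  have mu_Icc: "emeasure \<mu> {p..q} = ennreal (v q - v p)" if "p \<le> q" for p q
    unfolding \<mu>_def using that v_mono v_cont by (intro emeasure_interval_measure_Icc) auto
  define \<nu> where "\<nu> = density \<mu> (indicator {a..b})"
  have sets_nu[simp, measurable_cong]: "sets \<nu> = sets borel" and space_nu[simp]: "space \<nu> = UNIV" by (simp_all add: \<nu>_def)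
  have nu: "emeasure \<nu> A = emeasure \<mu> (A \<inter> {a..b})" if "A \<in> sets borel" for A
  proof -
    have "emeasure \<nu> A = (\<integral>\<^sup>+x. indicator {a..b} x * indicator A x \<partial>\<mu>)"
      using that unfolding \<nu>_def by (intro emeasure_density) auto
    also have "\<dots> = (\<integral>\<^sup>+x. indicator (A \<inter> {a..b}) x \<partial>\<mu>)"
      by (intro nn_integral_cong) (simp split: split_indicator)
    also have "\<dots> = emeasure \<mu> (A \<inter> {a..b})" using that by simp
    finally show ?thesis .
  qed
  have "absolutely_continuous lborel \<nu>"
    unfolding absolutely_continuous_def
  proof
    fix N :: "real set" assume N: "N \<in> null_sets lborel"
    then have Nb[measurable]: "N \<in> sets borel" by auto
    \<comment> \<open>It suffices to bound the measure of \<open>N\<close> by every \<open>e > 0\<close>.\<close>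
    have "emeasure \<nu> N \<le> ennreal e" if e: "e > 0" for e
    proof -
      obtain d where d: "d > 0"
        "\<And>P. subintervals a b P \<Longrightarrow> (\<Sum>(p,q)\<in>P. q - p) < d \<Longrightarrow> (\<Sum>(p,q)\<in>P. u q - u p) \<le> e"
        using ac[OF e] by auto
      obtain W where W: "open W" "N \<subseteq> W" "W - N \<in> lmeasurable" "emeasure lebesgue (W - N) < ennreal d"
        using sets_lebesgue_outer_open[of N d] N d(1) by auto
      have W_small: "emeasure lborel W < ennreal d"
      proof -
        have "emeasure lborel W \<le> emeasure lborel ((W - N) \<union> N)"
          using W by (intro emeasure_mono) auto
        also have "\<dots> \<le> emeasure lborel (W - N) + emeasure lborel N"
          using W(1) by (intro emeasure_subadditive) auto
        also have "\<dots> = emeasure lebesgue (W - N)" using N W(1) by (auto simp: null_setsD1)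
        finally show ?thesis using W(4) by simp
      qed
      obtain \<D> where \<D>: "countable \<D>" "\<And>X. X \<in> \<D> \<Longrightarrow> \<exists>p q. X = cbox p q" "\<Union>\<D> = W"
        using open_countable_Union_open_cbox[OF W(1)] by metis
      \<comment> \<open>The sets \<open>K n\<close> are finite unions of intervals that increase to \<open>W \<inter> {a..b}\<close>.\<close>
      define K where "K n = (\<Union>i\<le>n. from_nat_into \<D> i \<inter> {a..b})" for n
      have fin_bound: "emeasure \<mu> (\<Union>\<C> \<inter> {a..b}) \<le> ennreal e" if "finite \<C>" "\<C> \<subseteq> \<D>" for \<C>
      proof -
        have "\<exists>p q. s = cbox p q" if s: "s \<in> (\<lambda>X. X \<inter> {a..b}) ` \<C>" for s
        proof -
          obtain X where X: "X \<in> \<D>" "s = X \<inter> {a..b}" using s \<open>\<C> \<subseteq> \<D>\<close> by blast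
          obtain p q where "X = cbox p q" using \<D>(2)[OF X(1)] by blast
          then have "s = cbox (max p a) (min q b)" using X(2) by (simp add: Int_atLeastAtMost)
          then show ?thesis by blast
        qed
        with elementary_unions_intervals[of "(\<lambda>X. X \<inter> {a..b}) ` \<C>"] \<open>finite \<C>\<close>
        obtain D where D: "D division_of (\<Union>((\<lambda>X. X \<inter> {a..b}) ` \<C>))" by blast
        have eq: "\<Union>((\<lambda>X. X \<inter> {a..b}) ` \<C>) = \<Union>\<C> \<inter> {a..b}" by auto
        note D = D[unfolded eq]
        obtain P where P: "subintervals a b P"
          "\<And>w :: real \<Rightarrow> real. (\<Sum>(p,q)\<in>P. w q - w p) = (\<Sum>k\<in>D. w (Sup k) - w (Inf k))"
          using sum_over_division_eq_subintervals[OF D, of a b] by auto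
        have ivl: "\<exists>p q. p \<le> q \<and> k = {p..q} \<and> a \<le> p \<and> q \<le> b" if "k \<in> D" for k
        proof -
          obtain p q where k: "k = cbox p q" using division_ofD(4)[OF D \<open>k \<in> D\<close>] by blast
          moreover have "k \<noteq> {}" "k \<subseteq> {a..b}" using division_ofD(2,3)[OF D \<open>k \<in> D\<close>] by auto
          ultimately show ?thesis by (intro exI[of _ p] exI[of _ q]) auto
        qed
        have meas: "\<Union>\<C> \<inter> {a..b} \<in> sets borel"
        proof (intro sets.Int sets.finite_Union \<open>finite \<C>\<close> subsetI)
          fix X assume "X \<in> \<C>"
          then obtain p q where "X = cbox p q" using \<D>(2) \<open>\<C> \<subseteq> \<D>\<close> by blast
          then show "X \<in> sets borel" by simp
        qed simp
        have "(\<Sum>(p,q)\<in>P. q - p) = (\<Sum>k\<in>D. measure lebesgue k)"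
          unfolding P(2)
        proof (intro sum.cong refl)
          fix k assume "k \<in> D"
          then obtain p q where "p \<le> q" "k = {p..q}" using ivl by blast
          then show "Sup k - Inf k = measure lebesgue k" by simp
        qed
        also have "\<dots> = measure lebesgue (\<Union>\<C> \<inter> {a..b})" by (rule content_division[OF D])
        also have "\<dots> < d"
        proof -
          have "emeasure lborel (\<Union>\<C> \<inter> {a..b}) \<le> emeasure lborel W"
            using \<D>(3) that W(1) by (intro emeasure_mono) auto
          also note W_small
          finally have "emeasure lborel (\<Union>\<C> \<inter> {a..b}) < ennreal d" .
          then have "measure lborel (\<Union>\<C> \<inter> {a..b}) < d"
            unfolding measure_def using d(1) by (cases "emeasure lborel (\<Union>\<C> \<inter> {a..b})") (auto simp: ennreal_less_iff)
          then show ?thesis using meas by simp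
        qed
        finally have "(\<Sum>(p,q)\<in>P. u q - u p) \<le> e" by (rule d(2)[OF P(1)])
        then have le: "(\<Sum>k\<in>D. u (Sup k) - u (Inf k)) \<le> e" unfolding P(2) .
        have "emeasure \<mu> (\<Union>\<C> \<inter> {a..b}) = emeasure \<mu> (\<Union>k\<in>D. k)"
          using division_ofD(6)[OF D] by simp
        also have "\<dots> \<le> (\<Sum>k\<in>D. emeasure \<mu> k)"
        proof (rule emeasure_subadditive_finite)
          show "finite D" using D by auto
          show "(\<lambda>k. k) ` D \<subseteq> sets \<mu>"
          proof clarify
            fix k assume "k \<in> D"
            then obtain p q where "k = {p..q}" using ivl by blast
            then show "k \<in> sets \<mu>" by simp
          qed
        qed
        also have "\<dots> = (\<Sum>k\<in>D. ennreal (u (Sup k) - u (Inf k)))"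
        proof (intro sum.cong refl)
          fix k assume "k \<in> D"
          then obtain p q where "p \<le> q" "k = {p..q}" "a \<le> p" "q \<le> b" using ivl by blast
          then show "emeasure \<mu> k = ennreal (u (Sup k) - u (Inf k))" by (simp add: mu_Icc v_eq)
        qed
        also have "\<dots> = ennreal (\<Sum>k\<in>D. u (Sup k) - u (Inf k))"
        proof (rule sum_ennreal)
          fix k assume "k \<in> D"
          then obtain p q where "p \<le> q" "k = {p..q}" "a \<le> p" "q \<le> b" using ivl by blast
          then show "0 \<le> u (Sup k) - u (Inf k)" using mono[of p q] by simp
        qed
        also have "\<dots> \<le> ennreal e" using le by (rule ennreal_leI)
        finally show ?thesis .
      qed
      have "emeasure \<nu> N \<le> emeasure \<mu> (W \<inter> {a..b})"
        unfolding nu[OF Nb] using W by (intro emeasure_mono) auto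
      also have "\<dots> \<le> ennreal e"
      proof (cases "\<D> = {}")
        case True
        then show ?thesis using \<D>(3) by simp
      next
        case False
        have "W \<inter> {a..b} = (\<Union>n. K n)"
        proof -
          have "W = (\<Union>i. from_nat_into \<D> i)"
            using range_from_nat_into[OF False \<D>(1)] \<D>(3) by simp
          then show ?thesis unfolding K_def by auto
        qed
        moreover have "(SUP n. emeasure \<mu> (K n)) = emeasure \<mu> (\<Union>n. K n)"
        proof (rule SUP_emeasure_incseq)
          show "range K \<subseteq> sets \<mu>"
          proof -
            have "from_nat_into \<D> i \<in> sets borel" for i
              using \<D>(2)[OF from_nat_into[OF False]] by (metis borel_closed closed_cbox)
            then show ?thesis by (auto simp: K_def)
          qed
          show "incseq K" by (auto simp: K_def incseq_def intro: order_trans)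
        qed
        moreover have "emeasure \<mu> (K n) \<le> ennreal e" for n
        proof -
          have "K n = \<Union>(from_nat_into \<D> ` {..n}) \<inter> {a..b}" by (auto simp: K_def)
          then show ?thesis using fin_bound[of "from_nat_into \<D> ` {..n}"] from_nat_into[OF False] by auto
        qed
        ultimately show ?thesis by (metis SUP_least)
      qed
      finally show ?thesis .
    qed
    then have "emeasure \<nu> N \<le> 0" by - (rule ennreal_le_epsilon, simp)
    then show "N \<in> null_sets \<nu>" using Nb by (intro null_setsI) simp_all
  qed
  from sigma_finite_measure.Radon_Nikodym[OF sigma_finite_lborel this] obtain g0 where
    g0[measurable]: "g0 \<in> borel_measurable lborel" and dens: "density lborel g0 = \<nu>" by auto
  have nn: "(\<integral>\<^sup>+t. g0 t * indicator {a..x} t \<partial>lborel) = ennreal (u x - u a)" if x: "x \<in> {a..b}" for x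
  proof -
    have "(\<integral>\<^sup>+t. g0 t * indicator {a..x} t \<partial>lborel) = emeasure \<nu> {a..x}"
      unfolding dens[symmetric] by (subst emeasure_density) auto
    also have "\<dots> = emeasure \<mu> {a..x}" using x by (subst nu) (auto simp: Int_absorb2)
    also have "\<dots> = ennreal (u x - u a)" using x \<open>a < b\<close> by (simp add: mu_Icc v_eq)
    finally show ?thesis .
  qed
  define g where "g = (\<lambda>t. enn2real (g0 t))"
  have g[measurable]: "g \<in> borel_measurable borel" using g0 by (simp add: g_def)
  have "AE t in lborel. g0 t * indicator {a..b} t \<noteq> \<infinity>"
    using nn[of b] \<open>a < b\<close> by (intro nn_integral_PInf_AE) auto
  then have ae: "AE t in lborel. ennreal (indicator {a..x} t *\<^sub>R g t) = g0 t * indicator {a..x} t" if "x \<in> {a..b}" for x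
  proof (rule AE_mp, intro AE_I2 impI)
    fix t assume "g0 t * indicator {a..b} t \<noteq> \<infinity>"
    then show "ennreal (indicator {a..x} t *\<^sub>R g t) = g0 t * indicator {a..x} t"
      using \<open>x \<in> {a..b}\<close> by (auto simp: g_def indicator_def less_top)
  qed
  have nng: "(\<integral>\<^sup>+t. ennreal (indicator {a..x} t *\<^sub>R g t) \<partial>lborel) = ennreal (u x - u a)" if "x \<in> {a..b}" for x
    using nn_integral_cong_AE[OF ae[OF that]] nn[OF that] by simp
  show ?thesis
  proof (rule that[of g])
    show "set_integrable lborel {a..b} g"
      unfolding set_integrable_def
    proof (rule integrableI_bounded)
      have "(\<integral>\<^sup>+t. ennreal (norm (indicator {a..b} t *\<^sub>R g t)) \<partial>lborel) = (\<integral>\<^sup>+t. ennreal (indicator {a..b} t *\<^sub>R g t) \<partial>lborel)"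
        by (intro nn_integral_cong) (simp add: g_def)
      then show "(\<integral>\<^sup>+t. ennreal (norm (indicator {a..b} t *\<^sub>R g t)) \<partial>lborel) < \<infinity>"
        using nng[of b] \<open>a < b\<close> by simp
    qed measurable
    show "(LINT t:{a..x}|lborel. g t) = u x - u a" if "x \<in> {a..b}" for x
      unfolding set_lebesgue_integral_def
      using nng[OF that] mono[of a x] that
      by (subst integral_eq_nn_integral) (auto simp: g_def)
  qed (use g in simp)
qed

lemma set_integrable_complex_of_real:
  assumes "set_integrable M A f" shows "set_integrable M A (\<lambda>t. complex_of_real (f t))"
proof -
  have "integrable M (\<lambda>t. complex_of_real (indicator A t *\<^sub>R f t))"
    using assms unfolding set_integrable_def by (rule integrable_of_real)
  then show ?thesis unfolding set_integrable_def by (simp add: scaleR_conv_of_real)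
qed

text \<open>
  With the variation \<open>V\<close> of \<open>F\<close>, the functions \<open>V\<close>, \<open>V + Re F\<close> and \<open>V + Im F\<close> are increasing, and
  their increments are at most twice those of \<open>V\<close>. So all three are absolutely continuous and
  increasing, and the densities can be subtracted.
\<close>

lemma absolutely_continuous_on_density:
  assumes "a < b" and ac: "absolutely_continuous_on {a..b} F"
  obtains g :: "real \<Rightarrow> complex" where "g \<in> borel_measurable borel"
    "set_integrable lborel {a..b} g" "\<And>x. x \<in> {a..b} \<Longrightarrow> (LINT t:{a..x}|lborel. g t) = F x - F a"
proof -
  define V where "V = (\<lambda>x. enn2real (variation F a x))"
  have V_diff: "ennreal (V y - V x) = variation F x y" "V x \<le> V y" if "a \<le> x" "x \<le> y" "y \<le> b" for x y
  proof -
    have fin: "variation F a x < \<infinity>" "variation F x y < \<infinity>" "variation F a y < \<infinity>"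
      using variation_finite[OF ac] that by auto
    have "V y = V x + enn2real (variation F x y)"
      unfolding V_def using variation_add[OF that(1,2), of F] fin by (simp add: enn2real_plus)
    then show "ennreal (V y - V x) = variation F x y" "V x \<le> V y" using fin by auto
  qed
  have norm_le: "norm (F y - F x) \<le> V y - V x" if "a \<le> x" "x \<le> y" "y \<le> b" for x y
    using norm_diff_le_variation[OF that(2), of F] V_diff[OF that] by (metis diff_ge_0_iff_ge ennreal_le_iff)
  have V_ac: "\<exists>\<delta>>0. \<forall>P. subintervals a b P \<and> (\<Sum>(p,q)\<in>P. q - p) < \<delta> \<longrightarrow> (\<Sum>(p,q)\<in>P. V q - V p) \<le> \<epsilon>"
    if e: "\<epsilon> > 0" for \<epsilon>
  proof -
    obtain \<delta> where d: "\<delta> > 0"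
      "\<And>P. subintervals a b P \<Longrightarrow> (\<Sum>(p,q)\<in>P. q - p) < \<delta> \<Longrightarrow> (\<Sum>(p,q)\<in>P. variation F p q) \<le> ennreal \<epsilon>"
      using variation_absolutely_continuous[OF ac e] by blast
    show ?thesis
    proof (intro exI[of _ \<delta>] conjI d(1) allI impI, elim conjE)
      fix P assume P: "subintervals a b P" "(\<Sum>(p,q)\<in>P. q - p) < \<delta>"
      have b: "a \<le> fst z" "fst z \<le> snd z" "snd z \<le> b" if "z \<in> P" for z
        using subintervals_bounds[OF P(1), of "fst z" "snd z"] that by auto
      have "ennreal (\<Sum>z\<in>P. V (snd z) - V (fst z)) = (\<Sum>z\<in>P. variation F (fst z) (snd z))"
        using V_diff(2)[OF b] by (subst sum_ennreal[symmetric]) (auto simp: V_diff(1)[OF b])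
      also have "\<dots> \<le> ennreal \<epsilon>" using d(2)[OF P] by (simp add: case_prod_beta)
      finally show "(\<Sum>(p,q)\<in>P. V q - V p) \<le> \<epsilon>" using e by (simp add: case_prod_beta ennreal_le_iff)
    qed
  qed
  have part: "\<exists>g :: real \<Rightarrow> real. g \<in> borel_measurable borel \<and> set_integrable lborel {a..b} g \<and>
      (\<forall>x\<in>{a..b}. (LINT t:{a..x}|lborel. g t) = u x - u a)"
    if u: "\<And>x y. a \<le> x \<Longrightarrow> x \<le> y \<Longrightarrow> y \<le> b \<Longrightarrow> \<bar>(u y - u x) - (V y - V x)\<bar> \<le> V y - V x" for u :: "real \<Rightarrow> real"
  proof -
    have "u x \<le> u y" if "a \<le> x" "x \<le> y" "y \<le> b" for x y using u[OF that] by linarith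
    moreover have "\<exists>\<delta>>0. \<forall>P. subintervals a b P \<and> (\<Sum>(p,q)\<in>P. q - p) < \<delta> \<longrightarrow> (\<Sum>(p,q)\<in>P. u q - u p) \<le> \<epsilon>"
      if e: "\<epsilon> > 0" for \<epsilon>
    proof -
      obtain \<delta> where d: "\<delta> > 0"
        "\<And>P. subintervals a b P \<Longrightarrow> (\<Sum>(p,q)\<in>P. q - p) < \<delta> \<Longrightarrow> (\<Sum>(p,q)\<in>P. V q - V p) \<le> \<epsilon>/2"
        using V_ac[of "\<epsilon>/2"] e by auto
      show ?thesis
      proof (intro exI[of _ \<delta>] conjI d(1) allI impI, elim conjE)
        fix P assume P: "subintervals a b P" "(\<Sum>(p,q)\<in>P. q - p) < \<delta>"
        have "(\<Sum>(p,q)\<in>P. u q - u p) \<le> (\<Sum>(p,q)\<in>P. 2 * (V q - V p))"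
        proof (intro sum_mono, clarify)
          fix p q assume "(p,q) \<in> P"
          then show "u q - u p \<le> 2 * (V q - V p)"
            using u[of p q] subintervals_bounds[OF P(1), of p q] by auto
        qed
        also have "\<dots> = 2 * (\<Sum>(p,q)\<in>P. V q - V p)" by (simp add: sum_distrib_left case_prod_beta)
        also have "\<dots> \<le> \<epsilon>" using d(2)[OF P] by simp
        finally show "(\<Sum>(p,q)\<in>P. u q - u p) \<le> \<epsilon>" .
      qed
    qed
    ultimately obtain g :: "real \<Rightarrow> real" where "g \<in> borel_measurable borel"
      "set_integrable lborel {a..b} g" "\<And>x. x \<in> {a..b} \<Longrightarrow> (LINT t:{a..x}|lborel. g t) = u x - u a"
      using monotone_absolutely_continuous_density[OF \<open>a < b\<close>, of u] by blast
    then show ?thesis by blast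
  qed
  obtain g1 where g1: "g1 \<in> borel_measurable borel" "set_integrable lborel {a..b} g1"
    "\<And>x. x \<in> {a..b} \<Longrightarrow> (LINT t:{a..x}|lborel. g1 t) = V x - V a"
  proof -
    have "\<bar>(V y - V x) - (V y - V x)\<bar> \<le> V y - V x" if "a \<le> x" "x \<le> y" "y \<le> b" for x y
      using V_diff(2)[OF that] by simp
    from part[of V, OF this] show ?thesis using that by blast
  qed
  obtain g2 where g2: "g2 \<in> borel_measurable borel" "set_integrable lborel {a..b} g2"
    "\<And>x. x \<in> {a..b} \<Longrightarrow> (LINT t:{a..x}|lborel. g2 t) = (V x + Re (F x)) - (V a + Re (F a))"
  proof -
    have "\<bar>((V y + Re (F y)) - (V x + Re (F x))) - (V y - V x)\<bar> \<le> V y - V x" if "a \<le> x" "x \<le> y" "y \<le> b" for x y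
      using abs_Re_le_cmod[of "F y - F x"] norm_le[OF that] by auto
    from part[of "\<lambda>x. V x + Re (F x)", OF this] show ?thesis using that by blast
  qed
  obtain g3 where g3: "g3 \<in> borel_measurable borel" "set_integrable lborel {a..b} g3"
    "\<And>x. x \<in> {a..b} \<Longrightarrow> (LINT t:{a..x}|lborel. g3 t) = (V x + Im (F x)) - (V a + Im (F a))"
  proof -
    have "\<bar>((V y + Im (F y)) - (V x + Im (F x))) - (V y - V x)\<bar> \<le> V y - V x" if "a \<le> x" "x \<le> y" "y \<le> b" for x y
      using abs_Im_le_cmod[of "F y - F x"] norm_le[OF that] by auto
    from part[of "\<lambda>x. V x + Im (F x)", OF this] show ?thesis using that by blast
  qed
  define g where "g = (\<lambda>t. complex_of_real (g2 t - g1 t) + \<i> * complex_of_real (g3 t - g1 t))"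
  have int: "set_integrable lborel {a..x} (\<lambda>t. complex_of_real (g2 t - g1 t))"
    "set_integrable lborel {a..x} (\<lambda>t. \<i> * complex_of_real (g3 t - g1 t))"
    "set_integrable lborel {a..x} (\<lambda>t. complex_of_real (g3 t - g1 t))"
    "set_integrable lborel {a..x} g1" "set_integrable lborel {a..x} g2" "set_integrable lborel {a..x} g3"
    if "x \<in> {a..b}" for x
  proof -
    show *: "set_integrable lborel {a..x} g1" "set_integrable lborel {a..x} g2" "set_integrable lborel {a..x} g3"
      using set_integrable_subset[OF g1(2), of "{a..x}"] set_integrable_subset[OF g2(2), of "{a..x}"]
        set_integrable_subset[OF g3(2), of "{a..x}"] that by auto
    show "set_integrable lborel {a..x} (\<lambda>t. complex_of_real (g2 t - g1 t))"
      "set_integrable lborel {a..x} (\<lambda>t. complex_of_real (g3 t - g1 t))"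
      using * by (intro set_integrable_complex_of_real set_integral_diff; simp)+
    then show "set_integrable lborel {a..x} (\<lambda>t. \<i> * complex_of_real (g3 t - g1 t))"
      by (intro set_integrable_mult_right) auto
  qed
  show ?thesis
  proof (rule that[of g])
    show "g \<in> borel_measurable borel" unfolding g_def using g1(1) g2(1) g3(1) by measurable
    show "set_integrable lborel {a..b} g" unfolding g_def
      using int[of b] \<open>a < b\<close> by (intro set_integral_add) auto
    show "(LINT t:{a..x}|lborel. g t) = F x - F a" if x: "x \<in> {a..b}" for x
    proof -
      have "(LINT t:{a..x}|lborel. g t) = complex_of_real (Re (F x) - Re (F a)) + \<i> * complex_of_real (Im (F x) - Im (F a))"
        unfolding g_def using int[OF x] g1(3)[OF x] g2(3)[OF x] g3(3)[OF x]
        by (subst set_integral_add(2)) (auto simp: set_integral_complex_of_real set_integral_diff(2) simp del: of_real_diff)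
      also have "\<dots> = F x - F a" by (simp add: complex_eq_iff)
      finally show ?thesis .
    qed
  qed
qed

section \<open>Almost everywhere differentiability\<close>

text \<open>
  Almost everywhere the averages of an integrable function over \<open>[x, x + h]\<close> converge to its value
  at \<open>x\<close>. Applied to the density and to its reflection, this gives the right and the left derivative.
\<close>

lemma absolutely_continuous_ae_differentiable:
  fixes F g :: "real \<Rightarrow> complex"
  assumes "a < b" and g: "set_integrable lborel {a..b} g"
    and F: "\<And>x. x \<in> {a..b} \<Longrightarrow> (LINT t:{a..x}|lborel. g t) = F x - F a"
  obtains N where "negligible N" "\<And>x. x \<in> {a<..<b} - N \<Longrightarrow> (F has_vector_derivative g x) (at x)"
proof -
  define g' where "g' = (\<lambda>t. if t \<in> {a..b} then g t else 0)"
  have "g integrable_on {a..b}" by (rule set_borel_integral_eq_integral(1)[OF g])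
  then have "g' integrable_on UNIV" unfolding g'_def by (subst integrable_restrict_UNIV)
  then have int: "g' integrable_on cbox c d" for c d
    by (rule integrable_on_subcbox) simp
  have int': "(\<lambda>t. g' (- t)) integrable_on cbox c d" for c d
    using int[of "-d" "-c"] Henstock_Kurzweil_Integration.integrable_reflect_real[where f=g' and a="-d" and b="-c"] by simp
  have Fg: "integral {x..y} g' = F y - F x" if "a \<le> x" "x \<le> y" "y \<le> b" for x y
  proof -
    have *: "integral {a..z} g' = F z - F a" if "z \<in> {a..b}" for z
    proof -
      have "integral {a..z} g' = integral {a..z} g"
        using that by (intro integral_cong) (auto simp: g'_def)
      also have "\<dots> = (LINT t:{a..z}|lborel. g t)"
        using set_integrable_subset[OF g, of "{a..z}"] that
        by (intro set_borel_integral_eq_integral(2)[symmetric]) auto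
      finally show ?thesis using F[OF that] by simp
    qed
    have "integral {a..x} g' + integral {x..y} g' = integral {a..y} g'"
      using that int[of a y] by (intro Henstock_Kurzweil_Integration.integral_combine) auto
    then show ?thesis using *[of x] *[of y] that by (simp add: algebra_simps)
  qed
  obtain N1 where N1: "negligible N1" "\<And>x e. x \<notin> N1 \<Longrightarrow> 0 < e \<Longrightarrow>
      \<exists>d>0. \<forall>h. 0 < h \<and> h < d \<longrightarrow> norm (integral (cbox x (x + h *\<^sub>R One)) g' /\<^sub>R h ^ DIM(real) - g' x) < e"
    using integrable_ccontinuous_explicit[of g'] int by metis
  obtain N2 where N2: "negligible N2" "\<And>x e. x \<notin> N2 \<Longrightarrow> 0 < e \<Longrightarrow>
      \<exists>d>0. \<forall>h. 0 < h \<and> h < d \<longrightarrow> norm (integral (cbox x (x + h *\<^sub>R One)) (\<lambda>t. g' (-t)) /\<^sub>R h ^ DIM(real) - g' (-x)) < e"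
    using integrable_ccontinuous_explicit[of "\<lambda>t. g' (-t)"] int' by metis
  show ?thesis
  proof (rule that[of "N1 \<union> uminus ` N2"])
    show "negligible (N1 \<union> uminus ` N2)"
      using N1(1) N2(1) by (intro negligible_Un negligible_differentiable_image_negligible)
        (auto intro!: derivative_intros)
    fix x assume "x \<in> {a<..<b} - (N1 \<union> uminus ` N2)"
    then have x: "a < x" "x < b" "x \<notin> N1" "-x \<notin> N2" by (auto simp: image_iff)
    have gx: "g' x = g x" using x by (simp add: g'_def)
    show "(F has_vector_derivative g x) (at x)"
      unfolding has_vector_derivative_def has_derivative_at_alt
    proof (intro conjI allI impI)
      fix e :: real assume "e > 0"
      from N1(2)[OF x(3) this] obtain d1 where d1: "d1 > 0"
        "\<And>h. 0 < h \<Longrightarrow> h < d1 \<Longrightarrow> norm (integral {x..x+h} g' /\<^sub>R h - g x) < e"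
        by (auto simp: gx)
      from N2(2)[OF x(4) \<open>e > 0\<close>] obtain d2 where d2: "d2 > 0"
        "\<And>h. 0 < h \<Longrightarrow> h < d2 \<Longrightarrow> norm (integral {-x..-x+h} (\<lambda>t. g' (-t)) /\<^sub>R h - g x) < e"
        by (auto simp: gx)
      have scale: "norm (I - h *\<^sub>R g x) \<le> e * h" if "h > 0" "norm (I /\<^sub>R h - g x) < e" for h and I :: complex
      proof -
        have "I - h *\<^sub>R g x = h *\<^sub>R (I /\<^sub>R h - g x)" using that by (simp add: scaleR_diff_right)
        then have "norm (I - h *\<^sub>R g x) = h * norm (I /\<^sub>R h - g x)" using that by simp
        then show ?thesis using that by (simp add: mult.commute)
      qed
      show "\<exists>d>0. \<forall>y. norm (y - x) < d \<longrightarrow> norm (F y - F x - (y - x) *\<^sub>R g x) \<le> e * norm (y - x)"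
      proof (intro exI[of _ "min (min d1 d2) (min (x - a) (b - x))"] conjI allI impI)
        show "0 < min (min d1 d2) (min (x - a) (b - x))" using d1 d2 x by simp
        fix y assume y: "norm (y - x) < min (min d1 d2) (min (x - a) (b - x))"
        consider "y = x" | "y > x" | "y < x" by linarith
        then show "norm (F y - F x - (y - x) *\<^sub>R g x) \<le> e * norm (y - x)"
        proof cases
          case 2
          then have "norm (integral {x..x+(y-x)} g' /\<^sub>R (y-x) - g x) < e" using y by (intro d1(2)) auto
          from scale[OF _ this] show ?thesis using Fg[of x y] 2 y x by auto
        next
          case 3
          have "integral {-x..-y} (\<lambda>t. g' (-t)) = integral {y..x} g'" by (rule Henstock_Kurzweil_Integration.integral_reflect_real)
          also have "\<dots> = F x - F y" using 3 y x by (intro Fg) auto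
          finally have eq: "integral {-x..-x+(x-y)} (\<lambda>t. g' (-t)) = F x - F y" by simp
          have "norm (integral {-x..-x+(x-y)} (\<lambda>t. g' (-t)) /\<^sub>R (x-y) - g x) < e" using y 3 by (intro d2(2)) auto
          from scale[OF _ this] have "norm (F x - F y - (x - y) *\<^sub>R g x) \<le> e * (x - y)" using 3 unfolding eq by simp
          moreover have "F y - F x - (y - x) *\<^sub>R g x = - (F x - F y - (x - y) *\<^sub>R g x)" by (simp add: algebra_simps)
          ultimately show ?thesis using 3 by (simp only: norm_minus_cancel) simp
        qed simp
      qed
    qed (rule bounded_linear_scaleR_left)
  qed
qed

section \<open>Integrals of periodic functions\<close>

lemma nn_integral_shift_interval:
  fixes u :: "real \<Rightarrow> ennreal"
  assumes [measurable]: "u \<in> borel_measurable borel"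
  shows "(\<integral>\<^sup>+x\<in>{a<..b}. u (x + h) \<partial>lborel) = (\<integral>\<^sup>+x\<in>{a+h<..b+h}. u x \<partial>lborel)"
proof -
  have "(\<integral>\<^sup>+x\<in>{a+h<..b+h}. u x \<partial>lborel) = (\<integral>\<^sup>+x. u (h + 1 * x) * indicator {a+h<..b+h} (h + 1 * x) \<partial>lborel)"
    by (subst nn_integral_real_affine[where c=1 and t=h]) auto
  also have "\<dots> = (\<integral>\<^sup>+x\<in>{a<..b}. u (x + h) \<partial>lborel)"
    by (intro nn_integral_cong) (auto simp: indicator_def add.commute)
  finally show ?thesis ..
qed

text \<open>
  For nonnegative functions the invariance needs no integrability, so it can also be used to prove
  integrability of shifted functions.
\<close>

lemma nn_integral_periodic_shift:
  fixes u :: "real \<Rightarrow> ennreal"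
  assumes [measurable]: "u \<in> borel_measurable borel" and per: "\<And>x. u (x + 2*pi) = u x"
  shows "(\<integral>\<^sup>+x\<in>{-pi..pi}. u (x + h) \<partial>lborel) = (\<integral>\<^sup>+x\<in>{-pi..pi}. u x \<partial>lborel)"
proof -
  define J where "J a = (\<integral>\<^sup>+x\<in>{a<..a+2*pi}. u x \<partial>lborel)" for a
  have split: "(\<integral>\<^sup>+x\<in>{a<..c}. u x \<partial>lborel) = (\<integral>\<^sup>+x\<in>{a<..b}. u x \<partial>lborel) + (\<integral>\<^sup>+x\<in>{b<..c}. u x \<partial>lborel)"
    if "a \<le> b" "b \<le> c" for a b c
  proof -
    have "(\<integral>\<^sup>+x\<in>{a<..c}. u x \<partial>lborel) = (\<integral>\<^sup>+x. u x * indicator {a<..b} x + u x * indicator {b<..c} x \<partial>lborel)"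
      using that by (intro nn_integral_cong) (auto simp: indicator_def)
    then show ?thesis by (simp add: nn_integral_add)
  qed
  have step: "J (a + k) = J a" if "0 \<le> k" "k \<le> 2*pi" for a k
  proof -
    have "J (a + k) = (\<integral>\<^sup>+x\<in>{a+k<..a+2*pi}. u x \<partial>lborel) + (\<integral>\<^sup>+x\<in>{a+2*pi<..a+k+2*pi}. u x \<partial>lborel)"
      unfolding J_def using that by (intro split) auto
    also have "(\<integral>\<^sup>+x\<in>{a+2*pi<..a+k+2*pi}. u x \<partial>lborel) = (\<integral>\<^sup>+x\<in>{a<..a+k}. u x \<partial>lborel)"
      using nn_integral_shift_interval[of u "2*pi" a "a+k"] by (simp add: per)
    also have "(\<integral>\<^sup>+x\<in>{a+k<..a+2*pi}. u x \<partial>lborel) + (\<integral>\<^sup>+x\<in>{a<..a+k}. u x \<partial>lborel) = J a"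
      unfolding J_def using split[of a "a+k" "a+2*pi"] that by (simp add: add.commute)
    finally show ?thesis .
  qed
  have many: "J (a + k) = J a" if "0 \<le> k" "k \<le> real n * (2*pi)" for a k n
    using that
  proof (induction n arbitrary: k)
    case (Suc n)
    show ?case
    proof (cases "k \<le> 2*pi")
      case False
      have "J (a + k) = J (a + (k - 2*pi) + 2*pi)" by (simp add: algebra_simps)
      also have "\<dots> = J (a + (k - 2*pi))" by (intro step) auto
      also have "\<dots> = J a" using False Suc.prems by (intro Suc.IH) (auto simp: algebra_simps)
      finally show ?thesis .
    qed (use step Suc.prems in auto)
  qed auto
  have forward: "J (a + k) = J a" if "0 \<le> k" for a k
  proof -
    obtain n where "k / (2*pi) \<le> real n" using real_arch_simple by blast
    then show ?thesis using many[of k n a] that by (simp add: divide_le_eq)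
  qed
  have J: "J (-pi + h) = J (-pi)"
    using forward[of h "-pi"] forward[of "-h" "-pi + h"] by (cases "0 \<le> h") auto
  have closed: "(\<integral>\<^sup>+x\<in>{-pi..pi}. w x \<partial>lborel) = (\<integral>\<^sup>+x\<in>{-pi<..pi}. w x \<partial>lborel)" for w :: "real \<Rightarrow> ennreal"
  proof (rule nn_integral_cong_AE)
    show "AE x in lborel. w x * indicator {-pi..pi} x = w x * indicator {-pi<..pi} x"
      using AE_lborel_singleton[of "-pi"] by eventually_elim (auto simp: indicator_def)
  qed
  show ?thesis
    unfolding closed using nn_integral_shift_interval[of u h "-pi" pi] J by (simp add: J_def add.commute)
qed

text \<open>
  The members of the space \<open>L2pi\<close> that are Borel measurable. For these \<open>(x, t) \<mapsto> g (x + t)\<close> is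
  measurable for the product of the Borel sets, as the interchange of integrals requires.
\<close>

definition periodic_L1 :: "(real \<Rightarrow> complex) \<Rightarrow> bool" where
  "periodic_L1 g \<longleftrightarrow> g \<in> borel_measurable borel \<and> (\<forall>x. g (x + 2*pi) = g x) \<and> set_integrable lborel {-pi..pi} g"

lemma periodic_L1_measurable [measurable_dest]: "periodic_L1 g \<Longrightarrow> g \<in> borel_measurable borel"
  by (simp add: periodic_L1_def)

lemma periodic_L1_periodic: "periodic_L1 g \<Longrightarrow> g (x + 2*pi) = g x"
  by (simp add: periodic_L1_def)

lemma periodic_L1_integrable: "periodic_L1 g \<Longrightarrow> set_integrable lborel {-pi..pi} g"
  by (simp add: periodic_L1_def)

lemma nn_integral_set_norm:
  fixes g :: "real \<Rightarrow> complex"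
  shows "(\<integral>\<^sup>+x. ennreal (norm (indicator A x *\<^sub>R g x)) \<partial>lborel) = (\<integral>\<^sup>+x\<in>A. ennreal (norm (g x)) \<partial>lborel)"
  by (intro nn_integral_cong) (auto simp: indicator_def)

lemma set_integrable_iff_nn:
  fixes g :: "real \<Rightarrow> complex"
  assumes [measurable]: "g \<in> borel_measurable borel" "A \<in> sets borel"
  shows "set_integrable lborel A g \<longleftrightarrow> (\<integral>\<^sup>+x\<in>A. ennreal (norm (g x)) \<partial>lborel) < \<infinity>"
  unfolding set_integrable_def integrable_iff_bounded nn_integral_set_norm by simp

lemma periodic_L1_shift:
  assumes g: "periodic_L1 g" shows "periodic_L1 (\<lambda>x. g (x + h))"
proof -
  have [measurable]: "g \<in> borel_measurable borel" using g by measurable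
  have "(\<integral>\<^sup>+x\<in>{-pi..pi}. ennreal (norm (g (x + h))) \<partial>lborel) = (\<integral>\<^sup>+x\<in>{-pi..pi}. ennreal (norm (g x)) \<partial>lborel)"
    by (rule nn_integral_periodic_shift) (auto simp: periodic_L1_periodic[OF g])
  then have "set_integrable lborel {-pi..pi} (\<lambda>x. g (x + h))"
    using periodic_L1_integrable[OF g] by (simp add: set_integrable_iff_nn)
  moreover have "g (x + 2*pi + h) = g (x + h)" for x
    using periodic_L1_periodic[OF g, of "x + h"] by (simp add: algebra_simps)
  ultimately show ?thesis by (simp add: periodic_L1_def)
qed

lemma periodic_L1_diff: "periodic_L1 f \<Longrightarrow> periodic_L1 g \<Longrightarrow> periodic_L1 (\<lambda>x. f x - g x)"
  unfolding periodic_L1_def by auto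

lemma periodic_L1_add: "periodic_L1 f \<Longrightarrow> periodic_L1 g \<Longrightarrow> periodic_L1 (\<lambda>x. f x + g x)"
  unfolding periodic_L1_def by auto

lemma periodic_L1_continuous:
  assumes "continuous_on UNIV g" "\<And>x. g (x + 2*pi) = g x" shows "periodic_L1 g"
  unfolding periodic_L1_def using assms
  by (auto intro!: borel_measurable_continuous_onI borel_integrable_compact continuous_on_subset[OF assms(1)]
      simp: set_integrable_def)

lemma periodic_L1_mult_bounded:
  assumes g: "periodic_L1 g" and e: "continuous_on UNIV e" "\<And>x. norm (e x) \<le> B" "\<And>x. e (x + 2*pi) = e x"
  shows "periodic_L1 (\<lambda>x. g x * e x)"
proof -
  have [measurable]: "g \<in> borel_measurable borel" using g by measurable
  have [measurable]: "e \<in> borel_measurable borel" using e(1) by (rule borel_measurable_continuous_onI)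
  have "(\<integral>\<^sup>+x\<in>{-pi..pi}. ennreal (norm (g x * e x)) \<partial>lborel) \<le> (\<integral>\<^sup>+x. ennreal B * (ennreal (norm (g x)) * indicator {-pi..pi} x) \<partial>lborel)"
  proof (intro nn_integral_mono)
    fix x :: real
    have B: "0 \<le> B" using order_trans[OF norm_ge_zero e(2)] .
    have "norm (g x * e x) \<le> B * norm (g x)"
      using mult_left_mono[OF e(2)[of x] norm_ge_zero[of "g x"]] by (simp add: norm_mult mult.commute)
    then have "ennreal (norm (g x * e x)) \<le> ennreal B * ennreal (norm (g x))"
      using B by (simp add: ennreal_mult[symmetric] ennreal_leI)
    then show "ennreal (norm (g x * e x)) * indicator {-pi..pi} x \<le> ennreal B * (ennreal (norm (g x)) * indicator {-pi..pi} x)"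
      by (auto simp: indicator_def)
  qed
  also have "\<dots> = ennreal B * (\<integral>\<^sup>+x\<in>{-pi..pi}. ennreal (norm (g x)) \<partial>lborel)"
    by (rule nn_integral_cmult) measurable
  also have "\<dots> < \<infinity>"
    using periodic_L1_integrable[OF g] by (simp add: set_integrable_iff_nn ennreal_mult_less_top)
  finally have "set_integrable lborel {-pi..pi} (\<lambda>x. g x * e x)" by (simp add: set_integrable_iff_nn)
  then show ?thesis by (simp add: periodic_L1_def e(3) periodic_L1_periodic[OF g])
qed

lemma set_lebesgue_integral_lebesgue_eq_lborel:
  fixes g :: "real \<Rightarrow> 'b::{banach, second_countable_topology}"
  assumes "g \<in> borel_measurable borel" "A \<in> sets borel"
  shows "(LINT x:A|lebesgue. g x) = (LINT x:A|lborel. g x)"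
proof -
  have [measurable]: "g \<in> borel_measurable borel" "A \<in> sets borel" using assms by auto
  show ?thesis unfolding set_lebesgue_integral_def by (intro integral_completion) measurable
qed

lemma set_integral_periodic_shift_real:
  fixes w :: "real \<Rightarrow> real"
  assumes [measurable]: "w \<in> borel_measurable borel" and per: "\<And>x. w (x + 2*pi) = w x"
    and int: "set_integrable lborel {-pi..pi} w" "set_integrable lborel {-pi..pi} (\<lambda>x. w (x + h))"
  shows "(LINT x:{-pi..pi}|lborel. w (x + h)) = (LINT x:{-pi..pi}|lborel. w x)"
proof -
  have eq: "(\<integral>\<^sup>+x. ennreal (indicator {-pi..pi} x *\<^sub>R v x) \<partial>lborel) = (\<integral>\<^sup>+x\<in>{-pi..pi}. ennreal (v x) \<partial>lborel)" for v
    by (intro nn_integral_cong) (auto simp: indicator_def)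
  have eq': "(\<integral>\<^sup>+x. ennreal (- (indicator {-pi..pi} x *\<^sub>R v x)) \<partial>lborel) = (\<integral>\<^sup>+x\<in>{-pi..pi}. ennreal (- v x) \<partial>lborel)" for v
    by (intro nn_integral_cong) (auto simp: indicator_def)
  have 1: "(\<integral>\<^sup>+x\<in>{-pi..pi}. ennreal (w (x+h)) \<partial>lborel) = (\<integral>\<^sup>+x\<in>{-pi..pi}. ennreal (w x) \<partial>lborel)"
    by (rule nn_integral_periodic_shift) (auto simp: per)
  have 2: "(\<integral>\<^sup>+x\<in>{-pi..pi}. ennreal (- w (x+h)) \<partial>lborel) = (\<integral>\<^sup>+x\<in>{-pi..pi}. ennreal (- w x) \<partial>lborel)"
    using nn_integral_periodic_shift[of "\<lambda>x. ennreal (- w x)" h] by (simp add: per)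
  show ?thesis
    using int unfolding set_integrable_def set_lebesgue_integral_def
    by (simp only: real_lebesgue_integral_def eq eq' 1 2)
qed

lemma set_integral_Re_Im:
  fixes g :: "real \<Rightarrow> complex"
  assumes "set_integrable M A g"
  shows "Re (LINT x:A|M. g x) = (LINT x:A|M. Re (g x))" "Im (LINT x:A|M. g x) = (LINT x:A|M. Im (g x))"
    "set_integrable M A (\<lambda>x. Re (g x))" "set_integrable M A (\<lambda>x. Im (g x))"
  using assms integral_Re[of M "\<lambda>x. indicator A x *\<^sub>R g x"] integral_Im[of M "\<lambda>x. indicator A x *\<^sub>R g x"]
    integrable_Re[of M "\<lambda>x. indicator A x *\<^sub>R g x"] integrable_Im[of M "\<lambda>x. indicator A x *\<^sub>R g x"]
  by (auto simp: set_integrable_def set_lebesgue_integral_def)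

lemma set_integral_periodic_shift:
  assumes g: "periodic_L1 g"
  shows "(LINT x:{-pi..pi}|lborel. g (x + h)) = (LINT x:{-pi..pi}|lborel. g x)"
proof -
  have [measurable]: "g \<in> borel_measurable borel" using g by measurable
  note I = set_integral_Re_Im[OF periodic_L1_integrable[OF g]]
    set_integral_Re_Im[OF periodic_L1_integrable[OF periodic_L1_shift[OF g, of h]]]
  show ?thesis
    unfolding complex_eq_iff I(1,2,5,6)
    by (intro conjI set_integral_periodic_shift_real I) (auto simp: periodic_L1_periodic[OF g])
qed

section \<open>The integral norm\<close>

lemma ennreal_L1_norm:
  assumes g: "periodic_L1 g"
  shows "ennreal (L1_norm g) = (\<integral>\<^sup>+x\<in>{-pi..pi}. ennreal (norm (g x)) \<partial>lborel)"
proof -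
  have [measurable]: "g \<in> borel_measurable borel" using g by measurable
  have "set_integrable lborel {-pi..pi} (\<lambda>x. norm (g x))"
    using periodic_L1_integrable[OF g] by (rule set_integrable_norm)
  then have "ennreal (LINT x:{-pi..pi}|lborel. norm (g x)) = (\<integral>\<^sup>+x. ennreal (indicator {-pi..pi} x *\<^sub>R norm (g x)) \<partial>lborel)"
    unfolding set_lebesgue_integral_def set_integrable_def by (intro nn_integral_eq_integral[symmetric]) auto
  also have "\<dots> = (\<integral>\<^sup>+x\<in>{-pi..pi}. ennreal (norm (g x)) \<partial>lborel)"
    by (intro nn_integral_cong) (auto simp: indicator_def)
  finally show ?thesis
    unfolding L1_norm_def by (simp add: set_lebesgue_integral_lebesgue_eq_lborel)
qed

lemma L1_norm_nonneg: "0 \<le> L1_norm g"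
  unfolding L1_norm_def set_lebesgue_integral_def by (intro integral_nonneg_AE) auto

lemma L1_norm_le_iff_nn:
  "periodic_L1 g \<Longrightarrow> 0 \<le> c \<Longrightarrow> L1_norm g \<le> c \<longleftrightarrow> (\<integral>\<^sup>+x\<in>{-pi..pi}. ennreal (norm (g x)) \<partial>lborel) \<le> ennreal c"
  using ennreal_L1_norm[of g] L1_norm_nonneg[of g] by (metis ennreal_le_iff)

lemma L1_norm_triangle:
  assumes f: "periodic_L1 f" and g: "periodic_L1 g"
  shows "L1_norm (\<lambda>x. f x + g x) \<le> L1_norm f + L1_norm g"
proof -
  have [measurable]: "f \<in> borel_measurable borel" "g \<in> borel_measurable borel" using f g by measurable
  have "(\<integral>\<^sup>+x\<in>{-pi..pi}. ennreal (norm (f x + g x)) \<partial>lborel) \<le>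
     (\<integral>\<^sup>+x. ennreal (norm (f x)) * indicator {-pi..pi} x + ennreal (norm (g x)) * indicator {-pi..pi} x \<partial>lborel)"
    by (intro nn_integral_mono) (auto simp: indicator_def ennreal_plus[symmetric] norm_triangle_ineq ennreal_leI simp del: ennreal_plus)
  also have "\<dots> = ennreal (L1_norm f) + ennreal (L1_norm g)"
    by (simp add: nn_integral_add ennreal_L1_norm f g)
  also have "\<dots> = ennreal (L1_norm f + L1_norm g)" by (simp add: L1_norm_nonneg)
  finally show ?thesis by (simp add: L1_norm_le_iff_nn periodic_L1_add f g L1_norm_nonneg)
qed

lemma L1_norm_triangle_diff:
  assumes f: "periodic_L1 f" and g: "periodic_L1 g"
  shows "L1_norm (\<lambda>x. f x - g x) \<le> L1_norm f + L1_norm g"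
proof -
  have "periodic_L1 (\<lambda>x. - g x)" using periodic_L1_diff[OF periodic_L1_continuous g, of "\<lambda>_. 0"] by simp
  from L1_norm_triangle[OF f this] show ?thesis by (simp add: L1_norm_def)
qed

lemma L1_norm_shift:
  assumes g: "periodic_L1 g" shows "L1_norm (\<lambda>x. g (x + h)) = L1_norm g"
proof -
  have [measurable]: "g \<in> borel_measurable borel" using g by measurable
  have "ennreal (L1_norm (\<lambda>x. g (x + h))) = ennreal (L1_norm g)"
    unfolding ennreal_L1_norm[OF g] ennreal_L1_norm[OF periodic_L1_shift[OF g]]
    by (rule nn_integral_periodic_shift) (auto simp: periodic_L1_periodic[OF g])
  then show ?thesis by (simp add: L1_norm_nonneg)
qed

text \<open>
  Only \<open>g\<close> is assumed to be Borel measurable: \<open>f\<close> will be a pointwise derivative, which is known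
  only outside a null set.
\<close>

lemma L1_norm_cong_negligible:
  assumes g: "periodic_L1 g" and N: "negligible N" and eq: "\<And>x. x \<notin> N \<Longrightarrow> f x = g x"
  shows "L1_norm f = L1_norm g"
proof -
  have [measurable]: "g \<in> borel_measurable borel" using g by measurable
  have ig: "(\<lambda>x. norm (g x)) absolutely_integrable_on {-pi..pi}"
    using set_integrable_norm[OF periodic_L1_integrable[OF g]]
    unfolding set_integrable_def by (subst integrable_completion) auto
  moreover have "(\<lambda>x. norm (f x)) absolutely_integrable_on {-pi..pi}"
    by (rule absolutely_integrable_spike[OF ig N]) (use eq in auto)
  moreover have "integral {-pi..pi} (\<lambda>x. norm (f x)) = integral {-pi..pi} (\<lambda>x. norm (g x))"
    by (rule integral_spike[OF N]) (use eq in auto)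
  ultimately show ?thesis
    unfolding L1_norm_def by (simp add: set_lebesgue_integral_eq_integral(2))
qed

section \<open>Exponentials and Fourier coefficients\<close>

definition ek :: "int \<Rightarrow> real \<Rightarrow> complex" where
  "ek k x = cis (of_int k * x)"

lemma exp_eq_ek:
  "exp (\<i> * of_int k * complex_of_real x) = ek k x"
  "exp (- \<i> * of_int k * complex_of_real x) = ek (- k) x"
  by (simp_all add: ek_def cis_conv_exp mult.assoc)

lemma ek_0 [simp]: "ek 0 x = 1" by (simp add: ek_def)
lemma ek_arg_0 [simp]: "ek k 0 = 1" by (simp add: ek_def)
lemma norm_ek [simp]: "norm (ek k x) = 1" by (simp add: ek_def)
lemma ek_add: "ek (k + l) x = ek k x * ek l x" by (simp add: ek_def cis_mult algebra_simps)
lemma ek_arg_add: "ek k (x + y) = ek k x * ek k y" by (simp add: ek_def cis_mult algebra_simps)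
lemma ek_arg_minus: "ek k (- x) = ek (- k) x" by (simp add: ek_def)
lemma cnj_ek: "cnj (ek k x) = ek (- k) x" by (simp add: ek_def cis_cnj)
lemma ek_arg_diff: "ek k (x - y) = ek k x * ek (- k) y"
  using ek_arg_add[of k x "- y"] by (simp add: ek_arg_minus)

lemma ek_periodic [simp]: "ek k (x + 2*pi) = ek k x"
proof -
  have "ek k (2*pi) = 1" using cis_multiple_2pi[of "of_int k"] by (simp add: ek_def mult.commute mult.left_commute)
  then show ?thesis by (simp add: ek_arg_add)
qed

lemma continuous_on_ek [continuous_intros]: "continuous_on A f \<Longrightarrow> continuous_on A (\<lambda>x. ek k (f x))"
  unfolding ek_def by (intro continuous_intros)

lemma ek_measurable [measurable]: "ek k \<in> borel_measurable borel"
  by (intro borel_measurable_continuous_onI continuous_on_ek continuous_on_id)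

lemma ek_has_vector_derivative: "(ek k has_vector_derivative (\<i> * of_int k * ek k x)) (at x within A)"
proof -
  have "((\<lambda>z. exp (\<i> * of_int k * z)) has_field_derivative (\<i> * of_int k * exp (\<i> * of_int k * of_real x))) (at (of_real x))"
    by (auto intro!: derivative_eq_intros)
  from has_vector_derivative_real_field[OF this]
  have "((\<lambda>x. exp (\<i> * of_int k * complex_of_real x)) has_vector_derivative (\<i> * of_int k * exp (\<i> * of_int k * of_real x))) (at x within A)" .
  then show ?thesis by (simp only: exp_eq_ek)
qed

lemma integral_ek: "(LINT x:{-pi..pi}|lborel. ek k x) = (if k = 0 then complex_of_real (2*pi) else 0)"
proof (cases "k = 0")
  case True
  then show ?thesis by (simp add: set_lebesgue_integral_def scaleR_conv_of_real)
next
  case False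
  have "set_integrable lborel {-pi..pi} (ek k)"
    unfolding set_integrable_def by (intro borel_integrable_compact continuous_intros) auto
  then have "(LINT x:{-pi..pi}|lborel. ek k x) = integral {-pi..pi} (ek k)"
    by (rule set_borel_integral_eq_integral)
  also have "(ek k has_integral (1 / (\<i> * of_int k) * ek k pi - 1 / (\<i> * of_int k) * ek k (-pi))) {-pi..pi}"
  proof (rule fundamental_theorem_of_calculus)
    fix x :: real
    have "((\<lambda>x. 1 / (\<i> * of_int k) * ek k x) has_vector_derivative (1 / (\<i> * of_int k) * (\<i> * of_int k * ek k x))) (at x within {-pi..pi})"
      by (rule has_vector_derivative_mult_right[OF ek_has_vector_derivative])
    then show "((\<lambda>x. 1 / (\<i> * of_int k) * ek k x) has_vector_derivative ek k x) (at x within {-pi..pi})"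
      using False by simp
  qed simp
  then have "integral {-pi..pi} (ek k) = 1 / (\<i> * of_int k) * ek k pi - 1 / (\<i> * of_int k) * ek k (-pi)"
    by (rule integral_unique)
  also have "ek k pi = ek k (-pi)" using ek_periodic[of k "-pi"] by simp
  finally show ?thesis using False by simp
qed

lemma periodic_L1_ek_mult: "periodic_L1 g \<Longrightarrow> periodic_L1 (\<lambda>x. g x * ek k x)"
  by (rule periodic_L1_mult_bounded[where B=1]) (auto intro!: continuous_intros)

lemma fourier_coeff_eq:
  assumes "periodic_L1 g"
  shows "fourier_coeff g k = complex_of_real (1/(2*pi)) * (LINT x:{-pi..pi}|lborel. g x * ek (-k) x)"
proof -
  have [measurable]: "g \<in> borel_measurable borel" using assms by measurable
  show ?thesis unfolding fourier_coeff_def exp_eq_ek by (subst set_lebesgue_integral_lebesgue_eq_lborel) auto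
qed

lemma integral_mult_ek:
  assumes "periodic_L1 g"
  shows "(LINT x:{-pi..pi}|lborel. g x * ek k x) = complex_of_real (2*pi) * fourier_coeff g (-k)"
  by (simp add: fourier_coeff_eq[OF assms])

lemma fourier_coeff_diff:
  assumes "periodic_L1 f" "periodic_L1 g"
  shows "fourier_coeff (\<lambda>x. f x - g x) k = fourier_coeff f k - fourier_coeff g k"
proof -
  have "(LINT x:{-pi..pi}|lborel. (f x - g x) * ek (-k) x) =
      (LINT x:{-pi..pi}|lborel. f x * ek (-k) x) - (LINT x:{-pi..pi}|lborel. g x * ek (-k) x)"
    unfolding left_diff_distrib
    by (rule set_integral_diff(2)[OF periodic_L1_integrable periodic_L1_integrable])
       (intro periodic_L1_ek_mult assms)+
  then show ?thesis
    by (simp add: fourier_coeff_eq assms periodic_L1_diff right_diff_distrib)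
qed

lemma fourier_coeff_shift:
  assumes g: "periodic_L1 g"
  shows "fourier_coeff (\<lambda>x. g (x + h)) k = ek k h * fourier_coeff g k"
proof -
  have *: "g (x + h) * ek (-k) x = ek k h * (g (x + h) * ek (-k) (x + h))" for x
    using ek_add[of k "-k" h] by (simp add: ek_arg_add)
  have "(LINT x:{-pi..pi}|lborel. g (x + h) * ek (-k) x) = ek k h * (LINT x:{-pi..pi}|lborel. g (x + h) * ek (-k) (x + h))"
    unfolding * by (rule set_integral_mult_right)
  also have "(LINT x:{-pi..pi}|lborel. g (x + h) * ek (-k) (x + h)) = (LINT x:{-pi..pi}|lborel. g x * ek (-k) x)"
    by (rule set_integral_periodic_shift[OF periodic_L1_ek_mult[OF g]])
  finally show ?thesis by (simp add: fourier_coeff_eq[OF g] fourier_coeff_eq[OF periodic_L1_shift[OF g]])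
qed

lemma periodic_L1_trig: "periodic_L1 (\<lambda>x. \<Sum>j\<in>J. a j * ek j x)"
  by (intro periodic_L1_continuous continuous_intros) auto

lemma set_integral_sum:
  fixes f :: "'i \<Rightarrow> 'a \<Rightarrow> complex"
  assumes "\<And>i. i \<in> I \<Longrightarrow> set_integrable M A (f i)"
  shows "(LINT x:A|M. (\<Sum>i\<in>I. f i x)) = (\<Sum>i\<in>I. LINT x:A|M. f i x)"
  using assms unfolding set_lebesgue_integral_def set_integrable_def scaleR_sum_right
  by (intro Bochner_Integration.integral_sum)

lemma set_integrable_sum:
  fixes f :: "'i \<Rightarrow> 'a \<Rightarrow> complex"
  assumes "\<And>i. i \<in> I \<Longrightarrow> set_integrable M A (f i)"
  shows "set_integrable M A (\<lambda>x. \<Sum>i\<in>I. f i x)"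
  using assms unfolding set_integrable_def scaleR_sum_right
  by (intro Bochner_Integration.integrable_sum)

lemma fourier_coeff_trig:
  assumes "finite J"
  shows "fourier_coeff (\<lambda>x. \<Sum>j\<in>J. a j * ek j x) k = (if k \<in> J then a k else 0)"
proof -
  have eq: "(\<Sum>j\<in>J. a j * ek j x) * ek (-k) x = (\<Sum>j\<in>J. a j * ek (j - k) x)" for x
    unfolding sum_distrib_right using ek_add[of _ "-k" x] by (simp add: mult.assoc)
  have "(LINT x:{-pi..pi}|lborel. (\<Sum>j\<in>J. a j * ek (j - k) x)) = (\<Sum>j\<in>J. LINT x:{-pi..pi}|lborel. a j * ek (j - k) x)"
    by (intro set_integral_sum) (auto simp: set_integrable_def intro!: borel_integrable_compact continuous_intros)
  also have "\<dots> = (\<Sum>j\<in>J. if j = k then a k * complex_of_real (2*pi) else 0)"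
    by (intro sum.cong refl) (simp add: integral_ek)
  also have "\<dots> = (if k \<in> J then a k * complex_of_real (2*pi) else 0)"
    using assms by (simp add: sum.delta)
  finally show ?thesis by (simp add: fourier_coeff_eq[OF periodic_L1_trig] eq)
qed

lemma fourier_partial_sum_eq: "fourier_partial_sum f n x = (\<Sum>k\<in>{- int n..int n}. fourier_coeff f k * ek k x)"
  by (simp add: fourier_partial_sum_def exp_eq_ek)

section \<open>The Dirichlet and Fejer kernels\<close>

definition dirichlet :: "nat \<Rightarrow> real \<Rightarrow> complex" where
  "dirichlet N t = (\<Sum>j<N. ek (int j) t)"

lemma continuous_on_dirichlet [continuous_intros]: "continuous_on A f \<Longrightarrow> continuous_on A (\<lambda>x. dirichlet N (f x))"
  unfolding dirichlet_def by (intro continuous_intros)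

lemma dirichlet_measurable [measurable]: "dirichlet N \<in> borel_measurable borel"
  by (intro borel_measurable_continuous_onI continuous_on_dirichlet continuous_on_id)

lemma dirichlet_periodic [simp]: "dirichlet N (t + 2*pi) = dirichlet N t"
  by (simp add: dirichlet_def)

lemma norm_dirichlet_le: "norm (dirichlet N t) \<le> real N"
  unfolding dirichlet_def by (rule order_trans[OF norm_sum]) simp

text \<open>
  A crude form of Jordan's inequality: the mean value theorem gives \<open>sin y \<ge> y cos y\<close>, which is enough
  up to \<open>pi/3\<close>; beyond that monotonicity is enough.
\<close>

lemma abs_sin_ge_half:
  fixes y :: real assumes "\<bar>y\<bar> \<le> pi/2" shows "\<bar>y\<bar>/2 \<le> \<bar>sin y\<bar>"
proof -
  have *: "y/2 \<le> sin y" if "0 \<le> y" "y \<le> pi/2" for y :: real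
  proof (cases "y \<le> pi/3")
    case True
    show ?thesis
    proof (cases "y = 0")
      case False
      then have "0 < y" using that by simp
      from MVT2[of 0 y sin cos, OF this] obtain z where z: "0 < z" "z < y" "sin y - sin 0 = (y - 0) * cos z"
        by (auto intro: DERIV_sin)
      have "cos (pi/3) \<le> cos z" using z True pi_gt_zero by (intro cos_monotone_0_pi_le) auto
      then show ?thesis using z mult_left_mono[of "1/2" "cos z" y] that by (simp add: cos_60)
    qed simp
  next
    case False
    have "sin (pi/3) \<le> sin y" using False that by (intro sin_monotone_2pi_le) auto
    moreover have "pi/4 \<le> sin (pi/3)"
    proof -
      have "(1.6::real) \<le> sqrt 3" by (rule real_le_rsqrt) (simp add: power2_eq_square)
      then show ?thesis using pi_less_4 pi_approx by (simp add: sin_60)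
    qed
    ultimately show ?thesis using that by simp
  qed
  show ?thesis using *[of y] *[of "-y"] assms by (cases "0 \<le> y") auto
qed

text \<open>
  The geometric sum, with \<open>|e^(i t) - 1| = 2 |sin (t/2)|\<close>.
\<close>

lemma norm_dirichlet_mult_le:
  assumes "\<bar>t\<bar> \<le> pi" shows "norm (dirichlet N t) * \<bar>t\<bar> \<le> 4"
proof -
  have tel: "dirichlet N t * (ek 1 t - 1) = ek (int N) t - 1"
  proof (induction N)
    case (Suc N)
    have "dirichlet (Suc N) t * (ek 1 t - 1) = dirichlet N t * (ek 1 t - 1) + ek (int N) t * (ek 1 t - 1)"
      by (simp add: dirichlet_def algebra_simps)
    also have "\<dots> = ek (int N + 1) t - 1" by (simp only: Suc ek_add) (simp add: algebra_simps)
    finally show ?case by (simp add: add.commute)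
  qed (simp add: dirichlet_def)
  have "(norm (ek 1 t - 1))\<^sup>2 = (2 * \<bar>sin (t/2)\<bar>)\<^sup>2"
  proof -
    have c: "cos t = 1 - 2 * (sin (t/2))\<^sup>2" using cos_double_sin[of "t/2"] by simp
    have "(norm (ek 1 t - 1))\<^sup>2 = (cos t - 1)\<^sup>2 + (sin t)\<^sup>2" by (simp add: ek_def cmod_def)
    also have "\<dots> = 2 - 2 * cos t" using sin_cos_squared_add[of t] by (simp add: power2_eq_square algebra_simps)
    finally show ?thesis by (simp add: c power_mult_distrib)
  qed
  then have "norm (ek 1 t - 1) = 2 * \<bar>sin (t/2)\<bar>" by (subst (asm) power2_eq_iff_nonneg) auto
  also have "\<dots> \<ge> \<bar>t\<bar>/2" using abs_sin_ge_half[of "t/2"] assms by auto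
  finally have "norm (dirichlet N t) * (\<bar>t\<bar>/2) \<le> norm (dirichlet N t) * norm (ek 1 t - 1)"
    by (intro mult_left_mono) auto
  also have "\<dots> = norm (ek (int N) t - 1)" by (simp flip: norm_mult add: tel)
  also have "\<dots> \<le> 2" using norm_triangle_ineq4[of "ek (int N) t" 1] by simp
  finally show ?thesis by simp
qed

text \<open>
  The Lebesgue constants grow logarithmically. The two bounds \<open>|D| \<le> N\<close> and \<open>|D| \<le> 4/|t|\<close> combine to
  \<open>|D| \<le> 5 / (|t| + 1/N)\<close>, which has an elementary antiderivative on each side of \<open>0\<close>.
\<close>

lemma nn_integral_dirichlet_le:
  assumes "N \<ge> 1"
  shows "(\<integral>\<^sup>+t\<in>{-pi..pi}. ennreal (norm (dirichlet N t)) \<partial>lborel) \<le> ennreal (10 * ln (real N) + 40)"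
proof -
  define c where "c = 1 / real N"
  have c: "0 < c" "c \<le> 1" using assms by (auto simp: c_def)
  have bound: "norm (dirichlet N t) \<le> 5 / (\<bar>t\<bar> + c)" if "\<bar>t\<bar> \<le> pi" for t
  proof -
    have "norm (dirichlet N t) * c \<le> 1" using norm_dirichlet_le[of N t] assms by (simp add: c_def)
    then have "norm (dirichlet N t) * (\<bar>t\<bar> + c) \<le> 5"
      using norm_dirichlet_mult_le[OF that, of N] by (simp add: distrib_left)
    then show ?thesis using c by (simp add: pos_le_divide_eq add_nonneg_pos)
  qed
  have "(\<integral>\<^sup>+t\<in>{-pi..pi}. ennreal (norm (dirichlet N t)) \<partial>lborel) \<le>
     (\<integral>\<^sup>+t. ennreal (5 / (c - t)) * indicator {-pi..0} t + ennreal (5 / (t + c)) * indicator {0..pi} t \<partial>lborel)"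
  proof (rule nn_integral_mono)
    fix t :: real
    show "ennreal (norm (dirichlet N t)) * indicator {-pi..pi} t \<le>
      ennreal (5 / (c - t)) * indicator {-pi..0} t + ennreal (5 / (t + c)) * indicator {0..pi} t"
    proof (cases "0 \<le> t")
      case True
      then show ?thesis using bound[of t]
        by (cases "t \<le> pi") (auto simp: indicator_def intro!: add_increasing ennreal_leI)
    next
      case False
      then show ?thesis using bound[of t]
        by (cases "-pi \<le> t") (auto simp: indicator_def add.commute intro!: ennreal_leI)
    qed
  qed
  also have "\<dots> = (\<integral>\<^sup>+t. ennreal (5 / (c - t)) * indicator {-pi..0} t \<partial>lborel) + (\<integral>\<^sup>+t. ennreal (5 / (t + c)) * indicator {0..pi} t \<partial>lborel)"
    by (rule nn_integral_add) measurable
  also have "(\<integral>\<^sup>+t. ennreal (5 / (c - t)) * indicator {-pi..0} t \<partial>lborel) = ennreal ((- 5 * ln (c - 0)) - (- 5 * ln (c - (-pi))))"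
    using c by (intro nn_integral_FTC_Icc) (auto intro!: derivative_eq_intros)
  also have "(\<integral>\<^sup>+t. ennreal (5 / (t + c)) * indicator {0..pi} t \<partial>lborel) = ennreal (5 * ln (pi + c) - 5 * ln (0 + c))"
    using c by (intro nn_integral_FTC_Icc) (auto intro!: derivative_eq_intros)
  also have "ennreal ((- 5 * ln (c - 0)) - (- 5 * ln (c - (-pi)))) + ennreal (5 * ln (pi + c) - 5 * ln (0 + c))
      = ennreal (10 * ln (pi + c) - 10 * ln c)"
  proof -
    have "ln c \<le> ln (pi + c)" using c by (simp add: ln_le_cancel_iff add_pos_pos)
    then show ?thesis by (subst ennreal_plus[symmetric]) (auto simp: algebra_simps)
  qed
  also have "\<dots> \<le> ennreal (10 * ln (real N) + 40)"
  proof (rule ennreal_leI)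
    have "ln (pi + c) \<le> pi + c - 1" using c by (intro ln_le_minus_one) (simp add: add_pos_pos)
    then have "ln (pi + c) \<le> 4" using c pi_less_4 by linarith
    moreover have "ln c = - ln (real N)" using assms by (simp add: c_def ln_div)
    ultimately show "10 * ln (pi + c) - 10 * ln c \<le> 10 * ln (real N) + 40" by simp
  qed
  finally show ?thesis .
qed

text \<open>
  \<open>N\<close> times the classical Fejer kernel of order \<open>N\<close>.
\<close>

definition fejer :: "nat \<Rightarrow> real \<Rightarrow> real" where
  "fejer N t = (norm (dirichlet N t))\<^sup>2"

lemma fejer_nonneg [simp]: "0 \<le> fejer N t" by (simp add: fejer_def)
lemma fejer_periodic [simp]: "fejer N (t + 2*pi) = fejer N t" by (simp add: fejer_def)
lemma continuous_on_fejer [continuous_intros]: "continuous_on A f \<Longrightarrow> continuous_on A (\<lambda>x. fejer N (f x))"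
  unfolding fejer_def by (intro continuous_intros)
lemma fejer_measurable [measurable]: "fejer N \<in> borel_measurable borel"
  by (intro borel_measurable_continuous_onI continuous_on_fejer continuous_on_id)

definition fejer_coeff :: "nat \<Rightarrow> int \<Rightarrow> real" where
  "fejer_coeff N k = max 0 (real N - \<bar>real_of_int k\<bar>)"

lemma sum_symmetric_int:
  fixes h :: "int \<Rightarrow> 'a::comm_monoid_add"
  shows "(\<Sum>k\<in>{-int n..int n}. h k) = h 0 + ((\<Sum>k=1..n. h (int k)) + (\<Sum>k=1..n. h (- int k)))"
proof (induction n)
  case (Suc n)
  have eq: "{-int (Suc n)..int (Suc n)} = insert (int (Suc n)) (insert (- int (Suc n)) {-int n..int n})" by auto
  have "(\<Sum>k\<in>{-int (Suc n)..int (Suc n)}. h k) = h (int (Suc n)) + (h (- int (Suc n)) + (\<Sum>k\<in>{-int n..int n}. h k))"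
    unfolding eq by simp
  then show ?case unfolding Suc by (simp add: ac_simps)
qed simp

text \<open>
  The coefficients vanish for \<open>|k| \<ge> N\<close>, which is why the range of summation may be any larger one:
  kernels of different orders can then be subtracted termwise. In the induction, two consecutive kernels
  differ by the exponential sum over \<open>|k| \<le> N\<close>.
\<close>

lemma fejer_expansion:
  assumes "N \<le> M"
  shows "complex_of_real (fejer N t) = (\<Sum>k\<in>{-int M..int M}. complex_of_real (fejer_coeff N k) * ek k t)"
  using assms
proof (induction N)
  case 0
  then show ?case by (simp add: fejer_def dirichlet_def fejer_coeff_def)
next
  case (Suc N)
  have conv: "complex_of_real (fejer n t) = dirichlet n t * cnj (dirichlet n t)" for n
    unfolding fejer_def by (rule complex_norm_square)
  have rev: "(\<Sum>j<N. h (int N - int j)) = (\<Sum>k=1..N. h (int k))" for h :: "int \<Rightarrow> complex"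
    by (rule sum.reindex_bij_witness[where i="\<lambda>k. N - k" and j="\<lambda>j. N - j"]) (auto simp: of_nat_diff)
  have "complex_of_real (fejer (Suc N) t) = complex_of_real (fejer N t) + (1 +
      (ek (int N) t * cnj (dirichlet N t) + ek (- int N) t * dirichlet N t))"
  proof -
    have "ek (int N) t * ek (- int N) t = 1" using ek_add[of "int N" "- int N" t] by simp
    then show ?thesis
      unfolding conv by (simp add: dirichlet_def cnj_ek algebra_simps)
  qed
  also have "ek (int N) t * cnj (dirichlet N t) = (\<Sum>k=1..N. ek (int k) t)"
    unfolding rev[of "\<lambda>k. ek k t", symmetric] dirichlet_def cnj_sum sum_distrib_left cnj_ek
    by (simp flip: ek_add)
  also have "ek (- int N) t * dirichlet N t = (\<Sum>k=1..N. ek (- int k) t)"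
    unfolding rev[of "\<lambda>k. ek (- k) t", symmetric] dirichlet_def sum_distrib_left
    by (simp flip: ek_add)
  also have "1 + ((\<Sum>k=1..N. ek (int k) t) + (\<Sum>k=1..N. ek (- int k) t)) = (\<Sum>k\<in>{-int N..int N}. ek k t)"
    by (simp add: sum_symmetric_int)
  also have "\<dots> = (\<Sum>k\<in>{-int M..int M}. (if k \<in> {-int N..int N} then 1 else 0) * ek k t)"
    using Suc.prems by (intro sum.mono_neutral_cong_left) auto
  also have "complex_of_real (fejer N t) = (\<Sum>k\<in>{-int M..int M}. complex_of_real (fejer_coeff N k) * ek k t)"
    using Suc by simp
  also have "\<dots> + (\<Sum>k\<in>{-int M..int M}. (if k \<in> {-int N..int N} then 1 else 0) * ek k t)
     = (\<Sum>k\<in>{-int M..int M}. complex_of_real (fejer_coeff (Suc N) k) * ek k t)"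
    unfolding sum.distrib[symmetric] distrib_right[symmetric]
  proof (intro sum.cong refl arg_cong2[where f="(*)"])
    fix k :: int
    have "fejer_coeff (Suc N) k = fejer_coeff N k + (if k \<in> {-int N..int N} then 1 else 0)"
    proof (cases "\<bar>k\<bar> \<le> int N")
      case True
      then have "\<bar>real_of_int k\<bar> \<le> real N" by linarith
      then show ?thesis using True by (auto simp: fejer_coeff_def)
    next
      case False
      then have "\<bar>real_of_int k\<bar> \<ge> real N + 1" by linarith
      then show ?thesis using False by (auto simp: fejer_coeff_def)
    qed
    then show "complex_of_real (fejer_coeff N k) + (if k \<in> {-int N..int N} then 1 else 0) = complex_of_real (fejer_coeff (Suc N) k)"
      by simp
  qed
  finally show ?case .
qed

lemma integral_fejer: "(LINT t:{-pi..pi}|lborel. fejer N t) = 2 * pi * real N"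
proof -
  have "complex_of_real (LINT t:{-pi..pi}|lborel. fejer N t) = (LINT t:{-pi..pi}|lborel. complex_of_real (fejer N t))"
    by (simp add: set_integral_complex_of_real)
  also have "\<dots> = (LINT t:{-pi..pi}|lborel. (\<Sum>k\<in>{-int N..int N}. complex_of_real (fejer_coeff N k) * ek k t))"
    by (simp add: fejer_expansion[of N N])
  also have "\<dots> = (\<Sum>k\<in>{-int N..int N}. LINT t:{-pi..pi}|lborel. complex_of_real (fejer_coeff N k) * ek k t)"
    by (intro set_integral_sum) (auto simp: set_integrable_def intro!: borel_integrable_compact continuous_intros)
  also have "\<dots> = (\<Sum>k\<in>{-int N..int N}. if k = 0 then complex_of_real (2 * pi * real N) else 0)"
    by (intro sum.cong refl) (simp add: integral_ek fejer_coeff_def)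
  also have "\<dots> = complex_of_real (2 * pi * real N)" by (simp add: sum.delta)
  finally show ?thesis by (simp only: of_real_eq_iff)
qed

lemma nn_integral_eq_set_integral:
  fixes w :: "real \<Rightarrow> real"
  assumes "continuous_on UNIV w" "\<And>x. 0 \<le> w x"
  shows "(\<integral>\<^sup>+t\<in>{a..b}. ennreal (w t) \<partial>lborel) = ennreal (LINT t:{a..b}|lborel. w t)"
proof -
  have "set_integrable lborel {a..b} w"
    unfolding set_integrable_def using assms(1)
    by (intro borel_integrable_compact compact_Icc) (auto intro: continuous_on_subset)
  then have "(\<integral>\<^sup>+t. ennreal (indicator {a..b} t *\<^sub>R w t) \<partial>lborel) = ennreal (LINT t:{a..b}|lborel. w t)"
    unfolding set_lebesgue_integral_def set_integrable_def using assms(2) by (intro nn_integral_eq_integral) auto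
  moreover have "(\<integral>\<^sup>+t. ennreal (indicator {a..b} t *\<^sub>R w t) \<partial>lborel) = (\<integral>\<^sup>+t\<in>{a..b}. ennreal (w t) \<partial>lborel)"
    by (intro nn_integral_cong) (auto simp: indicator_def)
  ultimately show ?thesis by simp
qed

lemma nn_integral_fejer: "(\<integral>\<^sup>+t\<in>{-pi..pi}. ennreal (fejer N t) \<partial>lborel) = ennreal (2 * pi * real N)"
  by (subst nn_integral_eq_set_integral) (auto intro!: continuous_intros simp: integral_fejer)

section \<open>Convolution with a kernel\<close>

lemma norm_set_integral_le_nn:
  fixes u :: "'a \<Rightarrow> complex"
  shows "ennreal (norm (LINT t:A|M. u t)) \<le> (\<integral>\<^sup>+t\<in>A. ennreal (norm (u t)) \<partial>M)"
proof (cases "set_integrable M A u")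
  case True
  then have "ennreal (norm (LINT t:A|M. u t)) \<le> (\<integral>\<^sup>+t. ennreal (norm (indicator A t *\<^sub>R u t)) \<partial>M)"
    unfolding set_integrable_def set_lebesgue_integral_def by (rule integral_norm_bound_ennreal)
  also have "\<dots> = (\<integral>\<^sup>+t\<in>A. ennreal (norm (u t)) \<partial>M)"
    by (intro nn_integral_cong) (auto simp: indicator_def)
  finally show ?thesis .
next
  case False
  then show ?thesis by (simp add: set_integrable_def set_lebesgue_integral_def not_integrable_integral_eq)
qed

text \<open>
  Young's inequality, by interchanging the order of integration and translating the kernel.
\<close>

lemma L1_norm_convolution_le:
  fixes f K h :: "real \<Rightarrow> complex"
  assumes f: "periodic_L1 f" and K: "continuous_on UNIV K" "\<And>x. K (x + 2*pi) = K x"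
    and h: "periodic_L1 h" "\<And>x. h x = (LINT t:{-pi..pi}|lborel. f t * K (x - t))"
    and c: "(\<integral>\<^sup>+x\<in>{-pi..pi}. ennreal (norm (K x)) \<partial>lborel) \<le> ennreal c" "0 \<le> c"
  shows "L1_norm h \<le> c * L1_norm f"
proof -
  let ?I = "{-pi..pi}"
  have [measurable]: "f \<in> borel_measurable borel" using f by measurable
  have [measurable]: "K \<in> borel_measurable borel" using K(1) by (rule borel_measurable_continuous_onI)
  have "(\<integral>\<^sup>+x\<in>?I. ennreal (norm (h x)) \<partial>lborel)
      \<le> (\<integral>\<^sup>+x\<in>?I. (\<integral>\<^sup>+t\<in>?I. ennreal (norm (f t * K (x - t))) \<partial>lborel) \<partial>lborel)"
    unfolding h(2) by (intro nn_integral_mono mult_right_mono norm_set_integral_le_nn) auto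
  also have "\<dots> = (\<integral>\<^sup>+x. (\<integral>\<^sup>+t. ennreal (norm (f t)) * indicator ?I t * (ennreal (norm (K (x - t))) * indicator ?I x) \<partial>lborel) \<partial>lborel)"
    by (subst nn_integral_multc[symmetric]) (auto intro!: nn_integral_cong simp: norm_mult ennreal_mult ac_simps)
  also have "\<dots> = (\<integral>\<^sup>+t. (\<integral>\<^sup>+x. ennreal (norm (f t)) * indicator ?I t * (ennreal (norm (K (x - t))) * indicator ?I x) \<partial>lborel) \<partial>lborel)"
    by (rule lborel_pair.Fubini') measurable
  also have "\<dots> = (\<integral>\<^sup>+t. ennreal (norm (f t)) * indicator ?I t * (\<integral>\<^sup>+x\<in>?I. ennreal (norm (K x)) \<partial>lborel) \<partial>lborel)"
  proof (intro nn_integral_cong)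
    fix t :: real
    have "(\<integral>\<^sup>+x\<in>?I. ennreal (norm (K (x - t))) \<partial>lborel) = (\<integral>\<^sup>+x\<in>?I. ennreal (norm (K x)) \<partial>lborel)"
      using nn_integral_periodic_shift[of "\<lambda>x. ennreal (norm (K x))" "-t"] K(2) by simp
    then show "(\<integral>\<^sup>+x. ennreal (norm (f t)) * indicator ?I t * (ennreal (norm (K (x - t))) * indicator ?I x) \<partial>lborel)
       = ennreal (norm (f t)) * indicator ?I t * (\<integral>\<^sup>+x\<in>?I. ennreal (norm (K x)) \<partial>lborel)"
      by (subst nn_integral_cmult) auto
  qed
  also have "\<dots> = ennreal (L1_norm f) * (\<integral>\<^sup>+x\<in>?I. ennreal (norm (K x)) \<partial>lborel)"
    by (subst nn_integral_multc) (auto simp: ennreal_L1_norm[OF f])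
  also have "\<dots> \<le> ennreal (L1_norm f) * ennreal c" by (intro mult_left_mono c) simp
  also have "\<dots> = ennreal (c * L1_norm f)" using c(2) by (simp add: ennreal_mult[symmetric] L1_norm_nonneg mult.commute)
  finally show ?thesis using h(1) c(2) by (simp add: L1_norm_le_iff_nn L1_norm_nonneg)
qed

section \<open>The integral modulus of continuity\<close>

text \<open>
  The contribution of a single shift to the modulus of continuity; unlike the modulus it makes sense
  for negative shifts.
\<close>

definition L1_increment :: "(real \<Rightarrow> complex) \<Rightarrow> real \<Rightarrow> real" where
  "L1_increment g s = L1_norm (\<lambda>x. g (x + s) - g x)"

lemma modulus_L_eq: "modulus_L g t = (SUP h\<in>{0..t}. L1_increment g h)"
  by (simp add: modulus_L_def L1_increment_def)

lemma periodic_L1_increment: "periodic_L1 g \<Longrightarrow> periodic_L1 (\<lambda>x. g (x + s) - g x)"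
  by (intro periodic_L1_diff periodic_L1_shift)

lemma L1_increment_nonneg: "0 \<le> L1_increment g s"
  by (simp add: L1_increment_def L1_norm_nonneg)

lemma L1_increment_bound: "periodic_L1 g \<Longrightarrow> L1_increment g s \<le> 2 * L1_norm g"
  using L1_norm_triangle_diff[OF periodic_L1_shift, of g g s] by (simp add: L1_increment_def L1_norm_shift)

lemma L1_increment_le_modulus: "periodic_L1 g \<Longrightarrow> 0 \<le> h \<Longrightarrow> h \<le> t \<Longrightarrow> L1_increment g h \<le> modulus_L g t"
  unfolding modulus_L_eq by (rule cSUP_upper) (auto intro!: bdd_aboveI2 L1_increment_bound)

lemma modulus_L_least: "0 \<le> t \<Longrightarrow> (\<And>h. 0 \<le> h \<Longrightarrow> h \<le> t \<Longrightarrow> L1_increment g h \<le> c) \<Longrightarrow> modulus_L g t \<le> c"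
  unfolding modulus_L_eq by (rule cSUP_least) auto

lemma modulus_L_nonneg: "periodic_L1 g \<Longrightarrow> 0 \<le> t \<Longrightarrow> 0 \<le> modulus_L g t"
  using L1_increment_le_modulus[of g 0 t] L1_increment_nonneg[of g 0] by linarith

lemma modulus_L_mono: "periodic_L1 g \<Longrightarrow> 0 \<le> s \<Longrightarrow> s \<le> t \<Longrightarrow> modulus_L g s \<le> modulus_L g t"
  by (rule modulus_L_least) (auto intro!: L1_increment_le_modulus)

lemma L1_norm_minus_commute: "L1_norm (\<lambda>x. f x - g x) = L1_norm (\<lambda>x. g x - f x)"
  by (simp add: L1_norm_def norm_minus_commute)

lemma L1_increment_minus:
  assumes "periodic_L1 g" shows "L1_increment g (- s) = L1_increment g s"
proof -
  have "L1_increment g (- s) = L1_norm (\<lambda>x. g (x + s + - s) - g (x + s))"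
    unfolding L1_increment_def using L1_norm_shift[OF periodic_L1_increment[OF assms, of "-s"], of s] by simp
  then show ?thesis by (simp add: L1_increment_def L1_norm_minus_commute)
qed

lemma L1_increment_add:
  assumes "periodic_L1 g" shows "L1_increment g (s + u) \<le> L1_increment g s + L1_increment g u"
proof -
  have "L1_increment g (s + u) = L1_norm (\<lambda>x. (g (x + u + s) - g (x + u)) + (g (x + u) - g x))"
    by (simp add: L1_increment_def ac_simps)
  also have "\<dots> \<le> L1_norm (\<lambda>x. g (x + u + s) - g (x + u)) + L1_norm (\<lambda>x. g (x + u) - g x)"
    by (intro L1_norm_triangle periodic_L1_increment assms periodic_L1_shift[OF periodic_L1_increment[OF assms, of s], of u])
  also have "L1_norm (\<lambda>x. g (x + u + s) - g (x + u)) = L1_increment g s"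
    unfolding L1_increment_def by (rule L1_norm_shift[OF periodic_L1_increment[OF assms]])
  finally show ?thesis by (simp add: L1_increment_def)
qed

lemma L1_increment_multiple:
  assumes "periodic_L1 g" shows "L1_increment g (real m * u) \<le> real m * L1_increment g u"
proof (induction m)
  case 0
  then show ?case by (simp add: L1_increment_def L1_norm_def set_lebesgue_integral_def)
next
  case (Suc m)
  have "L1_increment g (real (Suc m) * u) \<le> L1_increment g (real m * u) + L1_increment g u"
    using L1_increment_add[OF assms, of "real m * u" u] by (simp add: distrib_right add.commute)
  then show ?case using Suc by (simp add: distrib_right)
qed

text \<open>
  A shift by \<open>s\<close> is divided into \<open>\<lceil>|s|/\<delta>\<rceil>\<close> equal shifts of size at most \<open>\<delta>\<close>.
\<close>

lemma L1_increment_scale: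
  assumes g: "periodic_L1 g" and "\<delta> > 0"
  shows "L1_increment g s \<le> (1 + \<bar>s\<bar> / \<delta>) * modulus_L g \<delta>"
proof -
  have main: "L1_increment g s \<le> (1 + s / \<delta>) * modulus_L g \<delta>" if "s \<ge> 0" for s
  proof -
    define m where "m = nat \<lceil>s / \<delta>\<rceil> + (if s = 0 then 1 else 0)"
    have m: "0 < m" "s / \<delta> \<le> real m" "real m \<le> 1 + s / \<delta>"
    proof -
      have "0 < s / \<delta>" if "s \<noteq> 0" using \<open>s \<ge> 0\<close> that assms(2) by simp
      then show "0 < m" by (auto simp: m_def)
      show "s / \<delta> \<le> real m" unfolding m_def by (auto intro: order_trans[OF real_nat_ceiling_ge])
      have "0 \<le> s / \<delta>" using \<open>s \<ge> 0\<close> assms(2) by simp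
      then show "real m \<le> 1 + s / \<delta>"
        using ceiling_correct[of "s / \<delta>"] by (cases "s = 0") (auto simp: m_def of_nat_nat)
    qed
    have "L1_increment g s = L1_increment g (real m * (s / real m))" using m by simp
    also have "\<dots> \<le> real m * L1_increment g (s / real m)" by (rule L1_increment_multiple[OF g])
    also have "\<dots> \<le> real m * modulus_L g \<delta>"
      using m that assms(2) by (intro mult_left_mono L1_increment_le_modulus[OF g]) (auto simp: field_simps)
    also have "\<dots> \<le> (1 + s / \<delta>) * modulus_L g \<delta>"
      using m modulus_L_nonneg[OF g] assms(2) by (intro mult_right_mono) auto
    finally show ?thesis .
  qed
  show ?thesis
    using main[of s] main[of "-s"] L1_increment_minus[OF g, of s] by (cases "s \<ge> 0") auto
qed

lemma modulus_L_double:
  assumes g: "periodic_L1 g" and "0 \<le> t"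
  shows "modulus_L g (2 * t) \<le> 2 * modulus_L g t"
proof (rule modulus_L_least)
  fix h assume h: "0 \<le> h" "h \<le> 2 * t"
  have "L1_increment g h \<le> 2 * L1_increment g (h/2)" using L1_increment_multiple[OF g, of 2 "h/2"] by simp
  also have "\<dots> \<le> 2 * modulus_L g t" using h L1_increment_le_modulus[OF g, of "h/2" t] by simp
  finally show "L1_increment g h \<le> 2 * modulus_L g t" .
qed (use assms in auto)

section \<open>Functions with a spectral gap\<close>

lemma dirichlet_minus: "dirichlet N (- t) = cnj (dirichlet N t)"
  by (simp add: dirichlet_def ek_arg_minus cnj_ek)

lemma fejer_minus [simp]: "fejer N (- t) = fejer N t"
  by (simp add: fejer_def dirichlet_minus)

lemma fejer_mult_square_le: "\<bar>t\<bar> \<le> pi \<Longrightarrow> t\<^sup>2 * fejer N t \<le> 16"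
  using power_mono[OF norm_dirichlet_mult_le[of t N], of 2] by (simp add: fejer_def power_mult_distrib mult.commute)

lemma fejer_lower_bound:
  assumes "\<bar>t\<bar> \<le> 1 / real N" "N > 0" shows "(real N / 2)\<^sup>2 \<le> fejer N t"
proof -
  have "real N / 2 = (\<Sum>j<N. 1/2)" by simp
  also have "\<dots> \<le> (\<Sum>j<N. Re (ek (int j) t))"
  proof (intro sum_mono)
    fix j assume "j \<in> {..<N}"
    then have "real j * \<bar>t\<bar> \<le> real N * (1 / real N)" using assms by (intro mult_mono) auto
    then have "\<bar>real j * t\<bar> \<le> 1" using assms by (simp add: abs_mult)
    moreover have "1 \<le> pi/3" using pi_gt3 by simp
    ultimately have "cos (pi/3) \<le> cos \<bar>real j * t\<bar>" by (intro cos_monotone_0_pi_le) auto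
    then show "1/2 \<le> Re (ek (int j) t)" by (simp add: ek_def cos_60)
  qed
  also have "\<dots> = Re (dirichlet N t)" by (simp add: dirichlet_def)
  also have "\<dots> \<le> norm (dirichlet N t)" by (rule complex_Re_le_cmod)
  finally show ?thesis unfolding fejer_def by (intro power_mono) auto
qed

text \<open>
  Let \<open>P\<close> be the square of the Fejer kernel of order about \<open>n/2\<close>, the Jackson kernel. It has degree at
  most \<open>n\<close>, so \<open>\<integral> h t P (x - t) dt = 0\<close> by the gap, and hence
  \<open>h x \<integral> P = \<integral> (h x - h t) P (x - t) dt\<close>. Taking norms gives
  \<open>||h|| \<integral> P \<le> \<integral> ||h (\<cdot> + s) - h|| P s ds \<le> \<omega>(h, \<delta>) \<integral> (1 + |s|/\<delta>) P s ds\<close>, and the kernel is so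
  concentrated that the last integral is at most a constant times \<open>\<integral> P\<close>.
\<close>

lemma spectral_gap_norm_le_modulus:
  assumes h: "periodic_L1 h" and gap: "\<And>k. \<bar>k\<bar> \<le> int n \<Longrightarrow> fourier_coeff h k = 0"
  shows "L1_norm h \<le> 1026 * modulus_L h (1 / (real n + 1))"
proof -
  let ?I = "{-pi..pi}"
  define m where "m = n div 2 + 1"
  define \<delta> where "\<delta> = 1 / (real n + 1)"
  define \<omega> where "\<omega> = modulus_L h \<delta>"
  define P where "P t = (fejer m t)\<^sup>2" for t
  have m: "m > 0" "2 * m - 2 \<le> n" "real n + 1 \<le> 2 * real m" by (auto simp: m_def)
  have d: "\<delta> > 0" "1 / \<delta> \<le> 2 * real m" using m by (auto simp: \<delta>_def)
  have \<omega>: "0 \<le> \<omega>" unfolding \<omega>_def using modulus_L_nonneg[OF h] d by simp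
  have P: "continuous_on UNIV P" "P (x + 2*pi) = P x" "P (-x) = P x" "0 \<le> P x" for x
    by (auto simp: P_def intro!: continuous_intros)
  have [measurable]: "h \<in> borel_measurable borel" using h by measurable
  have [measurable]: "P \<in> borel_measurable borel" using P(1) by (rule borel_measurable_continuous_onI)
  define p where "p = (LINT t:?I|lborel. P t)"
  have p_nn: "(\<integral>\<^sup>+t\<in>?I. ennreal (P t) \<partial>lborel) = ennreal p"
    unfolding p_def by (rule nn_integral_eq_set_integral[OF P(1,4)])
  \<comment> \<open>On \<open>|t| \<le> 1/m\<close> all terms of the Dirichlet kernel have real part at least 1/2, so \<open>P \<ge> (m/2)^4\<close>.\<close>
  have p_lower: "real m ^ 3 / 8 \<le> p" and p_pos: "0 < p"
  proof -
    have "1 / real m \<le> 1" using m by simp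
    then have sub: "1 / real m \<le> pi" using pi_gt3 by linarith
    have "ennreal ((real m / 2)^4 * (2 / real m)) = (\<integral>\<^sup>+t. ennreal ((real m / 2)^4) * indicator {- (1/real m)..1/real m} t \<partial>lborel)"
      using m by (subst nn_integral_cmult_indicator) (auto simp: ennreal_mult[symmetric])
    also have "\<dots> \<le> (\<integral>\<^sup>+t\<in>?I. ennreal (P t) \<partial>lborel)"
    proof (intro nn_integral_mono)
      fix t :: real
      have "(real m / 2)^4 \<le> P t" if "\<bar>t\<bar> \<le> 1 / real m"
        using power_mono[OF fejer_lower_bound[OF that m(1)], of 2] by (simp add: P_def flip: power_mult)
      then show "ennreal ((real m / 2)^4) * indicator {- (1/real m)..1/real m} t \<le> ennreal (P t) * indicator ?I t"
        using sub by (auto simp: indicator_def intro!: ennreal_leI)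
    qed
    finally have "ennreal ((real m / 2)^4 * (2 / real m)) \<le> ennreal p" unfolding p_nn .
    moreover have "0 \<le> p"
      unfolding p_def set_lebesgue_integral_def using P(4) by (intro integral_nonneg_AE) auto
    ultimately have "(real m / 2)^4 * (2 / real m) \<le> p" by (simp only: ennreal_le_iff)
    then show *: "real m ^ 3 / 8 \<le> p" using m by (simp add: power_divide power4_eq_xxxx power3_eq_cube field_simps)
    then show "0 < p" using m(1) by (smt (verit) zero_less_power of_nat_0_less_iff zero_less_divide_iff)
  qed
  have orth: "(LINT t:?I|lborel. h t * complex_of_real (P (x - t))) = 0" for x
  proof -
    let ?J = "{-int m..int m}"
    have expand: "h t * complex_of_real (P (x - t)) =
        (\<Sum>k\<in>?J. \<Sum>l\<in>?J. complex_of_real (fejer_coeff m k * fejer_coeff m l) * ek (k + l) x * (h t * ek (- (k + l)) t))" for t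
    proof -
      have "complex_of_real (P (x - t)) = complex_of_real (fejer m (x - t)) * complex_of_real (fejer m (x - t))"
        by (simp add: P_def power2_eq_square)
      also have "\<dots> = (\<Sum>k\<in>?J. \<Sum>l\<in>?J. (complex_of_real (fejer_coeff m k) * ek k (x - t)) * (complex_of_real (fejer_coeff m l) * ek l (x - t)))"
        unfolding fejer_expansion[of m m, OF order_refl] by (rule sum_product)
      also have "\<dots> = (\<Sum>k\<in>?J. \<Sum>l\<in>?J. complex_of_real (fejer_coeff m k * fejer_coeff m l) * ek (k + l) x * ek (- (k + l)) t)"
      proof (intro sum.cong refl)
        fix k l :: int
        have "ek k (x - t) * ek l (x - t) = ek (k + l) x * ek (- (k + l)) t"
          using ek_add[of k l "x - t"] by (simp only: ek_arg_diff)
        then show "(complex_of_real (fejer_coeff m k) * ek k (x - t)) * (complex_of_real (fejer_coeff m l) * ek l (x - t)) =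
            complex_of_real (fejer_coeff m k * fejer_coeff m l) * ek (k + l) x * ek (- (k + l)) t"
          by (simp only: of_real_mult mult.assoc mult.left_commute)
      qed
      finally show ?thesis by (simp add: sum_distrib_left ac_simps)
    qed
    have int: "set_integrable lborel ?I (\<lambda>t. c * (h t * ek j t))" for c j
      using periodic_L1_integrable[OF periodic_L1_ek_mult[OF h]] by (intro set_integrable_mult_right) auto
    have "(LINT t:?I|lborel. h t * complex_of_real (P (x - t))) =
       (\<Sum>k\<in>?J. \<Sum>l\<in>?J. complex_of_real (fejer_coeff m k * fejer_coeff m l) * ek (k + l) x * (LINT t:?I|lborel. h t * ek (- (k + l)) t))"
      unfolding expand
      by (subst set_integral_sum, (intro set_integrable_sum int; simp), intro sum.cong refl,
          subst set_integral_sum, rule int, intro sum.cong refl set_integral_mult_right)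
    also have "\<dots> = 0"
    proof (intro sum.neutral ballI)
      fix k l assume "k \<in> ?J" "l \<in> ?J"
      show "complex_of_real (fejer_coeff m k * fejer_coeff m l) * ek (k + l) x * (LINT t:?I|lborel. h t * ek (- (k + l)) t) = 0"
      proof (cases "\<bar>k\<bar> < int m \<and> \<bar>l\<bar> < int m")
        case True
        then have "\<bar>k + l\<bar> \<le> int n" using m(2) by linarith
        from gap[OF this] show ?thesis by (simp only: integral_mult_ek[OF h]) (simp add: add.commute)
      next
        case False
        then have "real m \<le> \<bar>real_of_int k\<bar> \<or> real m \<le> \<bar>real_of_int l\<bar>" by linarith
        then have "fejer_coeff m k = 0 \<or> fejer_coeff m l = 0" by (auto simp: fejer_coeff_def)
        then show ?thesis by auto
      qed
    qed
    finally show ?thesis .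
  qed
  have pint: "set_integrable lborel ?I (\<lambda>t. P (t + c))" for c
    unfolding set_integrable_def
    by (intro borel_integrable_compact compact_Icc continuous_intros continuous_on_compose2[OF P(1)]) auto
  have cint: "set_integrable lborel ?I (\<lambda>t. c * complex_of_real (P (x - t)))" for x c
    unfolding set_integrable_def
    by (intro borel_integrable_compact compact_Icc continuous_intros continuous_on_compose2[OF P(1)]) auto
  have hint: "set_integrable lborel ?I (\<lambda>t. h t * complex_of_real (P (x - t)))" for x
  proof -
    have "P y \<le> (real m ^ 2)^2" for y
      unfolding P_def fejer_def by (intro power_mono norm_dirichlet_le) auto
    then have "periodic_L1 (\<lambda>t. h t * complex_of_real (P (x - t)))"
      using P(2)[of "x - _ - 2*pi"] P(4)
      by (intro periodic_L1_mult_bounded[OF h, where B = "(real m ^ 2)^2"] continuous_intros continuous_on_compose2[OF P(1)])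
         (auto simp: algebra_simps)
    then show ?thesis by (rule periodic_L1_integrable)
  qed
  have pointwise: "ennreal p * ennreal (norm (h x)) \<le> (\<integral>\<^sup>+s\<in>?I. ennreal (norm (h (x + s) - h x)) * ennreal (P s) \<partial>lborel)" for x
  proof -
    have "(LINT t:?I|lborel. complex_of_real (P (x - t))) = complex_of_real (LINT t:?I|lborel. P (x - t))"
      by (rule set_integral_complex_of_real)
    also have "(LINT t:?I|lborel. P (x - t)) = (LINT t:?I|lborel. P (t + - x))"
      using P(3)[of "x - _"] by (intro set_lebesgue_integral_cong) (auto simp: algebra_simps)
    also have "\<dots> = p" unfolding p_def
      using pint[of 0] pint[of "- x"] by (intro set_integral_periodic_shift_real P(2)) auto
    finally have "(LINT t:?I|lborel. h x * complex_of_real (P (x - t))) = h x * complex_of_real p" by simp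
    then have "h x * complex_of_real p = (LINT t:?I|lborel. h x * complex_of_real (P (x - t)) - h t * complex_of_real (P (x - t)))"
      using set_integral_diff(2)[OF cint[of "h x" x] hint[of x]] orth[of x] by (simp del: set_integral_mult_right)
    then have "ennreal (norm (h x * complex_of_real p)) \<le> (\<integral>\<^sup>+t\<in>?I. ennreal (norm (h x * complex_of_real (P (x - t)) - h t * complex_of_real (P (x - t)))) \<partial>lborel)"
      using norm_set_integral_le_nn by metis
    also have "\<dots> = (\<integral>\<^sup>+t\<in>?I. ennreal (norm (h t - h x)) * ennreal (P (t - x)) \<partial>lborel)"
    proof (intro nn_integral_cong arg_cong2[where f="(*)"] refl)
      fix t :: real
      have "norm (h x * complex_of_real (P (x - t)) - h t * complex_of_real (P (x - t))) = norm (h t - h x) * P (x - t)"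
        unfolding left_diff_distrib[symmetric] norm_mult using P(4)[of "x - t"] by (simp add: norm_minus_commute)
      moreover have "P (t - x) = P (x - t)" using P(3)[of "x - t"] by simp
      ultimately show "ennreal (norm (h x * complex_of_real (P (x - t)) - h t * complex_of_real (P (x - t)))) = ennreal (norm (h t - h x)) * ennreal (P (t - x))"
        by (simp add: ennreal_mult P(4))
    qed
    also have "\<dots> = (\<integral>\<^sup>+s\<in>?I. ennreal (norm (h (s + x) - h x)) * ennreal (P (s + x - x)) \<partial>lborel)"
    proof (rule nn_integral_periodic_shift[symmetric])
      show "ennreal (norm (h (t + 2*pi) - h x)) * ennreal (P (t + 2*pi - x)) = ennreal (norm (h t - h x)) * ennreal (P (t - x))" for t
        using P(2)[of "t - x"] periodic_L1_periodic[OF h, of t] by (simp add: algebra_simps)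
    qed measurable
    finally show ?thesis using p_pos by (simp add: norm_mult ennreal_mult mult.commute add.commute)
  qed
  have "ennreal (p * L1_norm h) = (\<integral>\<^sup>+x\<in>?I. ennreal p * ennreal (norm (h x)) \<partial>lborel)"
    using p_pos by (simp add: ennreal_mult L1_norm_nonneg ennreal_L1_norm[OF h] nn_integral_cmult mult.assoc)
  also have "\<dots> \<le> (\<integral>\<^sup>+x\<in>?I. (\<integral>\<^sup>+s\<in>?I. ennreal (norm (h (x + s) - h x)) * ennreal (P s) \<partial>lborel) \<partial>lborel)"
    by (intro nn_integral_mono mult_right_mono pointwise) auto
  also have "\<dots> = (\<integral>\<^sup>+x. (\<integral>\<^sup>+s. ennreal (norm (h (x + s) - h x)) * indicator ?I x * (ennreal (P s) * indicator ?I s) \<partial>lborel) \<partial>lborel)"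
    by (subst nn_integral_multc[symmetric]) (auto intro!: nn_integral_cong simp: ac_simps)
  also have "\<dots> = (\<integral>\<^sup>+s. (\<integral>\<^sup>+x. ennreal (norm (h (x + s) - h x)) * indicator ?I x * (ennreal (P s) * indicator ?I s) \<partial>lborel) \<partial>lborel)"
    by (rule lborel_pair.Fubini') measurable
  also have "\<dots> = (\<integral>\<^sup>+s. ennreal (L1_increment h s) * (ennreal (P s) * indicator ?I s) \<partial>lborel)"
    by (intro nn_integral_cong) (simp add: nn_integral_multc L1_increment_def ennreal_L1_norm[OF periodic_L1_increment[OF h]])
  also have "\<dots> \<le> (\<integral>\<^sup>+s. ennreal \<omega> * (2 * (ennreal (P s) * indicator ?I s) + ennreal (16 * real m ^ 2) * (ennreal (fejer m s) * indicator ?I s)) \<partial>lborel)"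
  proof (intro nn_integral_mono)
    fix s :: real
    show "ennreal (L1_increment h s) * (ennreal (P s) * indicator ?I s) \<le>
      ennreal \<omega> * (2 * (ennreal (P s) * indicator ?I s) + ennreal (16 * real m ^ 2) * (ennreal (fejer m s) * indicator ?I s))"
    proof (cases "s \<in> ?I")
      case True
      then have s: "\<bar>s\<bar> \<le> pi" by auto
      \<comment> \<open>The linear weight is replaced by a quadratic one, since \<open>s^2 F \<le> 16\<close> turns \<open>s^2 P\<close> into a multiple
        of the Fejer kernel, whose integral is known.\<close>
      have "\<bar>s\<bar> / \<delta> = \<bar>s\<bar> * (1 / \<delta>)" by simp
      also have "\<dots> \<le> \<bar>s\<bar> * (2 * real m)" using d(2) by (intro mult_left_mono) auto
      also have "\<dots> \<le> 1 + (real m)\<^sup>2 * s\<^sup>2"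
      proof -
        have "0 \<le> (real m * \<bar>s\<bar> - 1)\<^sup>2" by simp
        then show ?thesis by (simp add: power2_eq_square algebra_simps)
      qed
      finally have "1 + \<bar>s\<bar> / \<delta> \<le> 2 + (real m)\<^sup>2 * s\<^sup>2" by simp
      then have "L1_increment h s \<le> (2 + (real m)\<^sup>2 * s\<^sup>2) * \<omega>"
        using L1_increment_scale[OF h d(1), of s] \<omega> unfolding \<omega>_def[symmetric]
        by (meson mult_right_mono order_trans)
      then have "L1_increment h s * P s \<le> (2 + (real m)\<^sup>2 * s\<^sup>2) * \<omega> * P s"
        by (rule mult_right_mono) (rule P(4))
      also have "\<dots> = \<omega> * (2 * P s + (real m)\<^sup>2 * (s\<^sup>2 * fejer m s) * fejer m s)"
        by (simp add: P_def power2_eq_square algebra_simps)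
      also have "\<dots> \<le> \<omega> * (2 * P s + (real m)\<^sup>2 * 16 * fejer m s)"
        using fejer_mult_square_le[OF s, of m] \<omega>
        by (intro mult_left_mono add_left_mono mult_right_mono) auto
      finally have "ennreal (L1_increment h s * P s) \<le> ennreal (\<omega> * (2 * P s + (real m)\<^sup>2 * 16 * fejer m s))"
        by (rule ennreal_leI)
      also have "\<dots> = ennreal \<omega> * (2 * ennreal (P s) + ennreal (16 * real m ^ 2) * ennreal (fejer m s))"
        using \<omega> P(4)[of s] by (simp add: ennreal_mult ennreal_plus mult.commute)
      finally show ?thesis using True by (simp add: ennreal_mult[symmetric] L1_increment_nonneg P(4))
    qed simp
  qed
  also have "\<dots> = ennreal \<omega> * (2 * ennreal p + ennreal (16 * real m ^ 2) * ennreal (2 * pi * real m))"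
    by (simp add: nn_integral_cmult nn_integral_add p_nn nn_integral_fejer)
  also have "\<dots> = ennreal (\<omega> * (2 * p + 16 * real m ^ 2 * (2 * pi * real m)))"
  proof -
    have "2 * ennreal p = ennreal (2 * p)" using p_pos by (simp add: ennreal_mult)
    moreover have "0 \<le> 2 * p" "0 \<le> 16 * real m ^ 2" "0 \<le> 2 * pi * real m" using p_pos by auto
    ultimately show ?thesis using \<omega>
      by (simp only: ennreal_mult[symmetric] ennreal_plus[symmetric] mult_nonneg_nonneg add_nonneg_nonneg)
  qed
  finally have "p * L1_norm h \<le> \<omega> * (2 * p + 16 * real m ^ 2 * (2 * pi * real m))"
    using \<omega> p_pos by (subst (asm) ennreal_le_iff) (auto intro!: mult_nonneg_nonneg add_nonneg_nonneg)
  also have "\<dots> \<le> \<omega> * (1026 * p)"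
  proof (intro mult_left_mono \<omega>)
    have "16 * real m ^ 2 * (2 * pi * real m) = 32 * pi * real m ^ 3" by (simp add: power2_eq_square power3_eq_cube)
    also have "\<dots> \<le> 32 * 4 * real m ^ 3" using pi_less_4 by (intro mult_right_mono) auto
    also have "\<dots> \<le> 1024 * p" using p_lower by simp
    finally show "2 * p + 16 * real m ^ 2 * (2 * pi * real m) \<le> 1026 * p" by simp
  qed
  also have "\<dots> = p * (1026 * \<omega>)" by simp
  finally show ?thesis using p_pos unfolding \<omega>_def \<delta>_def by simp
qed

section \<open>De la Vallee Poussin means\<close>

text \<open>
  The trapezoid that is 1 on \<open>[-n, n]\<close> and decreases linearly to 0 at \<open>\<plusminus> 2 n\<close>, written as a difference
  of two triangles so that its kernel is a difference of Fejer kernels.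
\<close>

definition vdp_coeff :: "nat \<Rightarrow> int \<Rightarrow> real" where
  "vdp_coeff n k = (fejer_coeff (2 * n) k - fejer_coeff n k) / real n"

definition vdp :: "nat \<Rightarrow> (real \<Rightarrow> complex) \<Rightarrow> real \<Rightarrow> complex" where
  "vdp n f x = (\<Sum>k\<in>{-int (2*n)..int (2*n)}. (complex_of_real (vdp_coeff n k) * fourier_coeff f k) * ek k x)"

lemma periodic_L1_vdp: "periodic_L1 (vdp n f)"
  unfolding vdp_def[abs_def] by (rule periodic_L1_trig)

lemma vdp_coeff_eq:
  assumes "n \<ge> 1"
  shows "\<bar>k\<bar> \<le> int n \<Longrightarrow> vdp_coeff n k = 1"
    and "int n \<le> \<bar>k\<bar> \<Longrightarrow> \<bar>k\<bar> \<le> 2 * int n \<Longrightarrow> vdp_coeff n k = (2 * real n - \<bar>real_of_int k\<bar>) / real n"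
proof -
  show "vdp_coeff n k = 1" if "\<bar>k\<bar> \<le> int n"
  proof -
    have "\<bar>real_of_int k\<bar> \<le> real n" using that by linarith
    then show ?thesis using assms by (simp add: vdp_coeff_def fejer_coeff_def)
  qed
  show "vdp_coeff n k = (2 * real n - \<bar>real_of_int k\<bar>) / real n" if "int n \<le> \<bar>k\<bar>" "\<bar>k\<bar> \<le> 2 * int n"
  proof -
    have "real n \<le> \<bar>real_of_int k\<bar>" "\<bar>real_of_int k\<bar> \<le> 2 * real n" using that by linarith+
    then show ?thesis using assms by (simp add: vdp_coeff_def fejer_coeff_def)
  qed
qed

text \<open>
  The kernel is \<open>(F (2 n) - F n) / n\<close> with nonnegative \<open>F N\<close> of integral \<open>2 pi N\<close>; the triangle
  inequality gives the constant \<open>(2 n + n) / n\<close>.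
\<close>

lemma L1_norm_vdp_le:
  assumes n: "n \<ge> 1" and f: "periodic_L1 f"
  shows "L1_norm (vdp n f) \<le> 3 * L1_norm f"
proof (rule L1_norm_convolution_le[OF f])
  let ?I = "{-pi..pi}" and ?J = "{-int (2*n)..int (2*n)}"
  define K where "K t = complex_of_real ((fejer (2*n) t - fejer n t) / (2 * pi * real n))" for t
  show "continuous_on UNIV K" unfolding K_def by (intro continuous_intros) (use n in auto)
  show "K (x + 2*pi) = K x" for x by (simp add: K_def)
  show "periodic_L1 (vdp n f)" by (rule periodic_L1_vdp)
  have K_eq: "K t = (\<Sum>k\<in>?J. complex_of_real (vdp_coeff n k / (2*pi)) * ek k t)" for t
  proof -
    have "K t = (complex_of_real (fejer (2*n) t) - complex_of_real (fejer n t)) / complex_of_real (2 * pi * real n)"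
      by (simp add: K_def)
    also have "\<dots> = (\<Sum>k\<in>?J. (complex_of_real (fejer_coeff (2*n) k) * ek k t - complex_of_real (fejer_coeff n k) * ek k t) / complex_of_real (2 * pi * real n))"
      by (subst (1 2) fejer_expansion[of _ "2*n"]) (simp_all only: sum_subtractf[symmetric] sum_divide_distrib)
    also have "\<dots> = (\<Sum>k\<in>?J. complex_of_real (vdp_coeff n k / (2*pi)) * ek k t)"
      by (intro sum.cong refl) (simp add: vdp_coeff_def diff_divide_distrib algebra_simps)
    finally show ?thesis .
  qed
  show "vdp n f x = (LINT t:?I|lborel. f t * K (x - t))" for x
  proof -
    have "f t * K (x - t) = (\<Sum>k\<in>?J. (complex_of_real (vdp_coeff n k / (2*pi)) * ek k x) * (f t * ek (-k) t))" for t
      unfolding K_eq sum_distrib_left ek_arg_diff by (intro sum.cong refl) (simp add: mult_ac)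
    then have "(LINT t:?I|lborel. f t * K (x - t)) =
       (LINT t:?I|lborel. (\<Sum>k\<in>?J. (complex_of_real (vdp_coeff n k / (2*pi)) * ek k x) * (f t * ek (-k) t)))" by simp
    also have "\<dots> = (\<Sum>k\<in>?J. (complex_of_real (vdp_coeff n k / (2*pi)) * ek k x) * (LINT t:?I|lborel. f t * ek (-k) t))"
      by (subst set_integral_sum, intro set_integrable_mult_right periodic_L1_integrable periodic_L1_ek_mult f,
          intro sum.cong refl set_integral_mult_right)
    also have "\<dots> = vdp n f x"
      unfolding vdp_def integral_mult_ek[OF f] by (intro sum.cong refl) simp
    finally show ?thesis by simp
  qed
  have "(\<integral>\<^sup>+x\<in>?I. ennreal (norm (K x)) \<partial>lborel) \<le>
      (\<integral>\<^sup>+x. ennreal (1 / (2 * pi * real n)) * (ennreal (fejer (2*n) x) * indicator ?I x + ennreal (fejer n x) * indicator ?I x) \<partial>lborel)"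
  proof (intro nn_integral_mono)
    fix x :: real
    have "norm (K x) \<le> (1 / (2 * pi * real n)) * (fejer (2*n) x + fejer n x)"
    proof -
      have "norm (K x) = \<bar>fejer (2*n) x - fejer n x\<bar> / (2 * pi * real n)"
        unfolding K_def norm_of_real using n by (simp add: abs_mult)
      also have "\<dots> \<le> (fejer (2*n) x + fejer n x) / (2 * pi * real n)"
        using n fejer_nonneg[of "2*n" x] fejer_nonneg[of n x] by (intro divide_right_mono) (auto simp: abs_le_iff)
      finally show ?thesis by simp
    qed
    then have "ennreal (norm (K x)) \<le> ennreal (1 / (2 * pi * real n)) * (ennreal (fejer (2*n) x) + ennreal (fejer n x))"
      by (subst ennreal_plus[symmetric], simp, simp, subst ennreal_mult[symmetric]) (auto intro!: ennreal_leI)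
    then show "ennreal (norm (K x)) * indicator ?I x \<le>
      ennreal (1 / (2 * pi * real n)) * (ennreal (fejer (2*n) x) * indicator ?I x + ennreal (fejer n x) * indicator ?I x)"
      by (auto simp: indicator_def)
  qed
  also have "\<dots> = ennreal (1 / (2 * pi * real n)) * (ennreal (2 * pi * real (2*n)) + ennreal (2 * pi * real n))"
    by (subst nn_integral_cmult, measurable, subst nn_integral_add, measurable) (simp only: nn_integral_fejer)
  also have "\<dots> = ennreal ((1 / (2 * pi * real n)) * (2 * pi * real (2*n) + 2 * pi * real n))"
    by (simp only: ennreal_mult[symmetric] ennreal_plus[symmetric] mult_nonneg_nonneg add_nonneg_nonneg
        pi_ge_zero of_nat_0_le_iff zero_le_numeral divide_nonneg_nonneg zero_le_one)
  also have "(1 / (2 * pi * real n)) * (2 * pi * real (2*n) + 2 * pi * real n) = 3" using n by (simp add: field_simps)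
  finally show "(\<integral>\<^sup>+x\<in>?I. ennreal (norm (K x)) \<partial>lborel) \<le> ennreal 3" .
qed simp

definition vdp_rest :: "nat \<Rightarrow> (real \<Rightarrow> complex) \<Rightarrow> real \<Rightarrow> complex" where
  "vdp_rest n f x = f x - vdp n f x"

lemma periodic_L1_vdp_rest: "periodic_L1 f \<Longrightarrow> periodic_L1 (vdp_rest n f)"
  unfolding vdp_rest_def[abs_def] by (intro periodic_L1_diff periodic_L1_vdp)

lemma fourier_coeff_vdp_rest:
  assumes "n \<ge> 1" "periodic_L1 f" "\<bar>k\<bar> \<le> int n"
  shows "fourier_coeff (vdp_rest n f) k = 0"
proof -
  have "fourier_coeff (vdp n f) k = fourier_coeff f k"
    unfolding vdp_def[abs_def] using assms vdp_coeff_eq(1)[OF assms(1,3)] by (subst fourier_coeff_trig) auto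
  then show ?thesis
    unfolding vdp_rest_def[abs_def] using assms by (simp add: fourier_coeff_diff periodic_L1_vdp)
qed

text \<open>
  The means commute with translations, so the increments of the remainder are the remainders of the
  increments.
\<close>

lemma modulus_L_vdp_rest_le:
  assumes n: "n \<ge> 1" and f: "periodic_L1 f" and "0 \<le> t"
  shows "modulus_L (vdp_rest n f) t \<le> 4 * modulus_L f t"
proof (rule modulus_L_least[OF \<open>0 \<le> t\<close>])
  fix h assume h: "0 \<le> h" "h \<le> t"
  define g where "g = (\<lambda>x. f (x + h) - f x)"
  have g: "periodic_L1 g" unfolding g_def by (rule periodic_L1_increment[OF f])
  have "vdp n g x = vdp n f (x + h) - vdp n f x" for x
  proof -
    have c: "fourier_coeff g k = (ek k h - 1) * fourier_coeff f k" for k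
      unfolding g_def by (simp add: fourier_coeff_diff fourier_coeff_shift periodic_L1_shift f left_diff_distrib)
    show ?thesis unfolding vdp_def sum_subtractf[symmetric]
      by (intro sum.cong refl) (simp only: c ek_arg_add, simp add: algebra_simps)
  qed
  then have "vdp_rest n f (x + h) - vdp_rest n f x = g x - vdp n g x" for x
    by (simp add: vdp_rest_def g_def)
  then have "L1_increment (vdp_rest n f) h = L1_norm (\<lambda>x. g x - vdp n g x)" by (simp add: L1_increment_def)
  also have "\<dots> \<le> L1_norm g + L1_norm (vdp n g)" by (intro L1_norm_triangle_diff g periodic_L1_vdp)
  also have "\<dots> \<le> 4 * L1_norm g" using L1_norm_vdp_le[OF n g] by simp
  also have "L1_norm g = L1_increment f h" by (simp add: g_def L1_increment_def)
  also have "4 * \<dots> \<le> 4 * modulus_L f t" using L1_increment_le_modulus[OF f h] by simp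
  finally show "L1_increment (vdp_rest n f) h \<le> 4 * modulus_L f t" .
qed

section \<open>Primitives and the Jackson inequality\<close>

text \<open>
  Stated through increments, the relation is invariant under translation and does not require \<open>F\<close> to be
  differentiable everywhere. Steps of length at most 1 are all that the modulus needs, and \<open>[0, h]\<close> then
  stays inside one period.
\<close>

definition primitive :: "(real \<Rightarrow> complex) \<Rightarrow> (real \<Rightarrow> complex) \<Rightarrow> bool" where
  "primitive F G \<longleftrightarrow> (\<forall>x h. 0 \<le> h \<and> h \<le> 1 \<longrightarrow> (G has_integral (F (x + h) - F x)) {x..x+h})"

lemma primitive_set_integral:
  assumes "primitive F G" and G: "periodic_L1 G" and h: "0 \<le> h" "h \<le> 1"
  shows "F (x + h) - F x = (LINT s:{0..h}|lborel. G (x + s))"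
    and "set_integrable lborel {0..h} (\<lambda>s. G (x + s))"
proof -
  have "set_integrable lborel {-pi..pi} (\<lambda>s. G (s + x))"
    by (rule periodic_L1_integrable[OF periodic_L1_shift[OF G]])
  then show si: "set_integrable lborel {0..h} (\<lambda>s. G (x + s))"
    unfolding add.commute[of x] by (rule set_integrable_subset) (use h pi_gt3 in auto)
  have "(G has_integral (F (x + h) - F x)) {x..x+h}"
    using assms(1) h by (simp add: primitive_def)
  from has_integral_shift_real_ivl[OF this, of x]
  have "((\<lambda>s. G (x + s)) has_integral (F (x + h) - F x)) {0..h}" by (simp add: add.commute)
  then show "F (x + h) - F x = (LINT s:{0..h}|lborel. G (x + s))"
    using set_borel_integral_eq_integral(2)[OF si] by (simp add: integral_unique)
qed

text \<open>
  Minkowski's inequality for \<open>F (x + h) - F x = \<integral> G (x + s) ds\<close>, the integral being over \<open>[0, h]\<close>.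
\<close>

lemma L1_increment_primitive_le:
  assumes "primitive F G" and F: "periodic_L1 F" and G: "periodic_L1 G" and h: "0 \<le> h" "h \<le> 1"
  shows "L1_increment F h \<le> h * L1_norm G"
proof -
  let ?I = "{-pi..pi}"
  have [measurable]: "F \<in> borel_measurable borel" "G \<in> borel_measurable borel" using F G by measurable
  have "(\<integral>\<^sup>+x\<in>?I. ennreal (norm (F (x + h) - F x)) \<partial>lborel)
      \<le> (\<integral>\<^sup>+x\<in>?I. (\<integral>\<^sup>+s\<in>{0..h}. ennreal (norm (G (x + s))) \<partial>lborel) \<partial>lborel)"
    unfolding primitive_set_integral(1)[OF assms(1) G h]
    by (intro nn_integral_mono mult_right_mono norm_set_integral_le_nn) auto
  also have "\<dots> = (\<integral>\<^sup>+x. (\<integral>\<^sup>+s. ennreal (norm (G (x + s))) * indicator {0..h} s * indicator ?I x \<partial>lborel) \<partial>lborel)"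
    by (subst nn_integral_multc[symmetric]) auto
  also have "\<dots> = (\<integral>\<^sup>+s. (\<integral>\<^sup>+x. ennreal (norm (G (x + s))) * indicator {0..h} s * indicator ?I x \<partial>lborel) \<partial>lborel)"
    by (rule lborel_pair.Fubini') measurable
  also have "\<dots> = (\<integral>\<^sup>+s. ennreal (L1_norm G) * indicator {0..h} s \<partial>lborel)"
  proof (intro nn_integral_cong)
    fix s :: real
    have "(\<integral>\<^sup>+x. ennreal (norm (G (x + s))) * indicator {0..h} s * indicator ?I x \<partial>lborel)
       = (\<integral>\<^sup>+x. indicator {0..h} s * (ennreal (norm (G (x + s))) * indicator ?I x) \<partial>lborel)"
      by (simp add: mult_ac)
    also have "\<dots> = indicator {0..h} s * (\<integral>\<^sup>+x\<in>?I. ennreal (norm (G (x + s))) \<partial>lborel)"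
      by (rule nn_integral_cmult) measurable
    also have "(\<integral>\<^sup>+x\<in>?I. ennreal (norm (G (x + s))) \<partial>lborel) = ennreal (L1_norm G)"
      unfolding ennreal_L1_norm[OF G] by (rule nn_integral_periodic_shift) (auto simp: periodic_L1_periodic[OF G])
    finally show "(\<integral>\<^sup>+x. ennreal (norm (G (x + s))) * indicator {0..h} s * indicator ?I x \<partial>lborel) = ennreal (L1_norm G) * indicator {0..h} s"
      by (simp add: mult.commute)
  qed
  also have "\<dots> = ennreal (h * L1_norm G)"
    using h by (simp add: nn_integral_cmult_indicator ennreal_mult[symmetric] L1_norm_nonneg mult.commute)
  finally show ?thesis unfolding L1_increment_def using h
    by (subst L1_norm_le_iff_nn) (auto simp: periodic_L1_increment[OF F] L1_norm_nonneg)
qed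

lemma modulus_L_primitive_le:
  assumes "primitive F G" "periodic_L1 F" "periodic_L1 G" "0 \<le> t" "t \<le> 1"
  shows "modulus_L F t \<le> t * L1_norm G"
proof (rule modulus_L_least[OF \<open>0 \<le> t\<close>])
  fix h assume h: "0 \<le> h" "h \<le> t"
  have "L1_increment F h \<le> h * L1_norm G" using assms h by (intro L1_increment_primitive_le) auto
  also have "\<dots> \<le> t * L1_norm G" using h by (intro mult_right_mono L1_norm_nonneg)
  finally show "L1_increment F h \<le> t * L1_norm G" .
qed

text \<open>
  The formula for the coefficients of a derivative, without integration by parts: comparing the
  coefficients of both sides of \<open>F (x + h) - F x = \<integral> G (x + s) ds\<close> gives
  \<open>(e^(i k h) - 1) c_k(F) = (\<integral> e^(i k s) ds) c_k(G)\<close>, and a suitable \<open>h\<close> makes the first factor nonzero.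
\<close>

lemma fourier_coeff_primitive:
  assumes prim: "primitive F G" and F: "periodic_L1 F" and G: "periodic_L1 G"
  shows "fourier_coeff G k = \<i> * of_int k * fourier_coeff F k"
proof -
  let ?I = "{-pi..pi}"
  have [measurable]: "F \<in> borel_measurable borel" "G \<in> borel_measurable borel" using F G by measurable
  have main: "(ek k h - 1) * fourier_coeff F k = (LINT s:{0..h}|lborel. ek k s) * fourier_coeff G k"
    if h: "0 \<le> h" "h \<le> 1" for h
  proof -
    define u where "u x s = indicator ?I x *\<^sub>R (indicator {0..h} s *\<^sub>R (G (x + s) * ek (-k) x))" for x s :: real
    have u_meas: "case_prod u \<in> borel_measurable (lborel \<Otimes>\<^sub>M lborel)" unfolding u_def by measurable
    have "integrable (lborel \<Otimes>\<^sub>M lborel) (case_prod u)"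
    proof (rule integrableI_bounded[OF u_meas])
      have "(\<integral>\<^sup>+z. ennreal (norm (case_prod u z)) \<partial>(lborel \<Otimes>\<^sub>M lborel)) = (\<integral>\<^sup>+s. (\<integral>\<^sup>+x. ennreal (norm (u x s)) \<partial>lborel) \<partial>lborel)"
        using u_meas by (subst lborel_pair.nn_integral_snd[symmetric]) auto
      also have "\<dots> = (\<integral>\<^sup>+s. ennreal (L1_norm G) * indicator {0..h} s \<partial>lborel)"
      proof (intro nn_integral_cong)
        fix s :: real
        have "(\<integral>\<^sup>+x. ennreal (norm (u x s)) \<partial>lborel) = (\<integral>\<^sup>+x. indicator {0..h} s * (ennreal (norm (G (x + s))) * indicator ?I x) \<partial>lborel)"
          by (intro nn_integral_cong) (auto simp: u_def indicator_def norm_mult)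
        also have "\<dots> = indicator {0..h} s * (\<integral>\<^sup>+x\<in>?I. ennreal (norm (G (x + s))) \<partial>lborel)"
          by (rule nn_integral_cmult) measurable
        also have "(\<integral>\<^sup>+x\<in>?I. ennreal (norm (G (x + s))) \<partial>lborel) = ennreal (L1_norm G)"
          unfolding ennreal_L1_norm[OF G] by (rule nn_integral_periodic_shift) (auto simp: periodic_L1_periodic[OF G])
        finally show "(\<integral>\<^sup>+x. ennreal (norm (u x s)) \<partial>lborel) = ennreal (L1_norm G) * indicator {0..h} s"
          by (simp add: mult.commute)
      qed
      also have "\<dots> < \<infinity>" using h by (simp add: nn_integral_cmult_indicator ennreal_mult_less_top)
      finally show "(\<integral>\<^sup>+z. ennreal (norm (case_prod u z)) \<partial>(lborel \<Otimes>\<^sub>M lborel)) < \<infinity>" .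
    qed
    from lborel_pair.Fubini_integral[OF this]
    have swap: "(\<integral>s. (\<integral>x. u x s \<partial>lborel) \<partial>lborel) = (\<integral>x. (\<integral>s. u x s \<partial>lborel) \<partial>lborel)" .
    have "(\<integral>s. u x s \<partial>lborel) = indicator ?I x *\<^sub>R ((F (x + h) - F x) * ek (-k) x)" for x
    proof -
      have "(\<integral>s. u x s \<partial>lborel) = indicator ?I x *\<^sub>R (LINT s:{0..h}|lborel. G (x + s) * ek (-k) x)"
        unfolding u_def set_lebesgue_integral_def by (rule integral_scaleR_right)
      also have "(LINT s:{0..h}|lborel. G (x + s) * ek (-k) x) = (LINT s:{0..h}|lborel. G (x + s)) * ek (-k) x"
        by (rule set_integral_mult_left)
      finally show ?thesis by (simp add: primitive_set_integral(1)[OF prim G h])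
    qed
    then have "(\<integral>x. (\<integral>s. u x s \<partial>lborel) \<partial>lborel) = (LINT x:?I|lborel. (F (x + h) - F x) * ek (-k) x)"
      by (simp add: set_lebesgue_integral_def)
    also have "\<dots> = complex_of_real (2*pi) * fourier_coeff (\<lambda>x. F (x + h) - F x) k"
      using integral_mult_ek[OF periodic_L1_increment[OF F], of h "-k"] by simp
    also have "\<dots> = complex_of_real (2*pi) * ((ek k h - 1) * fourier_coeff F k)"
      by (simp add: fourier_coeff_diff fourier_coeff_shift periodic_L1_shift F left_diff_distrib)
    finally have 1: "(\<integral>x. (\<integral>s. u x s \<partial>lborel) \<partial>lborel) = complex_of_real (2*pi) * ((ek k h - 1) * fourier_coeff F k)" .
    have "(\<integral>x. u x s \<partial>lborel) = indicator {0..h} s *\<^sub>R (ek k s * (complex_of_real (2*pi) * fourier_coeff G k))" for s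
    proof -
      have "(\<integral>x. u x s \<partial>lborel) = (\<integral>x. indicator {0..h} s *\<^sub>R (indicator ?I x *\<^sub>R (G (x + s) * ek (-k) x)) \<partial>lborel)"
        unfolding u_def by (intro Bochner_Integration.integral_cong refl) (simp add: mult.commute)
      also have "\<dots> = indicator {0..h} s *\<^sub>R (LINT x:?I|lborel. G (x + s) * ek (-k) x)"
        unfolding set_lebesgue_integral_def by (rule integral_scaleR_right)
      also have "(LINT x:?I|lborel. G (x + s) * ek (-k) x) = complex_of_real (2*pi) * fourier_coeff (\<lambda>x. G (x + s)) k"
        using integral_mult_ek[OF periodic_L1_shift[OF G], of s "-k"] by simp
      finally show ?thesis by (simp add: fourier_coeff_shift[OF G] mult_ac)
    qed
    then have "(\<integral>s. (\<integral>x. u x s \<partial>lborel) \<partial>lborel) = (LINT s:{0..h}|lborel. ek k s * (complex_of_real (2*pi) * fourier_coeff G k))"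
      by (simp only: set_lebesgue_integral_def)
    also have "\<dots> = (LINT s:{0..h}|lborel. ek k s) * (complex_of_real (2*pi) * fourier_coeff G k)"
      by (rule set_integral_mult_left)
    finally have "complex_of_real (2*pi) * ((ek k h - 1) * fourier_coeff F k) =
        complex_of_real (2*pi) * ((LINT s:{0..h}|lborel. ek k s) * fourier_coeff G k)"
      using 1 swap by (simp only: mult_ac)
    then show ?thesis by (subst (asm) mult_cancel_left) simp
  qed
  show ?thesis
  proof (cases "k = 0")
    case True
    then show ?thesis using main[of 1] by (simp add: set_lebesgue_integral_def)
  next
    case False
    \<comment> \<open>With this \<open>h\<close> the number \<open>e^(i k h)\<close> is \<open>e^i\<close> or its conjugate, which is not real.\<close>
    define h where "h = 1 / \<bar>real_of_int k\<bar>"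
    have h: "0 \<le> h" "h \<le> 1" using False by (auto simp: h_def divide_le_eq)
    have "real_of_int k * h = 1 \<or> real_of_int k * h = -1" using False by (auto simp: h_def abs_if)
    moreover have "sin (1::real) > 0" by (rule sin_gt_zero) (use pi_gt3 in auto)
    ultimately have "Im (ek k h) \<noteq> 0" by (auto simp: ek_def)
    then have ne: "ek k h - 1 \<noteq> 0" by (metis Im_complex_of_real eq_iff_diff_eq_0 of_real_1)
    have "(LINT s:{0..h}|lborel. ek k s) = integral {0..h} (ek k)"
      by (rule set_borel_integral_eq_integral(2)) (auto simp: set_integrable_def intro!: borel_integrable_compact continuous_intros)
    moreover have "((\<lambda>s. \<i> * of_int k * ek k s) has_integral (ek k h - ek k 0)) {0..h}"
      using h by (intro fundamental_theorem_of_calculus ek_has_vector_derivative) auto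
    then have "\<i> * of_int k * integral {0..h} (ek k) = ek k h - 1" using False by (simp add: integral_unique flip: integral_mult_right)
    ultimately have "(ek k h - 1) * (\<i> * of_int k * fourier_coeff F k) = (ek k h - 1) * fourier_coeff G k"
      using main[OF h] by (simp add: mult_ac)
    then show ?thesis using ne by simp
  qed
qed

lemma primitive_vdp_rest:
  assumes prim: "primitive F G" and F: "periodic_L1 F" and G: "periodic_L1 G"
  shows "primitive (vdp_rest n F) (vdp_rest n G)"
  unfolding primitive_def
proof (intro allI impI, elim conjE)
  fix x h :: real assume h: "0 \<le> h" "h \<le> 1"
  have deriv: "(vdp n F has_vector_derivative vdp n G y) (at y within {x..x+h})" for y
  proof -
    have "((\<lambda>y. (complex_of_real (vdp_coeff n k) * fourier_coeff F k) * ek k y) has_vector_derivative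
        (complex_of_real (vdp_coeff n k) * fourier_coeff G k) * ek k y) (at y within {x..x+h})" for k
      using has_vector_derivative_mult_right[OF ek_has_vector_derivative[of k y "{x..x+h}"], of "complex_of_real (vdp_coeff n k) * fourier_coeff F k"]
      unfolding fourier_coeff_primitive[OF prim F G] by (simp only: mult_ac)
    then show ?thesis unfolding vdp_def[abs_def] by (intro has_vector_derivative_sum)
  qed
  have "(vdp n G has_integral (vdp n F (x + h) - vdp n F x)) {x..x+h}"
    using h by (intro fundamental_theorem_of_calculus deriv) auto
  moreover have "(G has_integral (F (x + h) - F x)) {x..x+h}" using prim h by (simp add: primitive_def)
  ultimately have "((\<lambda>y. G y - vdp n G y) has_integral ((F (x + h) - F x) - (vdp n F (x + h) - vdp n F x))) {x..x+h}"
    by (rule has_integral_diff[rotated])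
  then show "(vdp_rest n G has_integral (vdp_rest n F (x + h) - vdp_rest n F x)) {x..x+h}"
    by (simp add: vdp_rest_def[abs_def] algebra_simps)
qed

text \<open>
  Jackson's inequality. Each remainder has a spectral gap, so its norm is bounded by its own modulus,
  hence by \<open>1/(n + 1)\<close> times the norm of the next remainder. The chain ends with the modulus of the
  last remainder, which is bounded by the modulus of \<open>F r\<close>.
\<close>

lemma vdp_rest_norm_le_modulus:
  assumes n: "n \<ge> 1" and F: "\<And>j. j \<le> r \<Longrightarrow> periodic_L1 (F j)" and prim: "\<And>j. j < r \<Longrightarrow> primitive (F j) (F (Suc j))"
  shows "L1_norm (vdp_rest n (F 0)) \<le> 4104 * 1026 ^ r * ((1 / (real n + 1)) ^ r * modulus_L (F r) (1 / (real n + 1)))"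
proof -
  define \<delta> where "\<delta> = 1 / (real n + 1)"
  have d: "0 \<le> \<delta>" "\<delta> \<le> 1" by (auto simp: \<delta>_def)
  have gap: "L1_norm (vdp_rest n (F j)) \<le> 1026 * modulus_L (vdp_rest n (F j)) \<delta>" if "j \<le> r" for j
    unfolding \<delta>_def using F[OF that] n
    by (intro spectral_gap_norm_le_modulus periodic_L1_vdp_rest fourier_coeff_vdp_rest)
  have "L1_norm (vdp_rest n (F (r - i))) \<le> (1026 * \<delta>) ^ i * (4104 * modulus_L (F r) \<delta>)" if "i \<le> r" for i
    using that
  proof (induction i)
    case 0
    show ?case using gap[of r] modulus_L_vdp_rest_le[OF n F[of r] d(1)] by simp
  next
    case (Suc i)
    define j where "j = r - Suc i"
    have j: "j < r" "Suc j = r - i" using Suc.prems by (auto simp: j_def)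
    have "L1_norm (vdp_rest n (F j)) \<le> 1026 * modulus_L (vdp_rest n (F j)) \<delta>" using j by (intro gap) auto
    also have "\<dots> \<le> 1026 * (\<delta> * L1_norm (vdp_rest n (F (Suc j))))"
      using j by (intro mult_left_mono modulus_L_primitive_le primitive_vdp_rest prim periodic_L1_vdp_rest F d) auto
    also have "\<dots> \<le> 1026 * (\<delta> * ((1026 * \<delta>) ^ i * (4104 * modulus_L (F r) \<delta>)))"
      using Suc d unfolding j(2) by (intro mult_left_mono) auto
    finally show ?case by (simp add: j_def mult_ac)
  qed
  from this[of r] have "L1_norm (vdp_rest n (F 0)) \<le> 1026 ^ r * \<delta> ^ r * (4104 * modulus_L (F r) \<delta>)"
    by (simp only: power_mult_distrib order_refl diff_self_eq_0)
  then show ?thesis unfolding \<delta>_def by (simp only: mult_ac)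
qed

section \<open>Periodic absolutely continuous functions\<close>

lemma periodic_int_multiple:
  assumes per: "\<And>x. u (x + 2*pi) = u x" shows "u (x + 2*pi * of_int k) = u x"
proof -
  have nat: "u (x + 2*pi * real n) = u x" for x n
  proof (induction n)
    case (Suc n)
    then show ?case using per[of "x + 2*pi * real n"] by (simp add: algebra_simps)
  qed simp
  show ?thesis
  proof (cases "0 \<le> k")
    case True
    then show ?thesis using nat[of x "nat k"] by simp
  next
    case False
    then show ?thesis using nat[of "x + 2*pi * of_int k" "nat (-k)"] by (simp add: algebra_simps)
  qed
qed

definition base_point :: "real \<Rightarrow> real" where
  "base_point x = x - 2*pi * of_int \<lfloor>(x + pi) / (2*pi)\<rfloor>"

lemma base_point_bounds: "-pi \<le> base_point x" "base_point x < pi"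
proof -
  have *: "of_int \<lfloor>(x + pi) / (2*pi)\<rfloor> \<le> (x + pi) / (2*pi)" "(x + pi) / (2*pi) < of_int \<lfloor>(x + pi) / (2*pi)\<rfloor> + 1" by linarith+
  from *(1) have "2*pi * of_int \<lfloor>(x + pi) / (2*pi)\<rfloor> \<le> x + pi"
    by (subst (asm) pos_le_divide_eq) (simp_all add: mult.commute)
  moreover from *(2) have "x + pi < 2*pi * (of_int \<lfloor>(x + pi) / (2*pi)\<rfloor> + 1)"
    by (subst (asm) pos_divide_less_eq) (simp_all add: mult.commute)
  ultimately show "-pi \<le> base_point x" "base_point x < pi"
    by (auto simp: base_point_def algebra_simps)
qed

lemma base_point_measurable [measurable]: "base_point \<in> borel_measurable borel"
  unfolding base_point_def[abs_def] by measurable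

lemma base_point_eq: "-pi \<le> x \<Longrightarrow> x < pi \<Longrightarrow> base_point x = x"
proof -
  assume "-pi \<le> x" "x < pi"
  then have "\<lfloor>(x + pi) / (2*pi)\<rfloor> = 0" by (intro floor_unique) auto
  then show ?thesis by (simp add: base_point_def)
qed

lemma base_point_periodic: "base_point (x + 2*pi) = base_point x"
proof -
  have "(x + 2*pi + pi) / (2*pi) = (x + pi) / (2*pi) + 1" by (simp add: field_simps)
  then have "\<lfloor>(x + 2*pi + pi) / (2*pi)\<rfloor> = \<lfloor>(x + pi) / (2*pi)\<rfloor> + 1" by simp
  then show ?thesis by (simp add: base_point_def algebra_simps)
qed

lemma periodic_base_point:
  assumes "\<And>x. u (x + 2*pi) = u x" shows "u (base_point x) = u x"
  using periodic_int_multiple[of u x "- \<lfloor>(x + pi) / (2*pi)\<rfloor>", OF assms] by (simp add: base_point_def)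

lemma has_vector_derivative_periodic:
  assumes per: "\<And>x. u (x + p) = u x"
  shows "(u has_vector_derivative D) (at (x + p)) \<longleftrightarrow> (u has_vector_derivative D) (at x)"
proof
  have id: "((\<lambda>y. y + c) has_vector_derivative 1) (at y)" for c y :: real
    by (auto intro!: derivative_eq_intros)
  have pern: "u (x - p) = u x" for x using per[of "x - p"] by simp
  show "(u has_vector_derivative D) (at x)" if "(u has_vector_derivative D) (at (x + p))"
    using vector_diff_chain_at[OF id[of p x] that] by (simp add: comp_def per)
  show "(u has_vector_derivative D) (at (x + p))" if "(u has_vector_derivative D) (at x)"
  proof -
    have "(u has_vector_derivative D) (at (x + p + - p))" using that by simp
    from vector_diff_chain_at[OF id this] show ?thesis by (simp add: comp_def pern)
  qed
qed

lemma nth_vderiv_0: "nth_vderiv 0 f = f" by (simp add: nth_vderiv_def)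

lemma nth_vderiv_Suc: "nth_vderiv (Suc k) f = (\<lambda>x. vector_derivative (nth_vderiv k f) (at x))"
  by (simp add: nth_vderiv_def)

lemma nth_vderiv_periodic:
  assumes per: "\<And>x. f (x + 2*pi) = f x" shows "nth_vderiv k f (x + 2*pi) = nth_vderiv k f x"
proof (induction k arbitrary: x)
  case 0 then show ?case by (simp add: nth_vderiv_0 per)
next
  case (Suc k)
  then show ?case
    unfolding nth_vderiv_Suc vector_derivative_def by (simp add: has_vector_derivative_periodic)
qed

lemma absolutely_continuous_on_imp_continuous:
  assumes ac: "absolutely_continuous_on {a..b} F" shows "continuous_on {a..b} F"
  unfolding continuous_on_iff
proof (intro ballI allI impI)
  fix x e :: real assume x: "x \<in> {a..b}" and "0 < e"
  obtain d where d: "d > 0"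
    "\<And>P. subintervals a b P \<Longrightarrow> (\<Sum>(p,q)\<in>P. q - p) < d \<Longrightarrow> (\<Sum>(p,q)\<in>P. norm (F q - F p)) < e"
    using absolutely_continuous_on_subintervals[OF ac \<open>0 < e\<close>] by blast
  have *: "norm (F q - F p) < e" if "a \<le> p" "p < q" "q \<le> b" "q - p < d" for p q
    using d(2)[OF subintervals_single[of a p q b]] that by simp
  show "\<exists>d>0. \<forall>x'\<in>{a..b}. dist x' x < d \<longrightarrow> dist (F x') (F x) < e"
  proof (intro exI[of _ d] conjI d(1) ballI impI)
    fix x' assume x': "x' \<in> {a..b}" "dist x' x < d"
    consider "x' = x" | "x' < x" | "x < x'" by linarith
    then show "dist (F x') (F x) < e"
    proof cases
      case 2
      then show ?thesis using *[of x' x] x x' by (simp add: dist_norm norm_minus_commute)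
    next
      case 3
      then show ?thesis using *[of x x'] x x' by (simp add: dist_norm)
    qed (use \<open>0 < e\<close> in simp)
  qed
qed

lemma periodic_continuous_on_UNIV:
  fixes F :: "real \<Rightarrow> complex"
  assumes cont: "continuous_on {-pi..pi} F" and per: "\<And>x. F (x + 2*pi) = F x"
  shows "continuous_on UNIV F"
proof -
  have "continuous_on {-pi - 2*pi..pi - 2*pi} (\<lambda>x. F (x + 2*pi))"
    by (rule continuous_on_compose2[OF cont]) (auto intro!: continuous_intros)
  then have "continuous_on {-pi - 2*pi..-pi} F" by (simp add: per)
  then have "continuous_on ({-pi - 2*pi..-pi} \<union> {-pi..pi}) F" using cont by (intro continuous_on_closed_Un) auto
  then have "continuous_on {-pi - 2*pi<..<pi} F" by (rule continuous_on_subset) auto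
  then have isC: "isCont F x" if "-pi - 2*pi < x" "x < pi" for x
    using that by (simp add: continuous_on_eq_continuous_at)
  have "isCont F x" for x
  proof -
    define c where "c = base_point x - x"
    obtain k :: int where k: "c = 2*pi * of_int k"
      by (rule that[of "- \<lfloor>(x + pi) / (2*pi)\<rfloor>"]) (simp add: c_def base_point_def)
    have "isCont F (x + c)" using base_point_bounds[of x] pi_gt_zero by (intro isC) (auto simp: c_def)
    then have "isCont (\<lambda>y. F (y + c)) x" by (rule isCont_o2[where f="\<lambda>y. y + c", rotated]) simp
    then show ?thesis unfolding k periodic_int_multiple[of F, OF per] .
  qed
  then show ?thesis by (simp add: continuous_on_eq_continuous_at)
qed

text \<open>
  The density found on one period is extended periodically. Increments over an interval that crosses
  the end of the period are put together from two pieces.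
\<close>

lemma periodic_absolutely_continuous_derivative:
  assumes ac: "absolutely_continuous_on {-pi..pi} F" and per: "\<And>x. F (x + 2*pi) = F x"
  obtains G N where "periodic_L1 F" "periodic_L1 G" "primitive F G" "negligible N"
    "\<And>x. x \<notin> N \<Longrightarrow> vector_derivative F (at x) = G x"
proof -
  obtain g where g: "g \<in> borel_measurable borel" "set_integrable lborel {-pi..pi} g"
    "\<And>x. x \<in> {-pi..pi} \<Longrightarrow> (LINT t:{-pi..x}|lborel. g t) = F x - F (-pi)"
    using absolutely_continuous_on_density[OF _ ac] by auto
  obtain N0 where N0: "negligible N0" "\<And>x. x \<in> {-pi<..<pi} - N0 \<Longrightarrow> (F has_vector_derivative g x) (at x)"
    using absolutely_continuous_ae_differentiable[OF _ g(2,3)] by auto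
  define G where "G x = g (base_point x)" for x
  have per_F: "periodic_L1 F"
    by (intro periodic_L1_continuous periodic_continuous_on_UNIV absolutely_continuous_on_imp_continuous ac per)
  have G_eq: "G x = g x" if "-pi \<le> x" "x < pi" for x using base_point_eq[OF that] by (simp add: G_def)
  have G_meas: "G \<in> borel_measurable borel" unfolding G_def[abs_def] using g(1) by measurable
  have G_per: "G (x + 2*pi) = G x" for x by (simp add: G_def base_point_periodic)
  have per_G: "periodic_L1 G"
  proof -
    have "set_integrable lborel {-pi..pi} G"
    proof -
      have "AE x in lborel. indicator {-pi..pi} x *\<^sub>R g x = indicator {-pi..pi} x *\<^sub>R G x"
        using AE_lborel_singleton[of pi] by eventually_elim (auto simp: indicator_def G_eq)
      then show ?thesis
        using g(2) g(1) G_meas unfolding set_integrable_def by (subst (asm) integrable_cong_AE) auto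
    qed
    then show ?thesis by (simp add: periodic_L1_def G_meas G_per)
  qed
  have cell: "(G has_integral (F y - F x)) {x..y}" if "-pi \<le> x" "x \<le> y" "y \<le> pi" for x y
  proof -
    have base: "(g has_integral (F z - F (-pi))) {-pi..z}" if "-pi \<le> z" "z \<le> pi" for z
    proof -
      have "set_integrable lborel {-pi..z} g" by (rule set_integrable_subset[OF g(2)]) (use that in auto)
      from set_borel_integral_eq_integral[OF this] show ?thesis
        using g(3)[of z] that by (simp add: has_integral_integrable_integral)
    qed
    have "g integrable_on {-pi..y}" using base[of y] that by (auto simp: has_integral_integrable_integral)
    then have "g integrable_on {x..y}" by (rule integrable_subinterval_real) (use that in auto)
    then obtain I where I: "(g has_integral I) {x..y}" by auto
    from has_integral_combine[OF that(1,2) base[of x] this] that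
    have "(g has_integral (F x - F (-pi) + I)) {-pi..y}" by auto
    from has_integral_unique[OF this base[of y]] that have "F x - F (-pi) + I = F y - F (-pi)" by simp
    then have "I = F y - F x" by (simp add: algebra_simps)
    with I have "(g has_integral (F y - F x)) {x..y}" by simp
    then show ?thesis
    proof (rule has_integral_spike_finite[of "{pi}", rotated 2])
      show "G t = g t" if "t \<in> {x..y} - {pi}" for t using that \<open>-pi \<le> x\<close> \<open>y \<le> pi\<close> by (intro G_eq) auto
    qed simp
  qed
  have "primitive F G"
    unfolding primitive_def
  proof (intro allI impI, elim conjE)
    fix x h :: real assume h: "0 \<le> h" "h \<le> 1"
    have near: "(G has_integral (F (z + h) - F z)) {z..z+h}" if z: "-pi \<le> z" "z < pi" for z
    proof (cases "z + h \<le> pi")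
      case False
      have "(G has_integral (F (z + h - 2*pi) - F (-pi))) {-pi..z + h - 2*pi}"
        using False z h pi_gt3 by (intro cell) auto
      from has_integral_shift_real_ivl[OF this, of "-2*pi"]
      have "((\<lambda>t. G (t - 2*pi)) has_integral (F (z + h - 2*pi) - F (-pi))) {pi..z + h}" by simp
      moreover have "G (t - 2*pi) = G t" for t using G_per[of "t - 2*pi"] by simp
      moreover have "F (z + h - 2*pi) = F (z + h)" "F (-pi) = F pi" using per[of "z + h - 2*pi"] per[of "-pi"] by auto
      ultimately have "(G has_integral (F (z + h) - F pi)) {pi..z + h}" by simp
      from has_integral_combine[OF _ _ cell[of z pi] this] z False
      show ?thesis by simp
    qed (use h z cell in auto)
    define k where "k = \<lfloor>(x + pi) / (2*pi)\<rfloor>"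
    have x: "base_point x = x - 2*pi * of_int k" by (simp add: base_point_def k_def)
    have "(G has_integral (F (base_point x + h) - F (base_point x))) {base_point x..base_point x + h}"
      by (intro near base_point_bounds)
    from has_integral_shift_real_ivl[OF this, of "- 2*pi * of_int k"]
    have "((\<lambda>t. G (t + 2*pi * of_int (-k))) has_integral (F (x + h + 2*pi * of_int (-k)) - F (base_point x))) {x..x + h}"
      by (simp add: x algebra_simps)
    then show "(G has_integral (F (x + h) - F x)) {x..x + h}"
      unfolding periodic_int_multiple[of G, OF G_per] periodic_int_multiple[of F, OF per] periodic_base_point[of F, OF per] .
  qed
  define N where "N = (\<Union>k::int. (+) (2*pi * of_int k) ` (insert (-pi) N0))"
  have "negligible N" unfolding N_def
    by (rule negligible_countable_Union) (auto intro!: negligible_translation simp: N0(1) negligible_insert)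
  moreover have "vector_derivative F (at x) = G x" if "x \<notin> N" for x
  proof -
    define k where "k = \<lfloor>(x + pi) / (2*pi)\<rfloor>"
    have x: "x = 2*pi * of_int k + base_point x" by (simp add: base_point_def k_def)
    then have "base_point x \<notin> insert (-pi) N0" using that unfolding N_def by blast
    then have "(F has_vector_derivative g (base_point x)) (at (base_point x))"
      using base_point_bounds[of x] by (intro N0(2)) (auto simp: less_le)
    then have "(F has_vector_derivative G x) (at (x + 2*pi * of_int (-k)))"
      by (simp add: G_def base_point_def k_def)
    then have "(F has_vector_derivative G x) (at x)"
      using has_vector_derivative_periodic[of F "2*pi * of_int (-k)" "G x" x, OF periodic_int_multiple[of F, OF per]]
      by simp
    then show ?thesis by (rule vector_derivative_at)
  qed
  ultimately show ?thesis by (rule that[OF per_F per_G \<open>primitive F G\<close>])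
qed

lemma modulus_L_cong_negligible:
  assumes g: "periodic_L1 g" and N: "negligible N" and eq: "\<And>x. x \<notin> N \<Longrightarrow> f x = g x"
  shows "modulus_L f t = modulus_L g t"
proof -
  have "L1_increment f h = L1_increment g h" for h
    unfolding L1_increment_def
  proof (rule L1_norm_cong_negligible[OF periodic_L1_increment[OF g]])
    show "negligible (N \<union> (+) (-h) ` N)" using N by (intro negligible_Un negligible_translation)
    fix x assume "x \<notin> N \<union> (+) (-h) ` N"
    moreover then have "x + h \<notin> N" by (auto simp: image_iff)
    ultimately show "f (x + h) - f x = g (x + h) - g x" using eq by auto
  qed
  then show ?thesis by (simp add: modulus_L_eq)
qed

text \<open>
  The successive derivatives form a chain of primitives of Borel functions. Only the last one has to be
  changed on a null set, and its modulus of continuity does not notice the change.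
\<close>

lemma derivative_chain:
  fixes f :: "real \<Rightarrow> complex"
  assumes r: "r \<ge> 1" and f: "f \<in> L2pi"
    and diff: "\<And>k x. Suc k < r \<Longrightarrow> nth_vderiv k f differentiable (at x)"
    and ac: "\<And>k. k < r \<Longrightarrow> absolutely_continuous_on {-pi..pi} (nth_vderiv k f)"
  obtains F where "\<And>j. j \<le> r \<Longrightarrow> periodic_L1 (F j)" "\<And>j. j < r \<Longrightarrow> primitive (F j) (F (Suc j))"
    "F 0 = f" "\<And>t. modulus_L (nth_vderiv r f) t = modulus_L (F r) t"
proof -
  have per: "nth_vderiv k f (x + 2*pi) = nth_vderiv k f x" for k x
    using f by (intro nth_vderiv_periodic) (auto simp: L2pi_def)
  have cont: "continuous_on UNIV (nth_vderiv k f)" if "k < r" for k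
    by (intro periodic_continuous_on_UNIV absolutely_continuous_on_imp_continuous ac that per)
  obtain G N where G: "periodic_L1 G" "primitive (nth_vderiv (r - 1) f) G" "negligible N"
    "\<And>x. x \<notin> N \<Longrightarrow> vector_derivative (nth_vderiv (r - 1) f) (at x) = G x"
  proof -
    have "r - 1 < r" using r by simp
    from periodic_absolutely_continuous_derivative[OF ac[OF this] per] show ?thesis using that by metis
  qed
  define F where "F j = (if j < r then nth_vderiv j f else G)" for j
  show ?thesis
  proof (rule that[of F])
    show "periodic_L1 (F j)" if "j \<le> r" for j
      using G(1) cont[of j] per by (auto simp: F_def intro!: periodic_L1_continuous)
    show "primitive (F j) (F (Suc j))" if "j < r" for j
    proof (cases "Suc j < r")
      case True
      have "(nth_vderiv j f has_vector_derivative nth_vderiv (Suc j) f x) (at x within A)" for x A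
        using diff[OF True, of x] unfolding nth_vderiv_Suc
        by (auto simp: vector_derivative_works[symmetric] intro: has_vector_derivative_at_within)
      then have "primitive (nth_vderiv j f) (nth_vderiv (Suc j) f)"
        unfolding primitive_def by (auto intro!: fundamental_theorem_of_calculus)
      then show ?thesis using True by (simp add: F_def)
    next
      case False
      then have "Suc j = r" using that by simp
      then show ?thesis using G(2) by (auto simp: F_def)
    qed
    show "F 0 = f" using r by (simp add: F_def nth_vderiv_0)
    show "modulus_L (nth_vderiv r f) t = modulus_L (F r) t" for t
    proof -
      have "nth_vderiv r f x = G x" if "x \<notin> N" for x
        using G(4)[OF that] r nth_vderiv_Suc[of "r - 1" f] by simp
      from modulus_L_cong_negligible[OF G(1,3) this] show ?thesis by (simp add: F_def)
    qed
  qed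
qed

section \<open>The class GBV\<close>

lemma arg_cone_Re:
  assumes "z \<in> arg_cone \<theta>" "0 \<le> \<theta>" "\<theta> < pi/2"
  shows "cos \<theta> * norm z \<le> Re z"
proof -
  have "cos \<theta> \<le> cos \<bar>Arg z\<bar>"
    using assms by (intro cos_monotone_0_pi_le) (auto simp: arg_cone_def)
  then have "norm z * cos \<theta> \<le> norm z * cos (Arg z)" by (intro mult_left_mono) auto
  also have "\<dots> = Re z"
  proof (cases "z = 0")
    case False
    then show ?thesis by (simp add: cos_Arg)
  qed simp
  finally show ?thesis by (simp add: mult.commute)
qed

text \<open>
  The last consequence follows by telescoping: up to a constant, the terms with indices between \<open>m\<close>
  and \<open>2 m + 1\<close> do not exceed the largest of the \<open>N\<close> terms from \<open>m\<close> on.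
\<close>

lemma GBV_E:
  assumes "GBV c"
  obtains \<kappa> N M where "\<kappa> > 0" "\<And>n. n \<ge> 1 \<Longrightarrow> \<kappa> * norm (c n) \<le> Re (c n)"
    "N \<ge> (1::nat)" "M > (0::real)"
    "\<And>m. m \<ge> 1 \<Longrightarrow> (\<Sum>n = m..2*m. norm (c n - c (Suc n))) \<le> M * Max ((\<lambda>n. norm (c n)) ` {m..<m+N})"
    "\<And>m k. m \<ge> 1 \<Longrightarrow> m \<le> k \<Longrightarrow> k \<le> 2*m+1 \<Longrightarrow> norm (c k) \<le> (M + 1) * Max ((\<lambda>n. norm (c n)) ` {m..<m+N})"
proof -
  from assms obtain \<theta> N M where \<theta>: "0 \<le> \<theta>" "\<theta> < pi/2" "\<And>n. n \<ge> 1 \<Longrightarrow> c n \<in> arg_cone \<theta>"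
    and N: "N \<ge> (1::nat)" and M: "M > (0::real)"
    and var: "\<And>m. m \<ge> 1 \<Longrightarrow> (\<Sum>n = m..2*m. norm (c n - c (Suc n))) \<le> M * Max ((\<lambda>n. norm (c n)) ` {m..<m+N})"
    unfolding GBV_def by auto
  show ?thesis
  proof (rule that[of "cos \<theta>" N M, OF _ _ N M var])
    show "cos \<theta> > 0" using \<theta> by (intro cos_gt_zero_pi) auto
    show "cos \<theta> * norm (c n) \<le> Re (c n)" if "n \<ge> 1" for n by (rule arg_cone_Re[OF \<theta>(3)[OF that] \<theta>(1,2)])
    show "norm (c k) \<le> (M + 1) * Max ((\<lambda>n. norm (c n)) ` {m..<m+N})" if m: "m \<ge> 1" "m \<le> k" "k \<le> 2*m+1" for m k
    proof -
      have tel: "c m - c k = (\<Sum>n = m..<k. c n - c (Suc n))"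
        using m(2) by (induction k rule: dec_induct) (auto simp: algebra_simps)
      have "norm (c k) \<le> norm (c m) + norm (c m - c k)" using norm_triangle_sub[of "c k" "c m"] by (simp add: norm_minus_commute)
      also have "norm (c m - c k) \<le> (\<Sum>n = m..<k. norm (c n - c (Suc n)))" unfolding tel by (rule norm_sum)
      also have "\<dots> \<le> (\<Sum>n = m..2*m. norm (c n - c (Suc n)))" using m by (intro sum_mono2) auto
      also have "\<dots> \<le> M * Max ((\<lambda>n. norm (c n)) ` {m..<m+N})" by (rule var[OF m(1)])
      also have "norm (c m) \<le> Max ((\<lambda>n. norm (c n)) ` {m..<m+N})" using N by (intro Max_ge) auto
      finally show ?thesis by (simp add: algebra_simps)
    qed
  qed
qed

section \<open>Coefficients are controlled by the remainder\<close>

text \<open>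
  The coefficients \<open>(1 - k/N) / k\<close> of the Fejer mean of the sawtooth series.
\<close>

definition sine_weight :: "nat \<Rightarrow> nat \<Rightarrow> real" where
  "sine_weight N k = (real N - real k) / (real N * real k)"

definition sine_poly :: "nat \<Rightarrow> real \<Rightarrow> real" where
  "sine_poly N x = (\<Sum>k=1..<N. sine_weight N k * sin (real k * x))"

lemma fejer_cosine:
  assumes "N \<ge> 1" shows "fejer N t = real N + 2 * (\<Sum>k=1..<N. (real N - real k) * cos (real k * t))"
proof -
  have "fejer N t = Re (complex_of_real (fejer N t))" by simp
  also have "\<dots> = (\<Sum>k\<in>{-int N..int N}. fejer_coeff N k * Re (ek k t))"
    unfolding fejer_expansion[of N N, OF order_refl] by simp
  also have "\<dots> = real N + 2 * (\<Sum>k=1..N. (real N - real k) * cos (real k * t))"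
    unfolding sum_symmetric_int by (simp add: fejer_coeff_def ek_def sum_distrib_left)
  also have "(\<Sum>k=1..N. (real N - real k) * cos (real k * t)) = (\<Sum>k=1..<N. (real N - real k) * cos (real k * t))"
    by (intro sum.mono_neutral_right) auto
  finally show ?thesis .
qed

text \<open>
  The derivative is \<open>(F N / N - 1) / 2\<close>, whose integral norm is bounded independently of \<open>N\<close> since
  \<open>F N\<close> is nonnegative with integral \<open>2 pi N\<close>; and the polynomial vanishes at \<open>0\<close>.
\<close>

lemma sine_poly_bounded:
  assumes N: "N \<ge> 1" and x: "\<bar>x\<bar> \<le> pi" shows "\<bar>sine_poly N x\<bar> \<le> 2 * pi"
proof -
  define d where "d t = (fejer N t / real N - 1) / 2" for t
  have deriv: "(sine_poly N has_vector_derivative d t) (at t within A)" for t A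
  proof -
    have "((\<lambda>t. \<Sum>k=1..<N. sine_weight N k * sin (real k * t)) has_real_derivative (\<Sum>k=1..<N. sine_weight N k * (cos (real k * t) * real k))) (at t within A)"
      by (intro DERIV_sum) (auto intro!: derivative_eq_intros)
    also have "(\<Sum>k=1..<N. sine_weight N k * (cos (real k * t) * real k)) = (\<Sum>k=1..<N. (real N - real k) * cos (real k * t)) / real N"
      unfolding sum_divide_distrib by (intro sum.cong refl) (simp add: sine_weight_def field_simps)
    also have "\<dots> = d t" using N unfolding d_def fejer_cosine[OF N] by (simp add: field_simps)
    finally show ?thesis by (simp add: sine_poly_def[abs_def] has_real_derivative_iff_has_vector_derivative)
  qed
  have main: "\<bar>sine_poly N y\<bar> \<le> 2 * pi" if y: "0 \<le> y" "y \<le> pi" for y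
  proof -
    define b where "b t = (fejer N t / real N + 1) / 2" for t
    have b_cont: "continuous_on A b" for A unfolding b_def by (intro continuous_intros) (use N in auto)
    have "(d has_integral (sine_poly N y - sine_poly N 0)) {0..y}"
      using y by (intro fundamental_theorem_of_calculus deriv) auto
    then have int: "(d has_integral sine_poly N y) {0..y}" by (simp add: sine_poly_def)
    have "norm (sine_poly N y) = norm (integral {0..y} d)" using int by (simp add: integral_unique)
    also have "\<dots> \<le> integral {0..y} b"
    proof (rule integral_norm_bound_integral)
      show "norm (d t) \<le> b t" for t using N by (auto simp: d_def b_def abs_le_iff field_simps)
    qed (use int b_cont in \<open>auto intro: integrable_continuous_interval\<close>)
    also have "\<dots> \<le> integral {-pi..pi} b"
      using y N by (intro integral_subset_le) (auto intro!: integrable_continuous_interval b_cont simp: b_def)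
    also have "\<dots> = (LINT t:{-pi..pi}|lborel. b t)"
      by (rule set_borel_integral_eq_integral(2)[symmetric])
        (unfold set_integrable_def, intro borel_integrable_compact compact_Icc b_cont)
    also have "\<dots> = 2 * pi"
    proof -
      have "set_integrable lborel {-pi..pi} (\<lambda>t. fejer N t / real N)"
        unfolding set_integrable_def
        by (intro borel_integrable_compact compact_Icc continuous_intros) (use N in simp)
      moreover have "set_integrable lborel {-pi..pi} (\<lambda>t. 1::real)"
        unfolding set_integrable_def by (intro borel_integrable_compact compact_Icc continuous_intros)
      ultimately show ?thesis using N unfolding b_def
        by (simp add: set_integral_add(2) integral_fejer) (simp add: set_lebesgue_integral_def)
    qed
    finally show ?thesis by simp
  qed
  have "sine_poly N (-x) = - sine_poly N x" by (simp add: sine_poly_def sum_negf)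
  then show ?thesis using main[of x] main[of "-x"] x by (cases "0 \<le> x") auto
qed

text \<open>
  The sum is, up to a constant, the integral of \<open>g x * e^(-i a x)\<close> against the bounded sine polynomial.
\<close>

lemma hardy_type_bound:
  assumes g: "periodic_L1 g" and N: "N \<ge> 1"
  shows "norm (\<Sum>k=1..<N. complex_of_real (sine_weight N k) * (fourier_coeff g (a - int k) - fourier_coeff g (a + int k))) \<le> 2 * L1_norm g"
proof -
  let ?I = "{-pi..pi}"
  let ?S = "\<Sum>k=1..<N. complex_of_real (sine_weight N k) * (fourier_coeff g (a - int k) - fourier_coeff g (a + int k))"
  have [measurable]: "g \<in> borel_measurable borel" using g by measurable
  define \<Phi> where "\<Phi> x = ek (-a) x * complex_of_real (sine_poly N x)" for x
  have sin_eq: "ek (-a) x * complex_of_real (sin (real k * x)) = (ek (int k - a) x - ek (- int k - a) x) / (2 * \<i>)" for k x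
  proof -
    have "ek (int k - a) x = ek (-a) x * ek (int k) x" "ek (- int k - a) x = ek (-a) x * ek (- int k) x"
      using ek_add[of "int k" "-a" x] ek_add[of "- int k" "-a" x] by (simp_all add: mult.commute)
    moreover have "ek (int k) x - ek (- int k) x = 2 * \<i> * complex_of_real (sin (real k * x))"
      by (simp add: ek_def complex_eq_iff)
    ultimately have "ek (int k - a) x - ek (- int k - a) x = ek (-a) x * (2 * \<i> * complex_of_real (sin (real k * x)))"
      by (simp only: right_diff_distrib[symmetric])
    also have "\<dots> = (2 * \<i>) * (ek (-a) x * complex_of_real (sin (real k * x)))" by (simp only: mult_ac)
    finally show ?thesis by (simp only: nonzero_mult_div_cancel_left) simp
  qed
  have int: "set_integrable lborel ?I (\<lambda>x. c * (g x * ek j x))" for c j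
    by (intro set_integrable_mult_right periodic_L1_integrable periodic_L1_ek_mult g)
  have \<Phi>_eq: "g x * \<Phi> x = (\<Sum>k=1..<N. complex_of_real (sine_weight N k) / (2 * \<i>) * (g x * ek (int k - a) x) - complex_of_real (sine_weight N k) / (2 * \<i>) * (g x * ek (- int k - a) x))" for x
  proof -
    have "g x * \<Phi> x = (\<Sum>k=1..<N. g x * (complex_of_real (sine_weight N k) * (ek (-a) x * complex_of_real (sin (real k * x)))))"
      by (simp add: \<Phi>_def sine_poly_def sum_distrib_left mult_ac)
    also have "\<dots> = (\<Sum>k=1..<N. complex_of_real (sine_weight N k) / (2 * \<i>) * (g x * ek (int k - a) x) - complex_of_real (sine_weight N k) / (2 * \<i>) * (g x * ek (- int k - a) x))"
      unfolding sin_eq by (intro sum.cong refl) (simp add: field_simps)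
    finally show ?thesis .
  qed
  have "(LINT x:?I|lborel. g x * \<Phi> x) = (\<Sum>k=1..<N. (LINT x:?I|lborel. complex_of_real (sine_weight N k) / (2 * \<i>) * (g x * ek (int k - a) x) - complex_of_real (sine_weight N k) / (2 * \<i>) * (g x * ek (- int k - a) x)))"
    unfolding \<Phi>_eq by (intro set_integral_sum set_integral_diff(1) int)
  also have "\<dots> = (\<Sum>k=1..<N. complex_of_real (sine_weight N k) / (2 * \<i>) * (complex_of_real (2*pi) * fourier_coeff g (a - int k)) - complex_of_real (sine_weight N k) / (2 * \<i>) * (complex_of_real (2*pi) * fourier_coeff g (a + int k)))"
    unfolding set_integral_diff(2)[OF int int] set_integral_mult_right integral_mult_ek[OF g] by (simp add: add.commute)
  also have "\<dots> = complex_of_real pi / \<i> * ?S"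
    unfolding sum_distrib_left by (intro sum.cong refl) (simp add: field_simps)
  finally have "norm (LINT x:?I|lborel. g x * \<Phi> x) = pi * norm ?S" by (simp add: norm_mult norm_divide)
  moreover have "ennreal (norm (LINT x:?I|lborel. g x * \<Phi> x)) \<le> ennreal (2 * pi * L1_norm g)"
  proof -
    have "ennreal (norm (LINT x:?I|lborel. g x * \<Phi> x)) \<le> (\<integral>\<^sup>+x\<in>?I. ennreal (norm (g x * \<Phi> x)) \<partial>lborel)"
      by (rule norm_set_integral_le_nn)
    also have "\<dots> \<le> (\<integral>\<^sup>+x. ennreal (2 * pi) * (ennreal (norm (g x)) * indicator ?I x) \<partial>lborel)"
    proof (intro nn_integral_mono)
      fix x :: real
      show "ennreal (norm (g x * \<Phi> x)) * indicator ?I x \<le> ennreal (2 * pi) * (ennreal (norm (g x)) * indicator ?I x)"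
      proof (cases "x \<in> ?I")
        case True
        then have "norm (\<Phi> x) \<le> 2 * pi" using sine_poly_bounded[OF N, of x] by (auto simp: \<Phi>_def norm_mult abs_le_iff)
        then have "norm (g x * \<Phi> x) \<le> 2 * pi * norm (g x)"
          using mult_left_mono[of "norm (\<Phi> x)" "2*pi" "norm (g x)"] by (simp add: norm_mult mult.commute)
        then have "ennreal (norm (g x * \<Phi> x)) \<le> ennreal (2 * pi) * ennreal (norm (g x))"
          by (subst ennreal_mult[symmetric]) (auto intro!: ennreal_leI)
        then show ?thesis using True by simp
      qed simp
    qed
    also have "\<dots> = ennreal (2 * pi) * ennreal (L1_norm g)"
      by (subst nn_integral_cmult) (auto simp: ennreal_L1_norm[OF g])
    also have "\<dots> = ennreal (2 * pi * L1_norm g)" by (subst ennreal_mult[symmetric]) (auto simp: L1_norm_nonneg)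
    finally show ?thesis .
  qed
  then have "norm (LINT x:?I|lborel. g x * \<Phi> x) \<le> 2 * pi * L1_norm g"
    by (subst (asm) ennreal_le_iff) (auto simp: L1_norm_nonneg)
  ultimately have "pi * norm ?S \<le> pi * (2 * L1_norm g)" by (simp add: mult_ac)
  then show ?thesis by (subst (asm) mult_le_cancel_left_pos) auto
qed

text \<open>
  With \<open>a l = |c (n + l)| / l\<close>, the cone condition bounds \<open>\<Sum> a l\<close> by \<open>B\<close>, since the weights are at
  least \<open>1 / (4 l)\<close> for \<open>l \<le> 3 n / 2\<close>. On the other hand, up to a constant \<open>|c j|\<close> is at most the sum of
  the absolute values of the \<open>N\<close> terms from \<open>n + k\<close> on, for every \<open>k \<le> n\<close>; dividing by \<open>k\<close> and summing gives \<open>|c j|\<close> times a harmonic number on one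
  side and at most a constant times \<open>\<Sum> a l\<close> on the other.
\<close>

lemma GBV_log_bound:
  assumes "GBV c"
  obtains C n0 where "C \<ge> 0"
    "\<And>n j B. n \<ge> n0 \<Longrightarrow> j = 2*n \<or> j = 2*n+1 \<Longrightarrow>
      norm (\<Sum>k=1..<2*n. complex_of_real (sine_weight (2*n) k) * c (n + k)) \<le> B \<Longrightarrow> norm (c j) * ln (real j) \<le> C * B"
proof -
  obtain \<kappa> N M where k: "\<kappa> > 0" "\<And>n. n \<ge> 1 \<Longrightarrow> \<kappa> * norm (c n) \<le> Re (c n)"
    and N: "N \<ge> (1::nat)" and M: "M > (0::real)"
    and var: "\<And>m. m \<ge> 1 \<Longrightarrow> (\<Sum>n = m..2*m. norm (c n - c (Suc n))) \<le> M * Max ((\<lambda>n. norm (c n)) ` {m..<m+N})"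
    and osc: "\<And>m k. m \<ge> 1 \<Longrightarrow> m \<le> k \<Longrightarrow> k \<le> 2*m+1 \<Longrightarrow> norm (c k) \<le> (M + 1) * Max ((\<lambda>n. norm (c n)) ` {m..<m+N})"
    by (rule GBV_E[OF assms]) blast
  define C where "C = 3 * ((M + 1) * (real N * real N) * 4 / \<kappa>)"
  show ?thesis
  proof (rule that[of C "2 * N + 2"])
    show "C \<ge> 0" using M k(1) by (simp add: C_def)
    fix n j :: nat and B :: real
    assume n: "n \<ge> 2 * N + 2" and j: "j = 2*n \<or> j = 2*n+1"
      and B: "norm (\<Sum>k=1..<2*n. complex_of_real (sine_weight (2*n) k) * c (n + k)) \<le> B"
    define a where "a l = norm (c (n + l)) / real l" for l
    define T where "T = (\<Sum>l=1..n+N. a l)"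
    have a0: "0 \<le> a l" for l by (simp add: a_def)
    have w0: "0 \<le> sine_weight (2*n) l" if "l \<in> {1..<2*n}" for l using that by (simp add: sine_weight_def)
    \<comment> \<open>The upper summation limit \<open>n + N\<close> leaves room for the shifts by \<open>i < N\<close> below; it is at most \<open>3 n / 2\<close>.\<close>
    have T_le: "\<kappa> * T \<le> 4 * B"
    proof -
      have "\<kappa> * T \<le> (\<Sum>l=1..n+N. 4 * (sine_weight (2*n) l * Re (c (n + l))))"
        unfolding T_def sum_distrib_left
      proof (intro sum_mono)
        fix l assume l: "l \<in> {1..n+N}"
        have "1 / real l \<le> 4 * sine_weight (2*n) l"
        proof -
          have "2 * l \<le> 3 * n" using l n by auto
          then have "2 * real l \<le> 3 * real n" by (metis of_nat_le_iff of_nat_mult of_nat_numeral)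
          then have "1 \<le> 4 * ((2 * real n - real l) / (2 * real n))" using n by (simp add: field_simps)
          then have "1 / real l \<le> 4 * ((2 * real n - real l) / (2 * real n)) / real l" by (intro divide_right_mono) auto
          then show ?thesis by (simp add: sine_weight_def)
        qed
        then have "\<kappa> * a l \<le> (4 * sine_weight (2*n) l) * (\<kappa> * norm (c (n + l)))"
          using k(1) mult_right_mono[of "1 / real l" "4 * sine_weight (2*n) l" "\<kappa> * norm (c (n + l))"] by (simp add: a_def)
        also have "\<dots> \<le> (4 * sine_weight (2*n) l) * Re (c (n + l))"
          using l n w0[of l] by (intro mult_left_mono k(2)) auto
        finally show "\<kappa> * a l \<le> 4 * (sine_weight (2*n) l * Re (c (n + l)))" by simp
      qed
      also have "\<dots> \<le> (\<Sum>l=1..<2*n. 4 * (sine_weight (2*n) l * Re (c (n + l))))"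
      proof (intro sum_mono2)
        fix l assume "l \<in> {1..<2*n} - {1..n+N}"
        then have "0 \<le> sine_weight (2*n) l" "\<kappa> * norm (c (n + l)) \<le> Re (c (n + l))" by (auto intro!: w0 k(2))
        moreover have "0 \<le> \<kappa> * norm (c (n + l))" using k(1) by simp
        ultimately show "0 \<le> 4 * (sine_weight (2*n) l * Re (c (n + l)))" by simp
      qed (use n in auto)
      also have "\<dots> = 4 * Re (\<Sum>l=1..<2*n. complex_of_real (sine_weight (2*n) l) * c (n + l))"
        by (simp add: sum_distrib_left)
      also have "\<dots> \<le> 4 * B" by (intro mult_left_mono order_trans[OF complex_Re_le_cmod B]) simp
      finally show ?thesis .
    qed
    have "norm (c j) * harm n = (\<Sum>k=1..n. norm (c j) / real k)"
      by (simp add: harm_def sum_distrib_left divide_inverse)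
    also have "\<dots> \<le> (\<Sum>k=1..n. \<Sum>i<N. (M + 1) * real N * a (k + i))"
    proof (intro sum_mono)
      fix k assume kk: "k \<in> {1..n}"
      have "norm (c j) \<le> (M + 1) * Max ((\<lambda>n. norm (c n)) ` {n+k..<n+k+N})"
        using kk j n by (intro osc) auto
      also have "Max ((\<lambda>n. norm (c n)) ` {n+k..<n+k+N}) \<le> (\<Sum>i<N. norm (c (n + k + i)))"
      proof (subst Max_le_iff)
        show "\<forall>y\<in>(\<lambda>n. norm (c n)) ` {n+k..<n+k+N}. y \<le> (\<Sum>i<N. norm (c (n + k + i)))"
        proof clarify
          fix m assume "m \<in> {n+k..<n+k+N}"
          then have "norm (c m) = norm (c (n + k + (m - (n + k))))" "m - (n + k) \<in> {..<N}" by auto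
          then show "norm (c m) \<le> (\<Sum>i<N. norm (c (n + k + i)))"
            using member_le_sum[of "m - (n + k)" "{..<N}" "\<lambda>i. norm (c (n + k + i))"] by auto
        qed
      qed (use N in auto)
      finally have "norm (c j) / real k \<le> (M + 1) * (\<Sum>i<N. norm (c (n + k + i))) / real k"
        using M by (intro divide_right_mono) auto
      also have "\<dots> = (\<Sum>i<N. (M + 1) * (norm (c (n + k + i)) / real k))"
        by (simp add: sum_distrib_left sum_divide_distrib)
      also have "\<dots> \<le> (\<Sum>i<N. (M + 1) * real N * a (k + i))"
      proof (intro sum_mono)
        fix i assume "i \<in> {..<N}"
        \<comment> \<open>Since \<open>k + i \<le> N k\<close>, the factor \<open>1/k\<close> may be replaced by \<open>N / (k + i)\<close>.\<close>
        then have "i \<le> N - 1" by auto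
        also have "\<dots> \<le> (N - 1) * k" using kk by simp
        finally have "i \<le> (N - 1) * k" .
        then have "k + i \<le> N * k" using N by (cases N) auto
        then have "real (k + i) \<le> real N * real k" by (metis of_nat_le_iff of_nat_mult)
        then have "1 / real k \<le> real N / real (k + i)" using kk by (simp add: field_simps)
        then have "norm (c (n + k + i)) * (1 / real k) \<le> norm (c (n + k + i)) * (real N / real (k + i))"
          by (intro mult_left_mono) auto
        then have "norm (c (n + k + i)) / real k \<le> real N * a (k + i)" by (simp add: a_def add.assoc mult.commute)
        then show "(M + 1) * (norm (c (n + k + i)) / real k) \<le> (M + 1) * real N * a (k + i)"
          using M mult_left_mono[of "norm (c (n + k + i)) / real k" "real N * a (k + i)" "M + 1"] by (simp add: mult.assoc)
      qed
      finally show "norm (c j) / real k \<le> (\<Sum>i<N. (M + 1) * real N * a (k + i))" .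
    qed
    also have "\<dots> = (\<Sum>i<N. (M + 1) * real N * (\<Sum>k=1..n. a (k + i)))"
      by (subst sum.swap) (simp add: sum_distrib_left)
    also have "\<dots> \<le> (\<Sum>i<N. (M + 1) * real N * T)"
    proof (intro sum_mono mult_left_mono)
      fix i assume i: "i \<in> {..<N}"
      have "(\<Sum>k=1..n. a (k + i)) = (\<Sum>l\<in>(\<lambda>k. k + i) ` {1..n}. a l)" by (subst sum.reindex) auto
      also have "\<dots> \<le> T" unfolding T_def using i a0 by (intro sum_mono2) auto
      finally show "(\<Sum>k=1..n. a (k + i)) \<le> T" .
    qed (use M in auto)
    also have "\<dots> = (M + 1) * (real N * real N) * T" by simp
    also have "\<dots> \<le> (M + 1) * (real N * real N) * (4 * B / \<kappa>)"
      using T_le k(1) M by (intro mult_left_mono) (auto simp: field_simps)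
    finally have harm_bound: "norm (c j) * harm n \<le> (M + 1) * (real N * real N) * (4 * B / \<kappa>)" .
    \<comment> \<open>Here \<open>j \<le> 4 n \<le> n^3\<close>, so passing from \<open>n\<close> to \<open>j\<close> costs only a factor 3 in the logarithm.\<close>
    have "ln (real j) \<le> 3 * harm n"
    proof -
      have "real j \<le> real n ^ 3"
      proof -
        have "n \<ge> 2" using n by simp
        then have "4 * n \<le> n * (n * n)" by (metis mult.commute mult_le_mono mult_le_mono2 numeral_Bit0 mult_2_right)
        moreover have "j \<le> 4 * n" using j n by auto
        ultimately have "j \<le> n ^ 3" unfolding power3_eq_cube mult.assoc by (rule order_trans[rotated])
        then show ?thesis by (metis of_nat_le_iff of_nat_power)
      qed
      then have "ln (real j) \<le> ln (real n ^ 3)" using j n by (subst ln_le_cancel_iff) auto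
      also have "\<dots> = 3 * ln (real n)" using n by (simp add: ln_realpow)
      also have "\<dots> \<le> 3 * ln (real n + 1)" using n by simp
      also have "\<dots> \<le> 3 * harm n" using ln_le_harm[of n] by simp
      finally show ?thesis .
    qed
    then have "norm (c j) * ln (real j) \<le> 3 * (norm (c j) * harm n)"
      using mult_left_mono[of "ln (real j)" "3 * harm n" "norm (c j)"] by simp
    also have "\<dots> \<le> C * B" using harm_bound by (simp add: C_def)
    finally show "norm (c j) * ln (real j) \<le> C * B" .
  qed
qed

section \<open>Blocks of coefficients\<close>

lemma abel_summation:
  fixes b z :: "nat \<Rightarrow> complex"
  shows "(\<Sum>i<p. b i * z i) = (\<Sum>i<p. (b i - b (Suc i)) * (\<Sum>j<Suc i. z j)) + b p * (\<Sum>j<p. z j)"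
  by (induction p) (simp_all add: algebra_simps)

text \<open>
  The weights taper off to 0 at \<open>2 n\<close>, so summation by parts leaves no boundary term. It
  leads to Dirichlet kernels of order less than \<open>n\<close>, with coefficients whose total variation is at most
  a constant times the largest of the \<open>N\<close> terms from \<open>n\<close> on.
\<close>

lemma GBV_block_norm_le:
  assumes "GBV c" and s: "s = 1 \<or> s = (-1::int)"
  obtains C n0 where "C \<ge> 0"
    "\<And>n B. n \<ge> n0 \<Longrightarrow> (\<And>k. k \<ge> n \<Longrightarrow> norm (c k) * ln (real k) \<le> B) \<Longrightarrow>
      L1_norm (\<lambda>x. \<Sum>k=n+1..2*n. (complex_of_real ((2 * real n - real k) / real n) * c k) * ek (s * int k) x) \<le> C * B"
proof -
  obtain \<kappa> N M where k: "\<kappa> > 0" "\<And>n. n \<ge> 1 \<Longrightarrow> \<kappa> * norm (c n) \<le> Re (c n)"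
    and N: "N \<ge> (1::nat)" and M: "M > (0::real)"
    and var: "\<And>m. m \<ge> 1 \<Longrightarrow> (\<Sum>n = m..2*m. norm (c n - c (Suc n))) \<le> M * Max ((\<lambda>n. norm (c n)) ` {m..<m+N})"
    and osc: "\<And>m k. m \<ge> 1 \<Longrightarrow> m \<le> k \<Longrightarrow> k \<le> 2*m+1 \<Longrightarrow> norm (c k) \<le> (M + 1) * Max ((\<lambda>n. norm (c n)) ` {m..<m+N})"
    by (rule GBV_E[OF assms(1)]) blast
  show ?thesis
  proof (rule that[of "50 * (2 * M + 1)" 3])
    show "0 \<le> 50 * (2 * M + 1)" using M by simp
    fix n :: nat and B :: real
    assume n: "n \<ge> 3" and B: "\<And>k. k \<ge> n \<Longrightarrow> norm (c k) * ln (real k) \<le> B"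
    define h where "h x = (\<Sum>k=n+1..2*n. (complex_of_real ((2 * real n - real k) / real n) * c k) * ek (s * int k) x)" for x
    define X where "X = Max ((\<lambda>n. norm (c n)) ` {n..<n+N})"
    \<comment> \<open>This absorbs the additive constant in the norm of the Dirichlet kernel.\<close>
    have ln_n: "ln (real n) \<ge> 1"
    proof -
      have "exp 1 \<le> real n" using n exp_le by linarith
      then show ?thesis using n by (subst ln_ge_iff) auto
    qed
    have X: "X * ln (real n) \<le> B"
    proof -
      have "X \<in> (\<lambda>n. norm (c n)) ` {n..<n+N}" unfolding X_def using N by (intro Max_in) auto
      then obtain k where k: "k \<ge> n" "X = norm (c k)" by auto
      have "X * ln (real n) \<le> norm (c k) * ln (real k)" using k n by (auto intro!: mult_left_mono)
      then show ?thesis using B[OF k(1)] by simp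
    qed
    \<comment> \<open>The block is shifted to start at frequency \<open>n + 1\<close>; in particular \<open>b (n - 1) = 0\<close>.\<close>
    define b where "b i = complex_of_real ((real n - real (Suc i)) / real n) * c (n + Suc i)" for i
    have b_sum: "(\<Sum>i<n-1. norm (b i - b (Suc i))) \<le> (2 * M + 1) * X"
    proof -
      have "(\<Sum>i<n-1. norm (b i - b (Suc i))) \<le> (\<Sum>i<n-1. norm (c (n + Suc i) - c (Suc (n + Suc i))) + (M + 1) * X / real n)"
      proof (intro sum_mono)
        fix i assume i: "i \<in> {..<n-1}"
        define q where "q = (real n - real (Suc i)) / real n"
        have q: "0 \<le> q" "q \<le> 1" "(real n - real (Suc (Suc i))) / real n = q - 1 / real n"
          using i n by (auto simp: q_def field_simps)
        have "b i - b (Suc i) = complex_of_real q * (c (n + Suc i) - c (Suc (n + Suc i))) + complex_of_real (1 / real n) * c (Suc (n + Suc i))"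
          unfolding b_def q(3) q_def[symmetric] by (simp add: algebra_simps)
        also have "norm \<dots> \<le> q * norm (c (n + Suc i) - c (Suc (n + Suc i))) + 1 / real n * norm (c (Suc (n + Suc i)))"
          by (rule order_trans[OF norm_triangle_ineq]) (simp add: norm_mult norm_divide q)
        also have "\<dots> \<le> 1 * norm (c (n + Suc i) - c (Suc (n + Suc i))) + 1 / real n * ((M + 1) * X)"
          unfolding X_def using i n q by (intro add_mono mult_right_mono mult_left_mono osc) auto
        finally show "norm (b i - b (Suc i)) \<le> norm (c (n + Suc i) - c (Suc (n + Suc i))) + (M + 1) * X / real n" by simp
      qed
      also have "\<dots> = (\<Sum>i<n-1. norm (c (n + Suc i) - c (Suc (n + Suc i)))) + real (n - 1) * ((M + 1) * X / real n)"
        by (simp add: sum.distrib)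
      also have "(\<Sum>i<n-1. norm (c (n + Suc i) - c (Suc (n + Suc i)))) = (\<Sum>k\<in>(\<lambda>i. n + Suc i) ` {..<n-1}. norm (c k - c (Suc k)))"
        by (subst sum.reindex) (auto simp: inj_on_def)
      also have "\<dots> \<le> (\<Sum>k=n..2*n. norm (c k - c (Suc k)))" by (intro sum_mono2) auto
      also have "\<dots> \<le> M * X" unfolding X_def using n by (intro var) auto
      also have "real (n - 1) * ((M + 1) * X / real n) \<le> (M + 1) * X"
      proof -
        have "norm (c n) \<le> X" unfolding X_def using N by (intro Max_ge) auto
        then have "0 \<le> X" using norm_ge_zero order_trans by blast
        then have "real (n - 1) * ((M + 1) * X / real n) \<le> real n * ((M + 1) * X / real n)" using M by (intro mult_right_mono) auto
        then show ?thesis using n by simp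
      qed
      finally show ?thesis by (simp add: algebra_simps)
    qed
    have norm_h: "norm (h x) \<le> (\<Sum>i<n-1. norm (b i - b (Suc i)) * norm (dirichlet (Suc i) x))" for x
    proof -
      have reindex: "(\<Sum>k=n+1..2*n. u k) = (\<Sum>i<n. u (n + Suc i))" for u :: "nat \<Rightarrow> complex"
        by (rule sum.reindex_bij_witness[where i="\<lambda>i. n + Suc i" and j="\<lambda>k. k - Suc n"]) auto
      have "h x = (\<Sum>i<n. ek (s * int (Suc n)) x * (b i * ek (s * int i) x))"
        unfolding h_def reindex
      proof (intro sum.cong refl)
        fix i
        have "ek (s * int (n + Suc i)) x = ek (s * int (Suc n)) x * ek (s * int i) x"
          by (subst ek_add[symmetric]) (simp add: algebra_simps)
        moreover have "2 * real n - real (n + Suc i) = real n - real (Suc i)" by simp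
        ultimately show "complex_of_real ((2 * real n - real (n + Suc i)) / real n) * c (n + Suc i) * ek (s * int (n + Suc i)) x
            = ek (s * int (Suc n)) x * (b i * ek (s * int i) x)"
          by (simp only: b_def mult_ac)
      qed
      then have "norm (h x) = norm (\<Sum>i<n. b i * ek (s * int i) x)"
        by (simp add: sum_distrib_left[symmetric] norm_mult)
      also have "(\<Sum>i<n. b i * ek (s * int i) x) = (\<Sum>i<n-1. b i * ek (s * int i) x)"
      proof (intro sum.mono_neutral_right ballI)
        fix i assume "i \<in> {..<n} - {..<n-1}"
        then have "Suc i = n" using n by auto
        then show "b i * ek (s * int i) x = 0" by (simp add: b_def)
      qed auto
      also have "\<dots> = (\<Sum>i<n-1. (b i - b (Suc i)) * (\<Sum>j<Suc i. ek (s * int j) x)) + b (n-1) * (\<Sum>j<n-1. ek (s * int j) x)"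
        by (rule abel_summation)
      also have "b (n - 1) = 0" using n by (simp add: b_def)
      also have "norm ((\<Sum>i<n-1. (b i - b (Suc i)) * (\<Sum>j<Suc i. ek (s * int j) x)) + 0 * (\<Sum>j<n-1. ek (s * int j) x))
          \<le> (\<Sum>i<n-1. norm ((b i - b (Suc i)) * (\<Sum>j<Suc i. ek (s * int j) x)))" by (simp only: mult_zero_left add_0_right norm_sum)
      also have "\<dots> = (\<Sum>i<n-1. norm (b i - b (Suc i)) * norm (dirichlet (Suc i) x))"
      proof (intro sum.cong refl)
        fix i
        have "norm (\<Sum>j<Suc i. ek (s * int j) x) = norm (dirichlet (Suc i) x)"
        proof (cases "s = 1")
          case False
          then have "(\<Sum>j<Suc i. ek (s * int j) x) = cnj (dirichlet (Suc i) x)"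
            using s unfolding dirichlet_def cnj_sum cnj_ek by simp
          then show ?thesis by (simp only: complex_mod_cnj)
        qed (simp add: dirichlet_def)
        then show "norm ((b i - b (Suc i)) * (\<Sum>j<Suc i. ek (s * int j) x)) = norm (b i - b (Suc i)) * norm (dirichlet (Suc i) x)"
          by (simp only: norm_mult)
      qed
      finally show ?thesis .
    qed
    have h: "periodic_L1 h" unfolding h_def[abs_def] by (intro periodic_L1_continuous continuous_intros) auto
    have "(\<integral>\<^sup>+x\<in>{-pi..pi}. ennreal (norm (h x)) \<partial>lborel)
        \<le> (\<integral>\<^sup>+x. (\<Sum>i<n-1. ennreal (norm (b i - b (Suc i))) * (ennreal (norm (dirichlet (Suc i) x)) * indicator {-pi..pi} x)) \<partial>lborel)"
    proof (intro nn_integral_mono)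
      fix x :: real
      have "ennreal (norm (h x)) \<le> ennreal (\<Sum>i<n-1. norm (b i - b (Suc i)) * norm (dirichlet (Suc i) x))"
        by (intro ennreal_leI norm_h)
      also have "\<dots> = (\<Sum>i<n-1. ennreal (norm (b i - b (Suc i))) * ennreal (norm (dirichlet (Suc i) x)))"
        by (subst sum_ennreal[symmetric]) (auto simp: ennreal_mult)
      finally show "ennreal (norm (h x)) * indicator {-pi..pi} x
          \<le> (\<Sum>i<n-1. ennreal (norm (b i - b (Suc i))) * (ennreal (norm (dirichlet (Suc i) x)) * indicator {-pi..pi} x))"
        by (auto simp: indicator_def)
    qed
    also have "\<dots> = (\<Sum>i<n-1. ennreal (norm (b i - b (Suc i))) * (\<integral>\<^sup>+x\<in>{-pi..pi}. ennreal (norm (dirichlet (Suc i) x)) \<partial>lborel))"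
      by (subst nn_integral_sum) (auto intro!: sum.cong nn_integral_cmult)
    also have "\<dots> \<le> (\<Sum>i<n-1. ennreal (norm (b i - b (Suc i))) * ennreal (50 * ln (real n)))"
    proof (intro sum_mono mult_left_mono)
      fix i assume i: "i \<in> {..<n-1}"
      have "ln (real (Suc i)) \<le> ln (real n)" using i by (subst ln_le_cancel_iff) auto
      then have "10 * ln (real (Suc i)) + 40 \<le> 50 * ln (real n)" using ln_n by linarith
      then show "(\<integral>\<^sup>+x\<in>{-pi..pi}. ennreal (norm (dirichlet (Suc i) x)) \<partial>lborel) \<le> ennreal (50 * ln (real n))"
        by (intro order_trans[OF nn_integral_dirichlet_le ennreal_leI]) simp_all
    qed simp
    also have "\<dots> = ennreal ((\<Sum>i<n-1. norm (b i - b (Suc i))) * (50 * ln (real n)))"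
      using ln_n by (simp add: sum_distrib_right[symmetric] ennreal_mult sum_nonneg)
    finally have "L1_norm h \<le> (\<Sum>i<n-1. norm (b i - b (Suc i))) * (50 * ln (real n))"
      using ln_n by (subst L1_norm_le_iff_nn[OF h]) (auto intro!: mult_nonneg_nonneg sum_nonneg)
    also have "\<dots> \<le> (2 * M + 1) * X * (50 * ln (real n))"
      using ln_n by (intro mult_right_mono b_sum) auto
    also have "\<dots> = 50 * (2 * M + 1) * (X * ln (real n))" by simp
    also have "\<dots> \<le> 50 * (2 * M + 1) * B" using M X by (intro mult_left_mono) auto
    finally show "L1_norm (\<lambda>x. \<Sum>k=n+1..2*n. (complex_of_real ((2 * real n - real k) / real n) * c k) * ek (s * int k) x)
        \<le> 50 * (2 * M + 1) * B" by (simp add: h_def[abs_def])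
  qed
qed

section \<open>The equivalence\<close>

text \<open>
  Both operators agree on the frequencies up to \<open>n\<close>.
\<close>

lemma vdp_minus_partial_sum:
  assumes n: "n \<ge> 1"
  shows "vdp n f x - fourier_partial_sum f n x =
    (\<Sum>k=n+1..2*n. (complex_of_real ((2 * real n - real k) / real n) * fourier_coeff f (int k)) * ek (1 * int k) x) +
    (\<Sum>k=n+1..2*n. (complex_of_real ((2 * real n - real k) / real n) * fourier_coeff f (- int k)) * ek (-1 * int k) x)"
proof -
  define T where "T k = (complex_of_real (vdp_coeff n k) * fourier_coeff f k) * ek k x" for k
  have split: "(\<Sum>k=1..2*n. u k) = (\<Sum>k=1..n. u k) + (\<Sum>k=n+1..2*n. u k)" for u :: "nat \<Rightarrow> complex"
    using sum.ub_add_nat[of 1 n u n] by (simp add: mult_2)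
  have low: "T k = fourier_coeff f k * ek k x" if "\<bar>k\<bar> \<le> int n" for k
    using vdp_coeff_eq(1)[OF n that] by (simp add: T_def)
  have S: "fourier_partial_sum f n x = T 0 + ((\<Sum>k=1..n. T (int k)) + (\<Sum>k=1..n. T (- int k)))"
    unfolding fourier_partial_sum_eq sum_symmetric_int by (simp add: low)
  have V: "vdp n f x = T 0 + ((\<Sum>k=1..2*n. T (int k)) + (\<Sum>k=1..2*n. T (- int k)))"
    unfolding vdp_def T_def[symmetric] by (rule sum_symmetric_int)
  have "vdp n f x - fourier_partial_sum f n x = (\<Sum>k=n+1..2*n. T (int k)) + (\<Sum>k=n+1..2*n. T (- int k))"
    unfolding S V split by simp
  also have "(\<Sum>k=n+1..2*n. T (int k)) = (\<Sum>k=n+1..2*n. (complex_of_real ((2 * real n - real k) / real n) * fourier_coeff f (int k)) * ek (1 * int k) x)"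
    unfolding T_def by (intro sum.cong refl) (simp add: vdp_coeff_eq(2)[OF n])
  also have "(\<Sum>k=n+1..2*n. T (- int k)) = (\<Sum>k=n+1..2*n. (complex_of_real ((2 * real n - real k) / real n) * fourier_coeff f (- int k)) * ek (-1 * int k) x)"
    unfolding T_def by (intro sum.cong refl) (simp add: vdp_coeff_eq(2)[OF n])
  finally show ?thesis .
qed

lemma periodic_L1_remainder: "periodic_L1 f \<Longrightarrow> periodic_L1 (\<lambda>x. f x - fourier_partial_sum f n x)"
  unfolding fourier_partial_sum_eq by (intro periodic_L1_diff periodic_L1_trig)

lemma fourier_coeff_remainder:
  assumes "periodic_L1 f"
  shows "fourier_coeff (\<lambda>x. f x - fourier_partial_sum f n x) k = (if \<bar>k\<bar> \<le> int n then 0 else fourier_coeff f k)"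
  unfolding fourier_partial_sum_eq
  by (subst fourier_coeff_diff[OF assms periodic_L1_trig], subst fourier_coeff_trig) auto

text \<open>
  The test is centred at the frequency \<open>n\<close>, respectively \<open>-n\<close>. The remainder has no frequencies in
  \<open>[-n, n]\<close>, so of the two coefficients at distance \<open>k < 2 n\<close> from the centre only the outer one
  survives.
\<close>

lemma sine_weight_sum_le_remainder:
  assumes f: "periodic_L1 f" and n: "n \<ge> 1"
  shows "norm (\<Sum>k=1..<2*n. complex_of_real (sine_weight (2*n) k) * fourier_coeff f (int (n + k)))
          \<le> 2 * L1_norm (\<lambda>x. f x - fourier_partial_sum f n x)" (is "?pos \<le> _")
    and "norm (\<Sum>k=1..<2*n. complex_of_real (sine_weight (2*n) k) * fourier_coeff f (- int (n + k)))
          \<le> 2 * L1_norm (\<lambda>x. f x - fourier_partial_sum f n x)" (is "?neg \<le> _")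
proof -
  let ?g = "\<lambda>x. f x - fourier_partial_sum f n x"
  have g: "periodic_L1 ?g" by (rule periodic_L1_remainder[OF f])
  have N: "1 \<le> 2 * n" using n by simp
  have "(\<Sum>k=1..<2*n. complex_of_real (sine_weight (2*n) k) * (fourier_coeff ?g (int n - int k) - fourier_coeff ?g (int n + int k)))
      = - (\<Sum>k=1..<2*n. complex_of_real (sine_weight (2*n) k) * fourier_coeff f (int (n + k)))"
    unfolding sum_negf[symmetric]
  proof (intro sum.cong refl)
    fix k assume "k \<in> {1..<2*n}"
    then have "\<bar>int n - int k\<bar> \<le> int n" "\<not> \<bar>int n + int k\<bar> \<le> int n" by auto
    then show "complex_of_real (sine_weight (2*n) k) * (fourier_coeff ?g (int n - int k) - fourier_coeff ?g (int n + int k))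
        = - (complex_of_real (sine_weight (2*n) k) * fourier_coeff f (int (n + k)))"
      by (simp add: fourier_coeff_remainder[OF f])
  qed
  then show "?pos \<le> 2 * L1_norm ?g" using hardy_type_bound[OF g N, of "int n"] by (simp only: norm_minus_cancel)
  have "(\<Sum>k=1..<2*n. complex_of_real (sine_weight (2*n) k) * (fourier_coeff ?g (- int n - int k) - fourier_coeff ?g (- int n + int k)))
      = (\<Sum>k=1..<2*n. complex_of_real (sine_weight (2*n) k) * fourier_coeff f (- int (n + k)))"
  proof (intro sum.cong refl)
    fix k assume "k \<in> {1..<2*n}"
    then have "\<not> \<bar>- int n - int k\<bar> \<le> int n" "\<bar>- int n + int k\<bar> \<le> int n" "- int n - int k = - int (n + k)" by auto
    then show "complex_of_real (sine_weight (2*n) k) * (fourier_coeff ?g (- int n - int k) - fourier_coeff ?g (- int n + int k))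
        = complex_of_real (sine_weight (2*n) k) * fourier_coeff f (- int (n + k))"
      by (simp only: fourier_coeff_remainder[OF f] if_True if_False diff_0_right)
  qed
  then show "?neg \<le> 2 * L1_norm ?g" using hardy_type_bound[OF g N, of "- int n"] by (simp only:)
qed

definition smoothness_bound :: "nat \<Rightarrow> (real \<Rightarrow> complex) \<Rightarrow> real \<Rightarrow> real" where
  "smoothness_bound r g x = (1 / (x + 1)) ^ r * modulus_L g (1 / (x + 1))"

lemma smoothness_bound_eq:
  "(x + 1) powi (- int r) * modulus_L g (1 / (x + 1)) = smoothness_bound r g x"
  by (simp add: smoothness_bound_def power_int_minus power_one_over inverse_eq_divide)

lemma smoothness_bound_nonneg: "periodic_L1 g \<Longrightarrow> 0 \<le> x \<Longrightarrow> 0 \<le> smoothness_bound r g x"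
  unfolding smoothness_bound_def by (intro mult_nonneg_nonneg modulus_L_nonneg) auto

lemma smoothness_bound_antimono:
  assumes "periodic_L1 g" "0 \<le> x" "x \<le> y"
  shows "smoothness_bound r g y \<le> smoothness_bound r g x"
proof -
  have "1 / (y + 1) \<le> 1 / (x + 1)" using assms by (intro divide_left_mono) auto
  then show ?thesis unfolding smoothness_bound_def using assms
    by (intro mult_mono power_mono modulus_L_mono modulus_L_nonneg) auto
qed

text \<open>
  The coefficients with indices \<open>2 n\<close> and \<open>2 n + 1\<close> are estimated through the remainder of order \<open>n\<close>;
  this lemma returns to the bound at the index of the coefficient.
\<close>

lemma smoothness_bound_doubling:
  assumes g: "periodic_L1 g" and j: "j = 2 * n \<or> j = 2 * n + 1"
  shows "smoothness_bound r g (real n) \<le> 2 ^ Suc r * smoothness_bound r g (real j)"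
proof -
  have le: "1 / (real n + 1) \<le> 2 * (1 / (real j + 1))" using j by (auto simp: field_simps)
  have "(1 / (real n + 1)) ^ r \<le> (2 * (1 / (real j + 1))) ^ r" using le by (intro power_mono) auto
  moreover have "modulus_L g (1 / (real n + 1)) \<le> 2 * modulus_L g (1 / (real j + 1))"
    using modulus_L_mono[OF g _ le] modulus_L_double[OF g, of "1 / (real j + 1)"] by auto
  ultimately have "smoothness_bound r g (real n) \<le> (2 * (1 / (real j + 1))) ^ r * (2 * modulus_L g (1 / (real j + 1)))"
    unfolding smoothness_bound_def by (intro mult_mono modulus_L_nonneg[OF g]) auto
  also have "\<dots> = 2 ^ Suc r * smoothness_bound r g (real j)"
    unfolding smoothness_bound_def power_mult_distrib by simp
  finally show ?thesis .
qed

lemma remainder_bound_imp_coeff_bound: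
  assumes f: "periodic_L1 f" and g: "periodic_L1 g"
    and GBV: "GBV (\<lambda>n. fourier_coeff f (int n))" "GBV (\<lambda>n. fourier_coeff f (- int n))"
    and O: "(\<lambda>n::nat. L1_norm (\<lambda>x. f x - fourier_partial_sum f n x)) \<in> O[at_top](\<lambda>n. smoothness_bound r g (real n))"
  shows "(\<lambda>n::int. norm (fourier_coeff f n * complex_of_real (ln \<bar>real_of_int n\<bar>)))
           \<in> O[filtercomap abs at_top](\<lambda>n. smoothness_bound r g \<bar>real_of_int n\<bar>)"
proof -
  let ?L = "\<lambda>n. L1_norm (\<lambda>x. f x - fourier_partial_sum f n x)" and ?\<psi> = "\<lambda>x. smoothness_bound r g x"
  obtain K where K: "K > 0" "eventually (\<lambda>n. norm (?L n) \<le> K * norm (?\<psi> (real n))) at_top"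
    using landau_o.bigE[OF O] by blast
  then obtain n1 where n1: "\<And>n. n \<ge> n1 \<Longrightarrow> ?L n \<le> K * ?\<psi> (real n)"
    using smoothness_bound_nonneg[OF g] by (auto simp: eventually_at_top_linorder L1_norm_nonneg)
  obtain Cp np where Cp: "Cp \<ge> 0" "\<And>n j B. n \<ge> np \<Longrightarrow> j = 2*n \<or> j = 2*n+1 \<Longrightarrow>
      norm (\<Sum>k=1..<2*n. complex_of_real (sine_weight (2*n) k) * fourier_coeff f (int (n + k))) \<le> B
        \<Longrightarrow> norm (fourier_coeff f (int j)) * ln (real j) \<le> Cp * B"
    by (rule GBV_log_bound[OF GBV(1)]) blast
  obtain Cm nm where Cm: "Cm \<ge> 0" "\<And>n j B. n \<ge> nm \<Longrightarrow> j = 2*n \<or> j = 2*n+1 \<Longrightarrow>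
      norm (\<Sum>k=1..<2*n. complex_of_real (sine_weight (2*n) k) * fourier_coeff f (- int (n + k))) \<le> B
        \<Longrightarrow> norm (fourier_coeff f (- int j)) * ln (real j) \<le> Cm * B"
    by (rule GBV_log_bound[OF GBV(2)]) blast
  define n2 where "n2 = n1 + np + nm + 1"
  define C where "C = (Cp + Cm) * (2 * K * 2 ^ Suc r)"
  have bound: "norm (fourier_coeff f m) * ln (real j) \<le> C * ?\<psi> (real j)"
    if j: "j \<ge> 2 * n2" and m: "m = int j \<or> m = - int j" for j m
  proof -
    \<comment> \<open>The coefficient of index \<open>j\<close> is seen by the remainder of order \<open>j div 2\<close>.\<close>
    define n where "n = j div 2"
    have n: "n \<ge> n2" "j = 2 * n \<or> j = 2 * n + 1" using j by (auto simp: n_def)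
    then have ge: "n \<ge> n1" "n \<ge> np" "n \<ge> nm" "n \<ge> 1" by (auto simp: n2_def)
    have L0: "0 \<le> 2 * ?L n" by (simp add: L1_norm_nonneg)
    have "norm (fourier_coeff f m) * ln (real j) \<le> (Cp + Cm) * (2 * ?L n)"
      using m
    proof
      assume "m = int j"
      then have "norm (fourier_coeff f m) * ln (real j) \<le> Cp * (2 * ?L n)"
        using Cp(2)[OF ge(2) n(2) sine_weight_sum_le_remainder(1)[OF f ge(4)]] by simp
      then show ?thesis using mult_nonneg_nonneg[OF Cm(1) L0] by (simp add: distrib_right)
    next
      assume "m = - int j"
      then have "norm (fourier_coeff f m) * ln (real j) \<le> Cm * (2 * ?L n)"
        using Cm(2)[OF ge(3) n(2) sine_weight_sum_le_remainder(2)[OF f ge(4)]] by simp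
      then show ?thesis using mult_nonneg_nonneg[OF Cp(1) L0] by (simp add: distrib_right)
    qed
    also have "\<dots> \<le> (Cp + Cm) * (2 * (K * (2 ^ Suc r * ?\<psi> (real j))))"
    proof (intro mult_left_mono)
      have "?L n \<le> K * ?\<psi> (real n)" by (rule n1[OF ge(1)])
      also have "\<dots> \<le> K * (2 ^ Suc r * ?\<psi> (real j))"
        using K(1) by (intro mult_left_mono smoothness_bound_doubling[OF g n(2)]) auto
      finally show "?L n \<le> K * (2 ^ Suc r * ?\<psi> (real j))" .
    qed (use Cp(1) Cm(1) in auto)
    finally show ?thesis by (simp add: C_def mult_ac)
  qed
  show ?thesis
  proof (rule landau_o.bigI[where c = "C + 1"])
    show "C + 1 > 0" using Cp(1) Cm(1) K(1) by (simp add: C_def add_nonneg_pos)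
    show "\<forall>\<^sub>F m in filtercomap abs at_top. norm (norm (fourier_coeff f m * complex_of_real (ln \<bar>real_of_int m\<bar>))) \<le> (C + 1) * norm (?\<psi> \<bar>real_of_int m\<bar>)"
      unfolding eventually_filtercomap_at_top_linorder
    proof (intro exI[of _ "2 * int n2"] allI impI)
      fix m :: int assume m: "\<bar>m\<bar> \<ge> 2 * int n2"
      define j where "j = nat \<bar>m\<bar>"
      have j: "j \<ge> 2 * n2" "m = int j \<or> m = - int j" "\<bar>real_of_int m\<bar> = real j" using m by (auto simp: j_def)
      have "1 \<le> j" using j(1) by (simp add: n2_def)
      then have "norm (fourier_coeff f m * complex_of_real (ln \<bar>real_of_int m\<bar>)) = norm (fourier_coeff f m) * ln (real j)"
        by (simp add: norm_mult j(3))
      also have "\<dots> \<le> C * ?\<psi> (real j)" by (rule bound[OF j(1,2)])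
      also have "\<dots> \<le> (C + 1) * ?\<psi> (real j)" using smoothness_bound_nonneg[OF g, of "real j" r] by (intro mult_right_mono) auto
      finally show "norm (norm (fourier_coeff f m * complex_of_real (ln \<bar>real_of_int m\<bar>))) \<le> (C + 1) * norm (?\<psi> \<bar>real_of_int m\<bar>)"
        using smoothness_bound_nonneg[OF g, of "real j" r] by (simp add: j(3))
    qed
  qed
qed

text \<open>
  The remainder of the partial sum is the remainder of the de la Vallee Poussin mean plus two blocks
  of coefficients, with positive and with negative frequencies.
\<close>

lemma coeff_bound_imp_remainder_bound:
  assumes f: "periodic_L1 f" and g: "periodic_L1 g"
    and GBV: "GBV (\<lambda>n. fourier_coeff f (int n))" "GBV (\<lambda>n. fourier_coeff f (- int n))"
    and jackson: "\<And>n. n \<ge> 1 \<Longrightarrow> L1_norm (vdp_rest n f) \<le> A * smoothness_bound r g (real n)"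
    and O: "(\<lambda>n::int. norm (fourier_coeff f n * complex_of_real (ln \<bar>real_of_int n\<bar>)))
           \<in> O[filtercomap abs at_top](\<lambda>n. smoothness_bound r g \<bar>real_of_int n\<bar>)"
  shows "(\<lambda>n::nat. L1_norm (\<lambda>x. f x - fourier_partial_sum f n x)) \<in> O[at_top](\<lambda>n. smoothness_bound r g (real n))"
proof -
  let ?L = "\<lambda>n. L1_norm (\<lambda>x. f x - fourier_partial_sum f n x)" and ?\<psi> = "\<lambda>x. smoothness_bound r g x"
  obtain K where K: "K > 0" "eventually (\<lambda>m. norm (norm (fourier_coeff f m * complex_of_real (ln \<bar>real_of_int m\<bar>)))
      \<le> K * norm (?\<psi> \<bar>real_of_int m\<bar>)) (filtercomap abs at_top)"
    using landau_o.bigE[OF O] by blast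
  then obtain m1 where m1: "\<And>m. \<bar>m\<bar> \<ge> m1 \<Longrightarrow> norm (fourier_coeff f m * complex_of_real (ln \<bar>real_of_int m\<bar>)) \<le> K * ?\<psi> \<bar>real_of_int m\<bar>"
    using smoothness_bound_nonneg[OF g] by (auto simp: eventually_filtercomap_at_top_linorder)
  obtain Cp np where Cp: "Cp \<ge> 0" "\<And>n B. n \<ge> np \<Longrightarrow> (\<And>k. k \<ge> n \<Longrightarrow> norm (fourier_coeff f (int k)) * ln (real k) \<le> B) \<Longrightarrow>
      L1_norm (\<lambda>x. \<Sum>k=n+1..2*n. (complex_of_real ((2 * real n - real k) / real n) * fourier_coeff f (int k)) * ek (1 * int k) x) \<le> Cp * B"
    by (rule GBV_block_norm_le[OF GBV(1), of 1]) auto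
  obtain Cm nm where Cm: "Cm \<ge> 0" "\<And>n B. n \<ge> nm \<Longrightarrow> (\<And>k. k \<ge> n \<Longrightarrow> norm (fourier_coeff f (- int k)) * ln (real k) \<le> B) \<Longrightarrow>
      L1_norm (\<lambda>x. \<Sum>k=n+1..2*n. (complex_of_real ((2 * real n - real k) / real n) * fourier_coeff f (- int k)) * ek (-1 * int k) x) \<le> Cm * B"
    by (rule GBV_block_norm_le[OF GBV(2), of "-1"]) auto
  define n2 where "n2 = nat m1 + np + nm + 1"
  define C where "C = \<bar>A\<bar> + (Cp + Cm) * K"
  have bound: "?L n \<le> C * ?\<psi> (real n)" if n: "n \<ge> n2" for n
  proof -
    have ge: "n \<ge> nat m1" "n \<ge> np" "n \<ge> nm" "n \<ge> 1" using n by (auto simp: n2_def)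
    have coeff: "norm (fourier_coeff f m) * ln (real k) \<le> K * ?\<psi> (real n)" if k: "k \<ge> n" "m = int k \<or> m = - int k" for k m
    proof -
      have mk: "\<bar>m\<bar> \<ge> m1" "\<bar>real_of_int m\<bar> = real k" "1 \<le> k" using k ge by auto
      then have "norm (fourier_coeff f m) * ln (real k) = norm (fourier_coeff f m * complex_of_real (ln \<bar>real_of_int m\<bar>))"
        by (simp add: norm_mult)
      also have "\<dots> \<le> K * ?\<psi> (real k)" using m1[OF mk(1)] by (simp add: mk(2))
      also have "\<dots> \<le> K * ?\<psi> (real n)" using K(1) k(1) by (intro mult_left_mono smoothness_bound_antimono[OF g]) auto
      finally show ?thesis .
    qed
    define p where "p x = (\<Sum>k=n+1..2*n. (complex_of_real ((2 * real n - real k) / real n) * fourier_coeff f (int k)) * ek (1 * int k) x)" for x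
    define q where "q x = (\<Sum>k=n+1..2*n. (complex_of_real ((2 * real n - real k) / real n) * fourier_coeff f (- int k)) * ek (-1 * int k) x)" for x
    have pq: "periodic_L1 p" "periodic_L1 q"
      unfolding p_def[abs_def] q_def[abs_def] by (intro periodic_L1_continuous continuous_intros; simp)+
    have "f x - fourier_partial_sum f n x = vdp_rest n f x + (p x + q x)" for x
      using vdp_minus_partial_sum[OF ge(4), of f x] unfolding vdp_rest_def p_def q_def by (simp add: algebra_simps)
    then have "?L n = L1_norm (\<lambda>x. vdp_rest n f x + (p x + q x))" by simp
    also have "\<dots> \<le> L1_norm (vdp_rest n f) + (L1_norm p + L1_norm q)"
      using L1_norm_triangle[OF periodic_L1_vdp_rest[OF f, of n] periodic_L1_add[OF pq]] L1_norm_triangle[OF pq] by simp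
    also have "\<dots> \<le> \<bar>A\<bar> * ?\<psi> (real n) + (Cp * (K * ?\<psi> (real n)) + Cm * (K * ?\<psi> (real n)))"
    proof (intro add_mono)
      have "A * ?\<psi> (real n) \<le> \<bar>A\<bar> * ?\<psi> (real n)" by (intro mult_right_mono smoothness_bound_nonneg[OF g]) auto
      with jackson[OF ge(4)] show "L1_norm (vdp_rest n f) \<le> \<bar>A\<bar> * ?\<psi> (real n)" by (rule order_trans)
      show "L1_norm p \<le> Cp * (K * ?\<psi> (real n))" unfolding p_def[abs_def] by (rule Cp(2)[OF ge(2)]) (rule coeff, auto)
      show "L1_norm q \<le> Cm * (K * ?\<psi> (real n))" unfolding q_def[abs_def] by (rule Cm(2)[OF ge(3)]) (rule coeff, auto)
    qed
    also have "\<dots> = C * ?\<psi> (real n)" by (simp add: C_def algebra_simps)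
    finally show ?thesis .
  qed
  show ?thesis
  proof (rule landau_o.bigI[where c = "C + 1"])
    show "C + 1 > 0" using Cp(1) Cm(1) K(1) by (simp add: C_def add_nonneg_pos)
    show "\<forall>\<^sub>F n in at_top. norm (?L n) \<le> (C + 1) * norm (?\<psi> (real n))"
      unfolding eventually_at_top_linorder
    proof (intro exI[of _ n2] allI impI)
      fix n assume "n \<ge> n2"
      then have "?L n \<le> C * ?\<psi> (real n)" by (rule bound)
      also have "\<dots> \<le> (C + 1) * ?\<psi> (real n)" using smoothness_bound_nonneg[OF g, of "real n" r] by (intro mult_right_mono) auto
      finally show "norm (?L n) \<le> (C + 1) * norm (?\<psi> (real n))"
        using smoothness_bound_nonneg[OF g, of "real n" r] by (simp add: L1_norm_nonneg)
    qed
  qed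
qed

theorem corollary3:
  fixes r :: nat and f :: "real \<Rightarrow> complex"
  assumes "r \<ge> 1"
    and "f \<in> L2pi"
    and "GBV (\<lambda>n. fourier_coeff f (int n))"
    and "GBV (\<lambda>n. fourier_coeff f (- int n))"
    and "\<And>k x. Suc k < r \<Longrightarrow> nth_vderiv k f differentiable (at x)"
    and "\<And>k. k < r \<Longrightarrow> absolutely_continuous_on {-pi..pi} (nth_vderiv k f)"
  shows "(\<lambda>n::nat. L1_norm (\<lambda>x. f x - fourier_partial_sum f n x))
            \<in> O[at_top](\<lambda>n. (real n + 1) powi (- int r) *
                          modulus_L (nth_vderiv r f) (1 / (real n + 1)))
         \<longleftrightarrow>
         (\<lambda>n::int. norm (fourier_coeff f n * complex_of_real (ln \<bar>real_of_int n\<bar>)))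
            \<in> O[filtercomap abs at_top](\<lambda>n. (\<bar>real_of_int n\<bar> + 1) powi (- int r) *
                          modulus_L (nth_vderiv r f) (1 / (\<bar>real_of_int n\<bar> + 1)))"
proof -
  obtain F where per: "\<And>j. j \<le> r \<Longrightarrow> periodic_L1 (F j)" and prim: "\<And>j. j < r \<Longrightarrow> primitive (F j) (F (Suc j))"
    and F0: "F 0 = f" and mod: "\<And>t. modulus_L (nth_vderiv r f) t = modulus_L (F r) t"
    using derivative_chain[OF assms(1,2,5,6)] by blast
  have f: "periodic_L1 f" and g: "periodic_L1 (F r)" using per[of 0] per[of r] F0 by auto
  have jackson: "L1_norm (vdp_rest n f) \<le> (4104 * 1026 ^ r) * smoothness_bound r (F r) (real n)" if "n \<ge> 1" for n
    using vdp_rest_norm_le_modulus[of n r F, OF that per prim] unfolding F0 smoothness_bound_def .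
  show ?thesis
    unfolding mod smoothness_bound_eq
    using remainder_bound_imp_coeff_bound[OF f g assms(3,4)]
      coeff_bound_imp_remainder_bound[OF f g assms(3,4) jackson] by blast
qed

end
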